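(* Let $T$ be either a linear or a linearizable operator acting on functions defined on $\mathbb{R}^n$. Fix $1\le p,q<\infty$, $\theta>0$, and $1<s<\infty$. Suppose that there exists an increasing function $\phi:[1,\infty)\to[0,\infty)$ such that for all weights $w$ with $w^\theta\in A_s$ and each $f\in L^p(w^p)$, $$\|Tf\|_{L^q(w^q)}\le\phi\big([w^\theta]_{A_s}\big)\,\|f\|_{L^p(w^p)}.$$ Then, for each $b\in\mathcal{BMO}$ and for every weight $w$ with $w^\theta\in A_s$, we have $$\big\|[T,b]f\big\|_{L^q(w^q)}\le\frac{2^{2\max\{s,s'\}+n+2}\,\theta}{\min\{1,s-1\}}\,[w^\theta]_{A_s}^{\max\{1,\frac1{s-1}\}}\,\phi\Big(4^{\min\{1,s-1\}}\,2^s\,[w^\theta]_{A_s}\Big)\,\|b\|_{\mathcal{BMO}}\,\|f\|_{L^p(w^p)};$$ and, for every $k\ge2$, $$\big\|T_b^kf\big\|_{L^q(w^q)}\le k!\Big(\frac{2^{2\max\{s,s'\}+n+2}\,\theta}{\min\{1,s-1\}}\Big)^k\,[w^\theta]_{A_s}^{k\max\{1,\frac1{s-1}\}}\,\phi\Big(4^{\min\{1,s-1\}}\,2^s\,[w^\theta]_{A_s}\Big)\,\|b\|_{\mathcal{BMO}}^k\,\|f\|_{L^p(w^p)},$$ where $\frac1s+\frac1{s'}=1$.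
   Context: A weight is a non-negative locally integrable function on $\mathbb{R}^n$; $\|f\|_{L^p(w)}=(\int_{\mathbb{R}^n}|f|^p w\,dx)^{1/p}$. $Q$ denotes cubes in $\mathbb{R}^n$ with sides parallel to the axes and $f_Q=\frac1{|Q|}\int_Q f\,dx$. For $1<s<\infty$, $w\in A_s$ means $$[w]_{A_s}:=\sup_Q\Big(\frac1{|Q|}\int_Q w\,dx\Big)\Big(\frac1{|Q|}\int_Q w^{1-s'}\,dx\Big)^{s-1}<\infty.$$ $\|f\|_{\exp L,Q}:=\inf\{\lambda>0:\ \frac1{|Q|}\int_Q e^{|f|/\lambda}\,dx\le 2\}$, and $\mathcal{BMO}$ is the space of locally integrable $b$ with $\|b\|_{\mathcal{BMO}}:=\sup_Q\|b-b_Q\|_{\exp L,Q}<\infty$. Commutators (defined whenever they make sense): for linear $T$, $T_b^1f=[T,b]f=T(bf)-b\,Tf$ and $T_b^k=[T_b^{k-1},b]$ for $k\ge2$; equivalently $T_b^kf(x)=T\big((b(\cdot)-b(x))^kf(\cdot)\big)(x)$. A sublinear operator $T$ is linearizable if there exist a Banach space $\mathbb{B}$ and a $\mathbb{B}$-valued linear operator $\mathcal{T}$ such that $Tf(x)=\|\mathcal{T}f(x)\|_{\mathbb{B}}$; in that case $T_b^kf(x):=\|\mathcal{T}_b^kf(x)\|_{\mathbb{B}}$ and $[T,b]f:=T^1_bf$. *)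

theory Defs
  imports "HOL-Analysis.Analysis"
begin

section \<open>Complex Banach spaces\<close>

text \<open>HOL-Analysis only has real Banach spaces. Commutators with complex symbols need a complex
  scalar multiplication which extends the real one and for which the norm is homogeneous.\<close>

class complex_banach = banach +
  fixes scaleC :: "complex \<Rightarrow> 'a \<Rightarrow> 'a"  (infixr \<open>*\<^sub>C\<close> 75)
  assumes scaleC_of_real: "of_real r *\<^sub>C x = r *\<^sub>R x"
    and scaleC_add_right: "c *\<^sub>C (x + y) = c *\<^sub>C x + c *\<^sub>C y"
    and scaleC_add_left: "(c + d) *\<^sub>C x = c *\<^sub>C x + d *\<^sub>C x"
    and scaleC_scaleC: "c *\<^sub>C d *\<^sub>C x = (c * d) *\<^sub>C x"
    and norm_scaleC: "norm (c *\<^sub>C x) = norm c * norm x"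

instantiation complex :: complex_banach
begin

definition scaleC_complex :: "complex \<Rightarrow> complex \<Rightarrow> complex"
  where "scaleC_complex c x = c * x"

instance
  by standard
    (simp_all add: scaleC_complex_def scaleR_conv_of_real algebra_simps norm_mult)

end

section \<open>Weights, averages over cubes, and the classes \<open>A\<^sub>s\<close>\<close>

definition cubes :: "(real ^ 'n) set set"
  where "cubes = {cbox a (\<chi> i. a $ i + l) | a l. 0 < l}"

definition locally_integrable :: "(real ^ 'n \<Rightarrow> 'a :: euclidean_space) \<Rightarrow> bool"
  where "locally_integrable f \<longleftrightarrow> (\<forall>K. compact K \<longrightarrow> f absolutely_integrable_on K)"

definition weight :: "(real ^ 'n \<Rightarrow> real) \<Rightarrow> bool"
  where "weight w \<longleftrightarrow> (\<forall>x. 0 \<le> w x) \<and> locally_integrable w"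

definition average :: "(real ^ 'n) set \<Rightarrow> (real ^ 'n \<Rightarrow> complex) \<Rightarrow> complex"
  where "average Q f = (LINT x:Q|lebesgue. f x) /\<^sub>R measure lebesgue Q"

text \<open>The average of a non-negative function, which may be infinite.\<close>

definition nn_average :: "(real ^ 'n) set \<Rightarrow> (real ^ 'n \<Rightarrow> real) \<Rightarrow> ennreal"
  where "nn_average Q g = (\<integral>\<^sup>+ x \<in> Q. ennreal (g x) \<partial>lebesgue) / emeasure lebesgue Q"

text \<open>Powers with a positive exponent on the extended half-line.\<close>

definition ennreal_powr :: "ennreal \<Rightarrow> real \<Rightarrow> ennreal"
  where "ennreal_powr t a = (if t = \<infinity> then \<infinity> else ennreal (enn2real t powr a))"

definition dual_exponent :: "real \<Rightarrow> real"
  where "dual_exponent s = s / (s - 1)"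

lemma dual_exponent: "1 < s \<Longrightarrow> 1 / s + 1 / dual_exponent s = 1"
  by (simp add: dual_exponent_def field_simps)

definition A_const :: "real \<Rightarrow> (real ^ 'n \<Rightarrow> real) \<Rightarrow> ennreal"
  where "A_const s w =
    (SUP Q \<in> cubes. nn_average Q w *
       ennreal_powr (nn_average Q (\<lambda>x. w x powr (1 - dual_exponent s))) (s - 1))"

text \<open>The exponent \<open>1 - s'\<close> is negative, so \<open>w powr (1 - s')\<close> is infinite where \<open>w\<close> vanishes, whereas
  \<open>0 powr a = 0\<close> in HOL; moreover \<open>0 * \<infinity> = 0\<close> in \<^typ>\<open>ennreal\<close>. A weight which vanishes on a set of
  positive measure does not belong to \<open>A\<^sub>s\<close>, so almost everywhere positivity is made explicit.
  It also gives \<open>A_const s w \<ge> 1\<close>.\<close>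

definition A_class :: "real \<Rightarrow> (real ^ 'n \<Rightarrow> real) set"
  where "A_class s = {w. weight w \<and> (AE x in lebesgue. 0 < w x) \<and> A_const s w < \<infinity>}"

definition A_norm :: "real \<Rightarrow> (real ^ 'n \<Rightarrow> real) \<Rightarrow> real"
  where "A_norm s w = enn2real (A_const s w)"

section \<open>\<open>BMO\<close>\<close>

definition expL_norm :: "(real ^ 'n) set \<Rightarrow> (real ^ 'n \<Rightarrow> complex) \<Rightarrow> ennreal"
  where "expL_norm Q f =
    (INF t \<in> {t. 0 < t \<and> nn_average Q (\<lambda>x. exp (norm (f x) / t)) \<le> 2}. ennreal t)"

definition BMO_seminorm :: "(real ^ 'n \<Rightarrow> complex) \<Rightarrow> ennreal"
  where "BMO_seminorm b = (SUP Q \<in> cubes. expL_norm Q (\<lambda>x. b x - average Q b))"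

definition BMO :: "(real ^ 'n \<Rightarrow> complex) set"
  where "BMO = {b. locally_integrable b \<and> BMO_seminorm b < \<infinity>}"

definition BMO_norm :: "(real ^ 'n \<Rightarrow> complex) \<Rightarrow> real"
  where "BMO_norm b = enn2real (BMO_seminorm b)"

section \<open>Weighted Lebesgue spaces\<close>

definition Lp_space ::
    "real \<Rightarrow> (real ^ 'n \<Rightarrow> real) \<Rightarrow> (real ^ 'n \<Rightarrow> 'a :: real_normed_vector) set"
  where "Lp_space p v = {f. f \<in> borel_measurable lebesgue \<and>
    integrable lebesgue (\<lambda>x. norm (f x) powr p * v x)}"

definition Lp_norm ::
    "real \<Rightarrow> (real ^ 'n \<Rightarrow> real) \<Rightarrow> (real ^ 'n \<Rightarrow> 'a :: real_normed_vector) \<Rightarrow> real"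
  where "Lp_norm p v f = (LINT x|lebesgue. norm (f x) powr p * v x) powr (1 / p)"

section \<open>Linear and linearizable operators and their commutators\<close>

text \<open>Operators act on functions up to equality almost everywhere. The set \<open>D\<close> is the domain, a
  complex vector space of functions; \<open>T f\<close> is irrelevant for \<open>f \<notin> D\<close>.\<close>

definition linear_operator_on ::
    "(real ^ 'n \<Rightarrow> complex) set \<Rightarrow>
     ((real ^ 'n \<Rightarrow> complex) \<Rightarrow> real ^ 'n \<Rightarrow> 'b :: complex_banach) \<Rightarrow> bool"
  where "linear_operator_on D T \<longleftrightarrow> (\<forall>f\<in>D. \<forall>g\<in>D. \<forall>\<alpha> \<beta>.
    (\<lambda>x. \<alpha> * f x + \<beta> * g x) \<in> D \<and>
    (AE x in lebesgue. T (\<lambda>x. \<alpha> * f x + \<beta> * g x) x = \<alpha> *\<^sub>C T f x + \<beta> *\<^sub>C T g x))"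

text \<open>\<open>L\<close> is a vector-valued linear operator which linearizes \<open>T\<close>. Sublinearity of \<open>T\<close> is a
  consequence.\<close>

definition linearizes_on ::
    "(real ^ 'n \<Rightarrow> complex) set \<Rightarrow>
     ((real ^ 'n \<Rightarrow> complex) \<Rightarrow> real ^ 'n \<Rightarrow> 'b :: complex_banach) \<Rightarrow>
     ((real ^ 'n \<Rightarrow> complex) \<Rightarrow> real ^ 'n \<Rightarrow> real) \<Rightarrow> bool"
  where "linearizes_on D L T \<longleftrightarrow> linear_operator_on D L \<and>
    (\<forall>f\<in>D. AE x in lebesgue. T f x = norm (L f x))"

definition commutator ::
    "((real ^ 'n \<Rightarrow> complex) \<Rightarrow> real ^ 'n \<Rightarrow> 'b :: complex_banach) \<Rightarrow> (real ^ 'n \<Rightarrow> complex) \<Rightarrow>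
     (real ^ 'n \<Rightarrow> complex) \<Rightarrow> real ^ 'n \<Rightarrow> 'b"
  where "commutator T b f = (\<lambda>x. T (\<lambda>y. b y * f y) x - b x *\<^sub>C T f x)"

definition iter_commutator ::
    "nat \<Rightarrow> ((real ^ 'n \<Rightarrow> complex) \<Rightarrow> real ^ 'n \<Rightarrow> 'b :: complex_banach) \<Rightarrow>
     (real ^ 'n \<Rightarrow> complex) \<Rightarrow> (real ^ 'n \<Rightarrow> complex) \<Rightarrow> real ^ 'n \<Rightarrow> 'b"
  where "iter_commutator k T b = ((\<lambda>S. commutator S b) ^^ k) T"

text \<open>For \<open>T = norm \<circ> L\<close> the iterated commutator of the sublinear operator \<open>T\<close> is by definition the
  norm of that of its linearization \<open>L\<close>.\<close>

definition linearized_commutator ::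
    "nat \<Rightarrow> ((real ^ 'n \<Rightarrow> complex) \<Rightarrow> real ^ 'n \<Rightarrow> 'b :: complex_banach) \<Rightarrow>
     (real ^ 'n \<Rightarrow> complex) \<Rightarrow> (real ^ 'n \<Rightarrow> complex) \<Rightarrow> real ^ 'n \<Rightarrow> real"
  where "linearized_commutator k L b f = (\<lambda>x. norm (iter_commutator k L b f x))"

section \<open>The weighted estimates\<close>

text \<open>Membership of \<open>f\<close> in the domain \<open>D\<close> is part of the hypothesis on \<open>T\<close>.\<close>

definition weighted_bound ::
    "real \<Rightarrow> real \<Rightarrow> real \<Rightarrow> real \<Rightarrow> (real \<Rightarrow> real) \<Rightarrow> (real ^ 'n \<Rightarrow> complex) set \<Rightarrow>
     ((real ^ 'n \<Rightarrow> complex) \<Rightarrow> real ^ 'n \<Rightarrow> 'a :: real_normed_vector) \<Rightarrow> bool"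
  where "weighted_bound p q \<theta> s \<phi> D T \<longleftrightarrow>
    (\<forall>w. weight w \<and> (\<lambda>x. w x powr \<theta>) \<in> A_class s \<longrightarrow>
      (\<forall>f \<in> Lp_space p (\<lambda>x. w x powr p).
         f \<in> D \<and> T f \<in> Lp_space q (\<lambda>x. w x powr q) \<and>
         Lp_norm q (\<lambda>x. w x powr q) (T f) \<le>
           \<phi> (A_norm s (\<lambda>x. w x powr \<theta>)) * Lp_norm p (\<lambda>x. w x powr p) f))"

end

theory Submission
  imports Defs
begin

text \<open>The commutator \<open>T\<^sub>b\<^sup>k f(x)\<close> is the \<open>k\<close>-th derivative at \<open>z = 0\<close> of \<open>e\<^bsup>-zb(x)\<^esup> T(e\<^bsup>zb\<^esup> f)(x)\<close>. Cauchy's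
  formula on a circle \<open>|z| = \<epsilon>\<close> bounds it by \<open>k! \<epsilon>\<^bsup>-k\<^esup>\<close> times the norm of \<open>T\<close> for the weights
  \<open>w e\<^bsup>-Re(zb)\<^esup>\<close>. Their \<open>\<theta>\<close>-th powers stay in \<open>A\<^sub>s\<close> with a controlled constant as long as
  \<open>\<epsilon> \<parallel>b\<parallel>\<close> is small compared with the gain of integrability in the reverse Hoelder inequality for
  \<open>w\<^sup>\<theta>\<close> and for its dual weight, because then Hoelder's inequality and the definition of the norm of
  \<open>exp L\<close> control the averages of \<open>w\<^sup>\<theta> e\<^bsup>-\<theta> Re(zb)\<^esup>\<close>.

  A priori \<open>w e\<^bsup>-Re(zb)\<^esup>\<close> need not be locally integrable and \<open>e\<^bsup>zb\<^esup> f\<close> need not lie in the domain of \<open>T\<close>.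
  Therefore \<open>b\<close> is replaced in the weight by its radial truncation, which has no larger oscillation,
  and \<open>f\<close> is first cut off to a set where \<open>b\<close> is bounded; there the exponential can be replaced by a
  Taylor polynomial and the contour integral by a finite sum.\<close>

section \<open>Dyadic cubes and the good-lambda inequality\<close>

text \<open>The radius is \<epsilon> = 1 / (\<open>bmo_const\<close> * t) with t slightly above
  \<open>BMO_norm b\<close>. For v = w^\<theta> the good-lambda argument yields the reverse Hoelder
  exponent 1 + \<delta> with 1/\<delta> = 2^(2m+n) [v] and m = max s s'; Hoelder's inequality then
  asks for exponential integrability of order 1 + 1/\<delta>. The dual weight makes the same demand.
  Its constant is at most [v]^(1/(s-1)), and its exponent carries the factor s' - 1 = 1/(s-1). This
  is the origin of max 1 (1/(s-1)) and of 1 / min 1 (s-1). Each of the two Hoelder steps loses a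
  factor 2, which gives 2 * 2^(s-1) = 2^s in the perturbed constant. Removing the cutoff of f meets
  an obstacle: b^j f may leave L^p(w^p), so T(b^j f) cannot be controlled with w. A further weight
  w' = w e^(-c|b|) puts all these functions into one space on which T is bounded. Convergence there
  gives a subsequence converging almost everywhere, and Fatou's lemma for w then preserves the
  constant found for cut-off functions.\<close>

definition hcube :: "real ^ 'n \<Rightarrow> real \<Rightarrow> (real ^ 'n) set"
  where "hcube a l = {x. \<forall>i. a $ i \<le> x $ i \<and> x $ i < a $ i + l}"

text \<open>A child is indexed by the set S of coordinates in which it occupies the upper half.
  Since the cubes are half-open, the 2^n children partition their parent exactly.\<close>

definition subcorner :: "real ^ 'n \<Rightarrow> real \<Rightarrow> 'n set \<Rightarrow> real ^ 'n"
  where "subcorner a l S = (\<chi> i. a $ i + (if i \<in> S then l / 2 else 0))"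

lemma box_subset_hcube: "box a (\<chi> i. a $ i + l) \<subseteq> hcube a l"
  by (auto simp: hcube_def mem_box_cart less_imp_le)

lemma hcube_subset_cbox: "hcube a l \<subseteq> cbox a (\<chi> i. a $ i + l)"
  by (auto simp: hcube_def mem_box_cart less_imp_le)

lemma negligible_cbox_diff_hcube: "negligible (cbox a (\<chi> i. a $ i + l) - hcube a l)"
  by (rule negligible_subset[OF negligible_frontier_interval[of a "\<chi> i. a $ i + l"]])
    (use box_subset_hcube in blast)

lemma hcube_sets [measurable]: "hcube a l \<in> sets borel" "hcube a l \<in> sets lebesgue"
proof -
  have "hcube a l = (\<Inter>i. {x. a $ i \<le> x $ i} \<inter> {x. x $ i < a $ i + l})"
    by (auto simp: hcube_def)
  also have "\<dots> \<in> sets borel"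
    by (intro sets.countable_INT'') (auto intro!: borel_measurable_le borel_measurable_less)
  finally show "hcube a l \<in> sets borel" .
  then show "hcube a l \<in> sets lebesgue"
    by (simp add: sets_completionI_sets)
qed

lemma emeasure_cube:
  assumes "0 < l"
  shows "emeasure lebesgue (cbox a (\<chi> i. a $ i + l) :: (real ^ 'n) set) = ennreal (l ^ CARD('n))"
proof -
  have "emeasure lebesgue (cbox a (\<chi> i. a $ i + l) :: (real ^ 'n) set) =
      ennreal (measure lebesgue (cbox a (\<chi> i. a $ i + l)))"
    by (simp add: emeasure_eq_ennreal_measure emeasure_lborel_cbox_eq)
  also have "measure lebesgue (cbox a (\<chi> i. a $ i + l)) = l ^ CARD('n)"
  proof -
    have "cbox a (\<chi> i. a $ i + l) \<noteq> {}"
      using assms by (auto simp: interval_ne_empty_cart less_imp_le)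
    then show ?thesis
      by (simp add: content_cbox_cart)
  qed
  finally show ?thesis .
qed

text \<open>Bisection needs half-open cubes, whereas the averages in \<open>A_const\<close> run over
  closed ones; the two differ by a null set.\<close>

lemma AE_hcube_cbox: "AE x in lebesgue. x \<in> hcube a l \<longleftrightarrow> x \<in> cbox a (\<chi> i. a $ i + l)"
proof -
  have "cbox a (\<chi> i. a $ i + l) - hcube a l \<in> null_sets lebesgue"
    using negligible_cbox_diff_hcube negligible_iff_null_sets by blast
  then show ?thesis
    by (rule AE_I') (use hcube_subset_cbox in auto)
qed

lemma emeasure_hcube:
  assumes "0 < l"
  shows "emeasure lebesgue (hcube a l :: (real ^ 'n) set) = ennreal (l ^ CARD('n))"
  using emeasure_cube[OF assms, of a] emeasure_eq_AE[OF AE_hcube_cbox, of a l] by simp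

lemma hcube_subcorner_subset:
  assumes "0 < l"
  shows "hcube (subcorner a l S) (l / 2) \<subseteq> hcube a l"
proof
  fix x assume x: "x \<in> hcube (subcorner a l S) (l / 2)"
  have "a $ i \<le> x $ i \<and> x $ i < a $ i + l" for i
    using x assms unfolding hcube_def subcorner_def
    by (cases "i \<in> S") (auto dest!: spec[where x=i])
  then show "x \<in> hcube a l"
    by (simp add: hcube_def)
qed

lemma disjoint_hcube_subcorner:
  "disjoint_family (\<lambda>S. hcube (subcorner a l S) (l / 2))"
proof (clarsimp simp: disjoint_family_on_def disjoint_iff)
  fix S S' :: "'a set" and x
  assume *: "S \<noteq> S'" "x \<in> hcube (subcorner a l S) (l / 2)" "x \<in> hcube (subcorner a l S') (l / 2)"
  then obtain i where "(i \<in> S) \<noteq> (i \<in> S')"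
    by auto
  then show False
    using *(2,3) by (auto simp: hcube_def subcorner_def dest!: spec[where x=i])
qed

lemma hcube_eq_UN:
  assumes "0 < l"
  shows "hcube a l = (\<Union>S. hcube (subcorner a l S) (l / 2))" (is "_ = ?R")
proof
  show "?R \<subseteq> hcube a l"
    using hcube_subcorner_subset[OF assms] by blast
  show "hcube a l \<subseteq> ?R"
  proof
    fix x assume "x \<in> hcube a l"
    then have "x \<in> hcube (subcorner a l {i. a $ i + l / 2 \<le> x $ i}) (l / 2)"
      unfolding hcube_def subcorner_def
      by (auto simp: not_le add.commute dest!: spec)
    then show "x \<in> ?R" by blast
  qed
qed

lemma emeasure_hcube_children:
  assumes "0 < l" "sets M = sets lebesgue" "F \<in> sets lebesgue"
  shows "emeasure M (hcube a l \<inter> F) = (\<Sum>S\<in>UNIV. emeasure M (hcube (subcorner a l S) (l / 2) \<inter> F))"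
proof -
  have "hcube a l \<inter> F = (\<Union>S. hcube (subcorner a l S) (l / 2) \<inter> F)"
    using hcube_eq_UN[OF assms(1), of a] by auto
  then show ?thesis
  proof -
    have "disjoint_family (\<lambda>S. hcube (subcorner a l S) (l / 2) \<inter> F)"
      using disjoint_hcube_subcorner[of a l] unfolding disjoint_family_on_def by blast
    moreover have "range (\<lambda>S. hcube (subcorner a l S) (l / 2) \<inter> F) \<subseteq> sets M"
      using assms(2,3) hcube_sets(2) by blast
    ultimately show ?thesis
      unfolding \<open>hcube a l \<inter> F = _\<close> by (intro sum_emeasure[symmetric]) auto
  qed
qed

lemma dist_hcube:
  fixes x y :: "real ^ 'n" and l :: real
  assumes "x \<in> hcube a l" "y \<in> hcube a l"
  shows "dist x y \<le> CARD('n) * l"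
proof -
  have "dist x y \<le> (\<Sum>i\<in>UNIV. \<bar>(x - y) $ i\<bar>)"
    unfolding dist_norm by (rule norm_le_l1_cart)
  also have "\<dots> \<le> (\<Sum>i\<in>(UNIV::'n set). l)"
  proof (intro sum_mono)
    fix i :: 'n
    have "a $ i \<le> x $ i \<and> x $ i < a $ i + l" "a $ i \<le> y $ i \<and> y $ i < a $ i + l"
      using assms by (auto simp: hcube_def)
    then show "\<bar>(x - y) $ i\<bar> \<le> l"
      by (simp add: abs_le_iff)
  qed
  finally show ?thesis by simp
qed

text \<open>A Calderon-Zygmund stopping argument in the form of an induction on the number of bisections: a child
  with large average is measured by \<open>half\<close>, and a cube of the last generation that meets
  \<open>{x. ball x d \<subseteq> U}\<close> is contained in \<open>U\<close>. Letting \<open>d\<close> tend to \<open>0\<close> and \<open>U\<close> shrink to \<open>{x. h < w x}\<close>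
  replaces the Lebesgue differentiation theorem.\<close>

lemma good_lambda_interior:
  fixes w :: "real ^ 'n \<Rightarrow> real" and l h d :: real
  defines "\<nu> \<equiv> density lebesgue (\<lambda>x. ennreal (w x))"
  assumes w: "w \<in> borel_measurable lebesgue"
    and lam: "0 < h" and beta: "\<beta> \<le> 1"
    and half: "\<And>a l. \<lbrakk>0 < l; ennreal h * emeasure lebesgue (hcube a l) < emeasure \<nu> (hcube a l)\<rbrakk> \<Longrightarrow>
      emeasure lebesgue (hcube a l) \<le> 2 * emeasure lebesgue (hcube a l \<inter> {x. \<beta> * h < w x})"
    and U: "U \<in> sets lebesgue" "{x. h < w x} \<subseteq> U"
    and d: "0 < d" and Ud: "{x. ball x d \<subseteq> U} \<in> sets lebesgue"
    and l: "0 < l"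
    and init: "emeasure \<nu> (hcube a l) \<le> ennreal h * emeasure lebesgue (hcube a l)"
    and k: "CARD('n) * l / 2 ^ k < d"
  shows "emeasure \<nu> (hcube a l \<inter> ({x. h < w x} \<inter> {x. ball x d \<subseteq> U})) \<le>
    ennreal (2 ^ (CARD('n) + 1) * h) * emeasure lebesgue (hcube a l \<inter> {x. \<beta> * h < w x}) +
    ennreal h * emeasure lebesgue (hcube a l \<inter> (U - {x. h < w x}))"
  using l init k
proof (induction k arbitrary: a l)
  case 0
  let ?Q = "hcube a l" and ?F = "{x. h < w x}" and ?G = "{x. \<beta> * h < w x}"
  note [measurable] = w
  have "Measurable.pred lebesgue (\<lambda>x. h < w x)" "Measurable.pred lebesgue (\<lambda>x. \<beta> * h < w x)"
    by measurable
  then have [measurable]: "?F \<in> sets lebesgue" "?G \<in> sets lebesgue" "U \<in> sets lebesgue"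
    using U(1) by (simp_all add: pred_def)
  have \<nu>: "sets \<nu> = sets lebesgue"
    by (simp add: \<nu>_def)
  show ?case
  proof (cases "?Q \<inter> {x. ball x d \<subseteq> U} = {}")
    case True
    then have "?Q \<inter> (?F \<inter> {x. ball x d \<subseteq> U}) = {}" by blast
    then show ?thesis by simp
  next
    case False
    then obtain x where x: "x \<in> ?Q" "ball x d \<subseteq> U" by blast
    \<comment> \<open>No bisection remains, so the edge is so short that two points of the cube are
      closer than d. Meeting {x. ball x d \<subseteq> U} once puts the whole cube inside U, and its
      volume splits between {h < w} and U - {h < w}.\<close>
    have "?Q \<subseteq> U"
    proof
      fix y assume "y \<in> ?Q"
      then have "dist x y \<le> CARD('n) * l"
        using dist_hcube[OF x(1)] by simp
      then show "y \<in> U"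
        using x(2) 0 by (auto simp: subset_iff)
    qed
    have FG: "?F \<subseteq> ?G"
    proof
      fix x assume "x \<in> ?F"
      moreover have "\<beta> * h \<le> 1 * h"
        using lam beta by (intro mult_right_mono) auto
      ultimately show "x \<in> ?G" by auto
    qed
    have one: "ennreal h \<le> ennreal (2 ^ (CARD('n) + 1) * h)"
    proof (intro ennreal_leI)
      have "1 * h \<le> 2 ^ (CARD('n) + 1) * h"
        using lam by (intro mult_right_mono one_le_power) auto
      then show "h \<le> 2 ^ (CARD('n) + 1) * h" by simp
    qed
    have "emeasure \<nu> (?Q \<inter> (?F \<inter> {x. ball x d \<subseteq> U})) \<le> emeasure \<nu> ?Q"
      by (intro emeasure_mono) (auto simp: \<nu>)
    also have "\<dots> \<le> ennreal h * emeasure lebesgue ?Q"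
      by (rule 0)
    also have "emeasure lebesgue ?Q = emeasure lebesgue ((?Q \<inter> ?F) \<union> (?Q \<inter> (U - ?F)))"
      using \<open>?Q \<subseteq> U\<close> by (intro arg_cong[where f="emeasure lebesgue"]) auto
    also have "\<dots> \<le> emeasure lebesgue (?Q \<inter> ?F) + emeasure lebesgue (?Q \<inter> (U - ?F))"
      by (intro emeasure_subadditive) auto
    also have "emeasure lebesgue (?Q \<inter> ?F) \<le> emeasure lebesgue (?Q \<inter> ?G)"
      using FG by (intro emeasure_mono) auto
    finally have "emeasure \<nu> (?Q \<inter> (?F \<inter> {x. ball x d \<subseteq> U})) \<le>
        ennreal h * (emeasure lebesgue (?Q \<inter> ?G) + emeasure lebesgue (?Q \<inter> (U - ?F)))"
      by (simp add: mult_left_mono add_right_mono)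
    also have "\<dots> \<le> ennreal (2 ^ (CARD('n) + 1) * h) * emeasure lebesgue (?Q \<inter> ?G) +
        ennreal h * emeasure lebesgue (?Q \<inter> (U - ?F))"
      using one by (simp add: distrib_left mult_right_mono)
    finally show ?thesis .
  qed
next
  case (Suc k)
  let ?F = "{x. h < w x}" and ?G = "{x. \<beta> * h < w x}" and ?V = "{x. ball x d \<subseteq> U}"
  let ?c = "\<lambda>S. hcube (subcorner a l S) (l / 2)"
  note [measurable] = w
  have "Measurable.pred lebesgue (\<lambda>x. h < w x)" "Measurable.pred lebesgue (\<lambda>x. \<beta> * h < w x)"
    by measurable
  then have [measurable]: "?F \<in> sets lebesgue" "?G \<in> sets lebesgue" "U \<in> sets lebesgue" "?V \<in> sets lebesgue"
    using U(1) Ud by (simp_all add: pred_def)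
  have \<nu>: "sets \<nu> = sets lebesgue"
    by (simp add: \<nu>_def)
  let ?R = "\<lambda>S. ennreal (2 ^ (CARD('n) + 1) * h) * emeasure lebesgue (?c S \<inter> ?G) +
    ennreal h * emeasure lebesgue (?c S \<inter> (U - ?F))"
  have child: "emeasure \<nu> (?c S \<inter> (?F \<inter> ?V)) \<le> ?R S" for S
  proof (cases "emeasure \<nu> (?c S) \<le> ennreal h * emeasure lebesgue (?c S)")
    case True
    show ?thesis
      by (rule Suc.IH) (use True Suc.prems in auto)
  next
    case False
    \<comment> \<open>The bisection stops at this child. Its mass is bounded by that of the parent,
      whose average is still at most h: the volume ratio costs 2^n and \<open>half\<close> costs
      2.\<close>
    have "emeasure \<nu> (?c S \<inter> (?F \<inter> ?V)) \<le> emeasure \<nu> (hcube a l)"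
      using hcube_subcorner_subset[OF Suc.prems(1)]
      by (intro emeasure_mono) (auto simp: \<nu>)
    also have "\<dots> \<le> ennreal h * emeasure lebesgue (hcube a l)"
      by (rule Suc.prems)
    also have "\<dots> = ennreal (2 ^ CARD('n) * h) * emeasure lebesgue (?c S)"
      using Suc.prems(1) lam
      by (simp add: emeasure_hcube power_divide del: emeasure_completion flip: ennreal_mult)
    also have "\<dots> \<le> ennreal (2 ^ CARD('n) * h) * (2 * emeasure lebesgue (?c S \<inter> ?G))"
      using False Suc.prems(1) by (intro mult_left_mono half) auto
    also have "\<dots> = ennreal (2 ^ (CARD('n) + 1) * h) * emeasure lebesgue (?c S \<inter> ?G)"
    proof -
      have "ennreal (2 ^ (CARD('n) + 1) * h) = ennreal (2 ^ CARD('n) * h) * 2"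
        using lam by (simp add: ennreal_mult' mult_ac flip: ennreal_numeral)
      then show ?thesis by (simp add: mult_ac)
    qed
    finally show ?thesis
      by (rule order_trans) simp
  qed
  have "emeasure \<nu> (hcube a l \<inter> (?F \<inter> ?V)) = (\<Sum>S\<in>UNIV. emeasure \<nu> (?c S \<inter> (?F \<inter> ?V)))"
    using Suc.prems(1) by (intro emeasure_hcube_children) (auto simp: \<nu>)
  also have "\<dots> \<le> (\<Sum>S\<in>UNIV. ?R S)"
    by (intro sum_mono child)
  also have "\<dots> = ennreal (2 ^ (CARD('n) + 1) * h) * emeasure lebesgue (hcube a l \<inter> ?G) +
    ennreal h * emeasure lebesgue (hcube a l \<inter> (U - ?F))"
  proof -
    have *: "emeasure lebesgue (hcube a l \<inter> F) = (\<Sum>S\<in>UNIV. emeasure lebesgue (?c S \<inter> F))"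
      if "F \<in> sets lebesgue" for F
      using Suc.prems(1) that by (intro emeasure_hcube_children) auto
    show ?thesis
      by (subst (1 2) *) (auto simp: sum.distrib sum_distrib_left simp del: emeasure_completion)
  qed
  finally show ?case .
qed

text \<open>Two limits eliminate d and U from the previous lemma. For open U the closed sets {x.
  ball x d \<subseteq> U} increase to U as d decreases to 0; then outer regularity lets U shrink to
  {h < w}, so that the error h |U - {h < w}| vanishes.\<close>

lemma good_lambda:
  fixes w :: "real ^ 'n \<Rightarrow> real" and l h :: real
  defines "\<nu> \<equiv> density lebesgue (\<lambda>x. ennreal (w x))"
  assumes w: "w \<in> borel_measurable lebesgue"
    and h: "0 < h" and beta: "\<beta> \<le> 1"
    and half: "\<And>a l. \<lbrakk>0 < l; ennreal h * emeasure lebesgue (hcube a l) < emeasure \<nu> (hcube a l)\<rbrakk> \<Longrightarrow>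
      emeasure lebesgue (hcube a l) \<le> 2 * emeasure lebesgue (hcube a l \<inter> {x. \<beta> * h < w x})"
    and l: "0 < l"
    and init: "emeasure \<nu> (hcube a l) \<le> ennreal h * emeasure lebesgue (hcube a l)"
  shows "emeasure \<nu> (hcube a l \<inter> {x. h < w x}) \<le>
    ennreal (2 ^ (CARD('n) + 1) * h) * emeasure lebesgue (hcube a l \<inter> {x. \<beta> * h < w x})"
    (is "_ \<le> ?R")
proof -
  let ?F = "{x. h < w x}"
  note [measurable] = w
  have "Measurable.pred lebesgue (\<lambda>x. h < w x)"
    by measurable
  then have F [measurable]: "?F \<in> sets lebesgue"
    by (simp add: pred_def)
  have \<nu>: "sets \<nu> = sets lebesgue"
    by (simp add: \<nu>_def)
  have outer: "emeasure \<nu> (hcube a l \<inter> ?F) \<le> ?R + ennreal h * emeasure lebesgue (U - ?F)"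
    if U: "open U" "?F \<subseteq> U" for U
  proof -
    define V where "V j = {x. ball x (inverse (real (Suc j))) \<subseteq> U}" for j
    have "closed (V j)" for j
    proof -
      have "- V j = (\<Union>y\<in>- U. ball y (inverse (real (Suc j))))"
        by (auto simp: V_def subset_iff dist_commute)
      then show ?thesis
        unfolding closed_def by (metis open_UN open_ball)
    qed
    then have V [measurable]: "V j \<in> sets lebesgue" for j
      by (simp add: borel_closed)
    have Us [measurable]: "U \<in> sets lebesgue"
      using U by (simp add: borel_open)
    have "incseq V"
    proof (rule incseq_SucI)
      fix j
      have "ball x (inverse (real (Suc (Suc j)))) \<subseteq> ball x (inverse (real (Suc j)))" for x :: "real ^ 'n"
        by (intro subset_ball) (simp add: field_simps)
      then show "V j \<subseteq> V (Suc j)"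
        unfolding V_def by blast
    qed
    have "U = (\<Union>j. V j)"
    proof
      show "(\<Union>j. V j) \<subseteq> U"
        by (auto simp: V_def)
      show "U \<subseteq> (\<Union>j. V j)"
      proof
        fix x assume "x \<in> U"
        then obtain e where e: "e > 0" "ball x e \<subseteq> U"
          using U openE by blast
        then obtain j where "inverse (real (Suc j)) < e"
          using reals_Archimedean by blast
        then show "x \<in> (\<Union>j. V j)"
        proof -
          have "ball x (inverse (real (Suc j))) \<subseteq> ball x e"
            using \<open>inverse (real (Suc j)) < e\<close> by (intro subset_ball) simp
          then have "x \<in> V j"
            using e unfolding V_def by blast
          then show ?thesis by blast
        qed
      qed
    qed
    then have "hcube a l \<inter> ?F = (\<Union>j. hcube a l \<inter> (?F \<inter> V j))"
      using U(2) by blast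
    also have "emeasure \<nu> \<dots> = (SUP j. emeasure \<nu> (hcube a l \<inter> (?F \<inter> V j)))"
      using \<open>incseq V\<close>
      by (intro SUP_emeasure_incseq[symmetric]) (auto simp: \<nu> incseq_def)
    also have "\<dots> \<le> ?R + ennreal h * emeasure lebesgue (U - ?F)"
    proof (rule SUP_least)
      fix j
      obtain k :: nat where k: "CARD('n) * l * Suc j < 2 ^ k"
        using real_arch_pow[of 2] by auto
      then have small: "CARD('n) * l / 2 ^ k < inverse (real (Suc j))"
        by (simp add: divide_less_eq less_divide_eq inverse_eq_divide mult_ac)
      have "emeasure \<nu> (hcube a l \<inter> (?F \<inter> V j)) \<le>
          ?R + ennreal h * emeasure lebesgue (hcube a l \<inter> (U - ?F))"
        unfolding \<nu>_def V_def
        by (rule good_lambda_interior[where k=k])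
          (use w h beta half[unfolded \<nu>_def] l init[unfolded \<nu>_def] Us U(2) V[of j, unfolded V_def] small
            in \<open>simp_all only: zero_less_numeral inverse_positive_iff_positive of_nat_0_less_iff zero_less_Suc\<close>)
      also have "\<dots> \<le> ?R + ennreal h * emeasure lebesgue (U - ?F)"
        by (intro add_left_mono mult_left_mono emeasure_mono) auto
      finally show "emeasure \<nu> (hcube a l \<inter> (?F \<inter> V j)) \<le> ?R + ennreal h * emeasure lebesgue (U - ?F)" .
    qed
    finally show ?thesis .
  qed
  show ?thesis
  proof (rule ennreal_le_epsilon)
    fix e :: real assume "0 < e"
    then have "0 < e / h" using h by simp
    from sets_lebesgue_outer_open[OF F this] obtain U
      where U: "open U" "?F \<subseteq> U" "emeasure lebesgue (U - ?F) < ennreal (e / h)" by metis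
    have "ennreal h * emeasure lebesgue (U - ?F) \<le> ennreal h * ennreal (e / h)"
      using U(3) by (intro mult_left_mono) auto
    also have "\<dots> = ennreal e"
      using h \<open>0 < e\<close> by (simp flip: ennreal_mult)
    finally show "emeasure \<nu> (hcube a l \<inter> ?F) \<le> ?R + ennreal e"
      using outer[OF U(1,2)] by (meson add_left_mono order_trans)
  qed
qed

section \<open>The reverse Hoelder inequality\<close>

lemma sigma_finite_lebesgue: "sigma_finite_measure (lebesgue :: 'a::euclidean_space measure)"
proof
  obtain A :: "nat \<Rightarrow> 'a set" where A: "range A \<subseteq> sets lborel" "(\<Union>i. A i) = space lborel"
      "\<And>i. emeasure lborel (A i) \<noteq> \<infinity>"
    using lborel.sigma_finite by metis
  then show "\<exists>A. countable A \<and> A \<subseteq> sets (lebesgue :: 'a measure) \<and> \<Union> A = space lebesgue \<and>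
      (\<forall>a\<in>A. emeasure lebesgue a \<noteq> \<infinity>)"
    by (intro exI[of _ "range A"]) (auto simp: sets_completionI_sets)
qed

interpretation lebesgue: sigma_finite_measure "lebesgue :: 'a::euclidean_space measure"
  by (rule sigma_finite_lebesgue)

lemma nn_integral_powr_segment:
  fixes a t :: real
  assumes "-1 < a" "0 \<le> t"
  shows "(\<integral>\<^sup>+ h. ennreal (h powr a) * indicator {0<..<t} h \<partial>lborel) = ennreal (t powr (a + 1) / (a + 1))"
proof -
  have "((\<lambda>x. x powr a) has_integral (t powr (a + 1) / (a + 1))) {0..t}"
    using assms by (rule has_integral_powr_from_0)
  then have "(\<integral>\<^sup>+ h. ennreal (h powr a) * indicator {0..t} h \<partial>lborel) = ennreal (t powr (a + 1) / (a + 1))"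
    by (intro nn_integral_has_integral_lebesgue') auto
  moreover have "AE h in lborel. h \<noteq> 0" "AE h in lborel. h \<noteq> t"
    by (rule AE_lborel_singleton)+
  then have "(\<integral>\<^sup>+ h. ennreal (h powr a) * indicator {0<..<t} h \<partial>lborel) =
      (\<integral>\<^sup>+ h. ennreal (h powr a) * indicator {0..t} h \<partial>lborel)"
    by (intro nn_integral_cong_AE) (auto elim!: eventually_elim2 simp: indicator_def)
  ultimately show ?thesis by simp
qed

text \<open>Fubini: for fixed x the levels h in (0, N) with \<beta> h < w x form the interval from 0
  to min (w x / \<beta>) N. The density g allows the same formula for the measure with density w and
  for Lebesgue measure.\<close>

lemma layer_cake:
  fixes w :: "'a::euclidean_space \<Rightarrow> real" and a \<beta> N :: real
  assumes \<mu>: "\<mu> = density lebesgue (\<lambda>x. ennreal (g x))" and g: "g \<in> borel_measurable lebesgue"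
    and w: "w \<in> borel_measurable lebesgue" "\<And>x. 0 \<le> w x" and a: "-1 < a" and \<beta>: "0 < \<beta>"
    and N: "0 \<le> N" and Q: "Q \<in> sets lebesgue"
  shows "(\<integral>\<^sup>+ h. ennreal (h powr a) * indicator {0<..<N} h * emeasure \<mu> (Q \<inter> {x. \<beta> * h < w x}) \<partial>lborel) =
    (\<integral>\<^sup>+ x. ennreal (min (w x / \<beta>) N powr (a + 1) / (a + 1)) * indicator Q x * ennreal (g x) \<partial>lebesgue)"
proof -
  interpret pair_sigma_finite "lborel :: real measure" "lebesgue :: 'a measure" ..
  note [measurable] = w(1) g Q
  have s: "Q \<inter> {x. \<beta> * h < w x} \<in> sets lebesgue" for h
  proof -
    have "Measurable.pred lebesgue (\<lambda>x. \<beta> * h < w x)" by measurable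
    then show ?thesis by (simp add: pred_def Q sets.Int)
  qed
  have e: "emeasure \<mu> (Q \<inter> {x. \<beta> * h < w x}) =
      (\<integral>\<^sup>+ x. ennreal (g x) * indicator Q x * (if \<beta> * h < w x then 1 else 0) \<partial>lebesgue)" for h
    unfolding \<mu> using s by (subst emeasure_density) (auto intro!: nn_integral_cong simp: indicator_def)
  have "(\<integral>\<^sup>+ h. ennreal (h powr a) * indicator {0<..<N} h * emeasure \<mu> (Q \<inter> {x. \<beta> * h < w x}) \<partial>lborel) =
     (\<integral>\<^sup>+ h. (\<integral>\<^sup>+ x. ennreal (h powr a) * indicator {0<..<N} h *
        (ennreal (g x) * indicator Q x * (if \<beta> * h < w x then 1 else 0)) \<partial>lebesgue) \<partial>lborel)"
    unfolding e by (intro nn_integral_cong nn_integral_cmult[symmetric]) measurable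
  also have "\<dots> = (\<integral>\<^sup>+ x. (\<integral>\<^sup>+ h. ennreal (h powr a) * indicator {0<..<N} h *
        (ennreal (g x) * indicator Q x * (if \<beta> * h < w x then 1 else 0)) \<partial>lborel) \<partial>lebesgue)"
    by (rule Fubini'[symmetric]) measurable
  also have "\<dots> = (\<integral>\<^sup>+ x. (\<integral>\<^sup>+ h. (ennreal (h powr a) * indicator {0<..<min (w x / \<beta>) N} h) *
        (ennreal (g x) * indicator Q x) \<partial>lborel) \<partial>lebesgue)"
    using \<beta> by (intro nn_integral_cong) (auto simp: indicator_def field_simps)
  also have "\<dots> = (\<integral>\<^sup>+ x. ennreal (min (w x / \<beta>) N powr (a + 1) / (a + 1)) * (ennreal (g x) * indicator Q x) \<partial>lebesgue)"
  proof (intro nn_integral_cong)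
    fix x
    have "(\<integral>\<^sup>+ h. (ennreal (h powr a) * indicator {0<..<min (w x / \<beta>) N} h) *
        (ennreal (g x) * indicator Q x) \<partial>lborel) =
      (\<integral>\<^sup>+ h. ennreal (h powr a) * indicator {0<..<min (w x / \<beta>) N} h \<partial>lborel) * (ennreal (g x) * indicator Q x)"
      by (rule nn_integral_multc) measurable
    also have "(\<integral>\<^sup>+ h. ennreal (h powr a) * indicator {0<..<min (w x / \<beta>) N} h \<partial>lborel) =
        ennreal (min (w x / \<beta>) N powr (a + 1) / (a + 1))"
      using a w(2)[of x] \<beta> N by (intro nn_integral_powr_segment) auto
    finally show "(\<integral>\<^sup>+ h. (ennreal (h powr a) * indicator {0<..<min (w x / \<beta>) N} h) *
        (ennreal (g x) * indicator Q x) \<partial>lborel) =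
      ennreal (min (w x / \<beta>) N powr (a + 1) / (a + 1)) * (ennreal (g x) * indicator Q x)" .
  qed
  finally show ?thesis by (simp add: mult_ac)
qed

text \<open>The good-lambda inequality is integrated against h^(\<delta>-1) dh. Its left side
  becomes the integral to be bounded, divided by \<delta>; its right side returns the same integral
  times 2^(n+1) \<beta>^-(1+\<delta>). After multiplication by \<delta> the hypothesis
  \<open>small\<close> makes that coefficient at most 1/2.\<close>

lemma truncated_reverse_holder:
  fixes w :: "real ^ 'n \<Rightarrow> real" and l A N \<delta> \<beta> :: real
  defines "\<nu> \<equiv> density lebesgue (\<lambda>x. ennreal (w x))"
  assumes w: "w \<in> borel_measurable lebesgue" "\<And>x. 0 \<le> w x"
    and \<beta>: "0 < \<beta>" "\<beta> \<le> 1" and \<delta>: "0 < \<delta>" and small: "2 ^ (CARD('n) + 1) * \<delta> * \<beta> powr - (1 + \<delta>) \<le> 1 / 2"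
    and half: "\<And>h a l. \<lbrakk>0 < h; 0 < l; ennreal h * emeasure lebesgue (hcube a l) < emeasure \<nu> (hcube a l)\<rbrakk> \<Longrightarrow>
      emeasure lebesgue (hcube a l) \<le> 2 * emeasure lebesgue (hcube a l \<inter> {x. \<beta> * h < w x})"
    and l: "0 < l" and A: "0 < A" "emeasure \<nu> (hcube a l) = ennreal (A * l ^ CARD('n))"
    and N: "0 < N"
  shows "(\<integral>\<^sup>+ x \<in> hcube a l. ennreal (min (w x) N powr \<delta> * w x) \<partial>lebesgue) \<le>
    ennreal (2 * A powr (1 + \<delta>) * l ^ CARD('n))"
proof -
  let ?Q = "hcube a l"
  note [measurable] = w(1)
  define I where "I = (\<integral>\<^sup>+ x \<in> ?Q. ennreal (min (w x) N powr \<delta> * w x) \<partial>lebesgue)"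
  \<comment> \<open>The truncation at N is there for this a priori finiteness: without it the term
    on the right could not be absorbed.\<close>
  have "I \<le> (\<integral>\<^sup>+ x. ennreal (N powr \<delta>) * (ennreal (w x) * indicator ?Q x) \<partial>lebesgue)"
    unfolding I_def using w(2) N \<delta>
    by (intro nn_integral_mono)
      (auto simp: indicator_def min_def mult_right_mono powr_mono2 simp flip: ennreal_mult intro!: ennreal_leI)
  also have "\<dots> = ennreal (N powr \<delta>) * emeasure \<nu> ?Q"
    unfolding \<nu>_def by (simp add: emeasure_density nn_integral_cmult)
  also have "\<dots> < \<infinity>"
    unfolding A(2) by (simp add: ennreal_mult_less_top)
  finally have "I < \<infinity>" .
  then obtain i where i: "I = ennreal i" "0 \<le> i"
    by (cases I) auto
  have lc1: "(\<integral>\<^sup>+ h. ennreal (h powr (\<delta> - 1)) * indicator {0<..<N} h * emeasure \<nu> (?Q \<inter> {x. 1 * h < w x}) \<partial>lborel) =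
      ennreal (1 / \<delta>) * I"
  proof -
    have "(\<integral>\<^sup>+ h. ennreal (h powr (\<delta> - 1)) * indicator {0<..<N} h * emeasure \<nu> (?Q \<inter> {x. 1 * h < w x}) \<partial>lborel) =
        (\<integral>\<^sup>+ x. ennreal (min (w x / 1) N powr (\<delta> - 1 + 1) / (\<delta> - 1 + 1)) * indicator ?Q x * ennreal (w x) \<partial>lebesgue)"
      using w \<delta> N unfolding \<nu>_def by (intro layer_cake) auto
    also have "\<dots> = (\<integral>\<^sup>+ x. ennreal (1 / \<delta>) * (ennreal (min (w x) N powr \<delta> * w x) * indicator ?Q x) \<partial>lebesgue)"
      using w(2) \<delta> by (intro nn_integral_cong) (auto simp: indicator_def simp flip: ennreal_mult)
    also have "\<dots> = ennreal (1 / \<delta>) * I"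
      unfolding I_def by (rule nn_integral_cmult) measurable
    finally show ?thesis .
  qed
  have lc2: "(\<integral>\<^sup>+ h. ennreal (h powr \<delta>) * indicator {0<..<N} h * emeasure lebesgue (?Q \<inter> {x. \<beta> * h < w x}) \<partial>lborel) =
      (\<integral>\<^sup>+ x. ennreal (min (w x / \<beta>) N powr (\<delta> + 1) / (\<delta> + 1)) * indicator ?Q x * ennreal 1 \<partial>lebesgue)"
    using w \<delta> N \<beta> by (intro layer_cake) (auto simp: density_1)
  have lc2': "\<dots> \<le> ennreal (\<beta> powr - (1 + \<delta>)) * I"
  proof -
    have "min (w x / \<beta>) N powr (\<delta> + 1) / (\<delta> + 1) \<le> \<beta> powr - (1 + \<delta>) * (min (w x) N powr \<delta> * w x)" for x
    proof -
      let ?m = "min (w x) N"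
      have m: "0 \<le> ?m" "?m \<le> w x" using w(2) N by auto
      have "N * \<beta> \<le> N" using N \<beta> by simp
      then have "min (w x / \<beta>) N \<le> ?m / \<beta>"
        using \<beta> by (auto simp: min_def field_simps)
      then have "min (w x / \<beta>) N powr (\<delta> + 1) \<le> (?m / \<beta>) powr (\<delta> + 1)"
        using w(2)[of x] N \<beta> \<delta> by (intro powr_mono2) auto
      also have "\<dots> = \<beta> powr - (1 + \<delta>) * ?m powr (\<delta> + 1)"
      proof -
        have "\<beta> powr - (1 + \<delta>) = 1 / \<beta> powr (\<delta> + 1)"
          by (simp only: powr_minus_divide add.commute)
        then show ?thesis
          using m(1) \<beta> by (simp add: powr_divide)
      qed
      also have "?m powr (\<delta> + 1) = ?m powr \<delta> * ?m"
        using m by (cases "?m = 0") (auto simp: powr_add)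
      also have "\<beta> powr - (1 + \<delta>) * (?m powr \<delta> * ?m) \<le> \<beta> powr - (1 + \<delta>) * (?m powr \<delta> * w x)"
        using m by (intro mult_left_mono) auto
      finally have "min (w x / \<beta>) N powr (\<delta> + 1) \<le> \<beta> powr - (1 + \<delta>) * (?m powr \<delta> * w x)" .
      moreover have "min (w x / \<beta>) N powr (\<delta> + 1) / (\<delta> + 1) \<le> min (w x / \<beta>) N powr (\<delta> + 1) / 1"
        using \<delta> by (intro divide_left_mono) auto
      ultimately show ?thesis by simp
    qed
    then have "(\<integral>\<^sup>+ x. ennreal (min (w x / \<beta>) N powr (\<delta> + 1) / (\<delta> + 1)) * indicator ?Q x * ennreal 1 \<partial>lebesgue) \<le>
        (\<integral>\<^sup>+ x. ennreal (\<beta> powr - (1 + \<delta>)) * (ennreal (min (w x) N powr \<delta> * w x) * indicator ?Q x) \<partial>lebesgue)"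
      using w(2) by (intro nn_integral_mono) (auto simp: indicator_def simp flip: ennreal_mult intro!: ennreal_leI)
    also have "\<dots> = ennreal (\<beta> powr - (1 + \<delta>)) * I"
      unfolding I_def by (rule nn_integral_cmult) measurable
    finally show ?thesis .
  qed
  have m1: "(\<lambda>h. ennreal (h powr (\<delta> - 1)) * indicator {0<..<A} h) \<in> borel_measurable lborel"
    by measurable
  have m2: "(\<lambda>h. emeasure lebesgue (?Q \<inter> {x. \<beta> * h < w x})) \<in> borel_measurable lborel"
  proof -
    have "(\<lambda>h. \<integral>\<^sup>+ x. indicator ?Q x * (if \<beta> * h < w x then 1 else 0) \<partial>lebesgue) \<in> borel_measurable lborel"
      by measurable
    moreover have "emeasure lebesgue (?Q \<inter> {x. \<beta> * h < w x}) =
        (\<integral>\<^sup>+ x. indicator ?Q x * (if \<beta> * h < w x then 1 else 0) \<partial>lebesgue)" for h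
    proof -
      have "Measurable.pred lebesgue (\<lambda>x. \<beta> * h < w x)" by measurable
      then have "?Q \<inter> {x. \<beta> * h < w x} \<in> sets lebesgue"
        by (simp add: pred_def sets.Int)
      then have "emeasure lebesgue (?Q \<inter> {x. \<beta> * h < w x}) = (\<integral>\<^sup>+ x. indicator (?Q \<inter> {x. \<beta> * h < w x}) x \<partial>lebesgue)"
        by (rule nn_integral_indicator[symmetric])
      also have "\<dots> = (\<integral>\<^sup>+ x. indicator ?Q x * (if \<beta> * h < w x then 1 else 0) \<partial>lebesgue)"
        by (intro nn_integral_cong) (auto simp: indicator_def)
      finally show ?thesis .
    qed
    ultimately show ?thesis by simp
  qed
  \<comment> \<open>The levels are split at the average A of w over the cube. Below A the trivial
    bound by the full mass integrates to A^\<delta>/\<delta>; from A on the cube satisfies the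
    starting condition of \<open>good_lambda\<close>.\<close>
  have ptw: "ennreal (h powr (\<delta> - 1)) * indicator {0<..<N} h * emeasure \<nu> (?Q \<inter> {x. 1 * h < w x}) \<le>
      ennreal (h powr (\<delta> - 1)) * indicator {0<..<A} h * emeasure \<nu> ?Q +
      ennreal (2 ^ (CARD('n) + 1)) * (ennreal (h powr \<delta>) * indicator {0<..<N} h * emeasure lebesgue (?Q \<inter> {x. \<beta> * h < w x}))"
    for h
  proof (cases "h \<in> {0<..<N}")
    case True
    then have h: "0 < h" by simp
    show ?thesis
    proof (cases "h < A")
      case True
      have "emeasure \<nu> (?Q \<inter> {x. 1 * h < w x}) \<le> emeasure \<nu> ?Q"
        by (intro emeasure_mono) (auto simp: \<nu>_def)
      then show ?thesis
        using True \<open>h \<in> {0<..<N}\<close> by (intro order_trans[OF _ add_increasing2]) (auto intro!: mult_left_mono)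
    next
      case False
      then have init: "emeasure \<nu> ?Q \<le> ennreal h * emeasure lebesgue ?Q"
        using l h A
        by (simp add: emeasure_hcube del: emeasure_completion flip: ennreal_mult)
      have "emeasure \<nu> (?Q \<inter> {x. h < w x}) \<le>
          ennreal (2 ^ (CARD('n) + 1) * h) * emeasure lebesgue (?Q \<inter> {x. \<beta> * h < w x})"
        unfolding \<nu>_def
        by (rule good_lambda) (use w h \<beta> half[OF h, unfolded \<nu>_def] l init[unfolded \<nu>_def] in \<open>simp_all only:\<close>)
      then have "ennreal (h powr (\<delta> - 1)) * emeasure \<nu> (?Q \<inter> {x. h < w x}) \<le>
          ennreal (h powr (\<delta> - 1)) * (ennreal (2 ^ (CARD('n) + 1) * h) * emeasure lebesgue (?Q \<inter> {x. \<beta> * h < w x}))"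
        by (rule mult_left_mono) simp
      also have "\<dots> = ennreal (h powr (\<delta> - 1) * (2 ^ (CARD('n) + 1) * h)) * emeasure lebesgue (?Q \<inter> {x. \<beta> * h < w x})"
        using h by (subst ennreal_mult) (auto simp: mult_ac)
      also have "h powr (\<delta> - 1) * (2 ^ (CARD('n) + 1) * h) = 2 ^ (CARD('n) + 1) * h powr \<delta>"
        using h by (simp add: powr_diff)
      also have "ennreal (2 ^ (CARD('n) + 1) * h powr \<delta>) = ennreal (2 ^ (CARD('n) + 1)) * ennreal (h powr \<delta>)"
        by (rule ennreal_mult) auto
      finally show ?thesis
        using True by (simp add: mult_ac add_increasing)
    qed
  qed auto
  have "ennreal (1 / \<delta>) * I \<le>
     (\<integral>\<^sup>+ h. ennreal (h powr (\<delta> - 1)) * indicator {0<..<A} h * emeasure \<nu> ?Q +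
      ennreal (2 ^ (CARD('n) + 1)) * (ennreal (h powr \<delta>) * indicator {0<..<N} h * emeasure lebesgue (?Q \<inter> {x. \<beta> * h < w x})) \<partial>lborel)"
    unfolding lc1[symmetric] by (intro nn_integral_mono ptw)
  also have "\<dots> = (\<integral>\<^sup>+ h. ennreal (h powr (\<delta> - 1)) * indicator {0<..<A} h * emeasure \<nu> ?Q \<partial>lborel) +
      (\<integral>\<^sup>+ h. ennreal (2 ^ (CARD('n) + 1)) * (ennreal (h powr \<delta>) * indicator {0<..<N} h * emeasure lebesgue (?Q \<inter> {x. \<beta> * h < w x})) \<partial>lborel)"
    using m2 by (intro nn_integral_add) measurable
  also have "(\<integral>\<^sup>+ h. ennreal (h powr (\<delta> - 1)) * indicator {0<..<A} h * emeasure \<nu> ?Q \<partial>lborel) =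
      ennreal (A powr \<delta> / \<delta>) * emeasure \<nu> ?Q"
    using nn_integral_powr_segment[of "\<delta> - 1" A] \<delta> A by (subst nn_integral_multc[OF m1]) simp
  also have "(\<integral>\<^sup>+ h. ennreal (2 ^ (CARD('n) + 1)) * (ennreal (h powr \<delta>) * indicator {0<..<N} h * emeasure lebesgue (?Q \<inter> {x. \<beta> * h < w x})) \<partial>lborel) =
      ennreal (2 ^ (CARD('n) + 1)) *
      (\<integral>\<^sup>+ h. ennreal (h powr \<delta>) * indicator {0<..<N} h * emeasure lebesgue (?Q \<inter> {x. \<beta> * h < w x}) \<partial>lborel)"
    using m2 by (intro nn_integral_cmult) measurable
  also have "\<dots> \<le> ennreal (2 ^ (CARD('n) + 1)) * (ennreal (\<beta> powr - (1 + \<delta>)) * I)"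
    unfolding lc2 by (intro mult_left_mono lc2') auto
  finally have "ennreal (1 / \<delta>) * I \<le> ennreal (A powr \<delta> / \<delta>) * emeasure \<nu> ?Q +
     ennreal (2 ^ (CARD('n) + 1)) * (ennreal (\<beta> powr - (1 + \<delta>)) * I)"
    by (simp add: add_left_mono)
  then have "ennreal (1 / \<delta> * i) \<le> ennreal (A powr \<delta> / \<delta> * (A * l ^ CARD('n)) +
     2 ^ (CARD('n) + 1) * (\<beta> powr - (1 + \<delta>) * i))"
    using i A l \<delta> by (simp add: A(2) flip: ennreal_mult ennreal_plus)
  then have "1 / \<delta> * i \<le> A powr \<delta> / \<delta> * (A * l ^ CARD('n)) + 2 ^ (CARD('n) + 1) * (\<beta> powr - (1 + \<delta>) * i)"
    using i A l \<delta> by (subst (asm) ennreal_le_iff) auto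
  then have "\<delta> * (1 / \<delta> * i) \<le> \<delta> * (A powr \<delta> / \<delta> * (A * l ^ CARD('n)) + 2 ^ (CARD('n) + 1) * (\<beta> powr - (1 + \<delta>) * i))"
    using \<delta> by (intro mult_left_mono) auto
  then have "i \<le> A powr \<delta> * A * l ^ CARD('n) + (2 ^ (CARD('n) + 1) * \<delta> * \<beta> powr - (1 + \<delta>)) * i"
    using \<delta> by (simp add: algebra_simps)
  \<comment> \<open>Half of the finite number i is moved to the left side.\<close>
  also have "\<dots> \<le> A powr \<delta> * A * l ^ CARD('n) + (1 / 2) * i"
    using i(2) small by (intro add_left_mono mult_right_mono) auto
  finally have "i \<le> 2 * (A powr \<delta> * A * l ^ CARD('n))"
    by simp
  also have "A powr \<delta> * A = A powr (1 + \<delta>)"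
    using A(1) by (simp add: powr_add)
  finally have "i \<le> 2 * A powr (1 + \<delta>) * l ^ CARD('n)"
    by simp
  then show ?thesis
    unfolding I_def[symmetric] i(1) by (rule ennreal_leI)
qed

text \<open>The bound for the truncations does not depend on N, so monotone convergence removes
  them. At each point the supremum is already attained once N exceeds w x.\<close>

lemma reverse_holder:
  fixes w :: "real ^ 'n \<Rightarrow> real" and l A \<delta> \<beta> :: real
  defines "\<nu> \<equiv> density lebesgue (\<lambda>x. ennreal (w x))"
  assumes w: "w \<in> borel_measurable lebesgue" "\<And>x. 0 \<le> w x"
    and \<beta>: "0 < \<beta>" "\<beta> \<le> 1" and \<delta>: "0 < \<delta>" and small: "2 ^ (CARD('n) + 1) * \<delta> * \<beta> powr - (1 + \<delta>) \<le> 1 / 2"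
    and half: "\<And>h a l. \<lbrakk>0 < h; 0 < l; ennreal h * emeasure lebesgue (hcube a l) < emeasure \<nu> (hcube a l)\<rbrakk> \<Longrightarrow>
      emeasure lebesgue (hcube a l) \<le> 2 * emeasure lebesgue (hcube a l \<inter> {x. \<beta> * h < w x})"
    and l: "0 < l" and A: "0 < A" "emeasure \<nu> (hcube a l) = ennreal (A * l ^ CARD('n))"
  shows "(\<integral>\<^sup>+ x \<in> hcube a l. ennreal (w x powr (1 + \<delta>)) \<partial>lebesgue) \<le>
    ennreal (2 * A powr (1 + \<delta>) * l ^ CARD('n))"
proof -
  let ?Q = "hcube a l"
  let ?f = "\<lambda>N x. ennreal (min (w x) (real (Suc N)) powr \<delta> * w x) * indicator ?Q x"
  note [measurable] = w(1)
  have "(\<integral>\<^sup>+ x \<in> ?Q. ennreal (w x powr (1 + \<delta>)) \<partial>lebesgue) \<le> (\<integral>\<^sup>+ x. (SUP N. ?f N x) \<partial>lebesgue)"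
  proof (rule nn_integral_mono)
    fix x
    have "ennreal (w x powr (1 + \<delta>)) * indicator ?Q x = ?f (nat \<lceil>w x\<rceil>) x"
    proof -
      have "w x \<le> real (Suc (nat \<lceil>w x\<rceil>))" by linarith
      then show ?thesis
        using w(2)[of x] by (cases "w x = 0") (auto simp: min_def powr_add mult.commute)
    qed
    then show "ennreal (w x powr (1 + \<delta>)) * indicator ?Q x \<le> (SUP N. ?f N x)"
      by (simp only:) (rule SUP_upper, rule UNIV_I)
  qed
  also have "\<dots> = (SUP N. \<integral>\<^sup>+ x. ?f N x \<partial>lebesgue)"
  proof (rule nn_integral_monotone_convergence_SUP)
    have "?f N x \<le> ?f M x" if "N \<le> M" for N M x
      using that w(2)[of x] \<delta>
      by (intro mult_right_mono ennreal_leI powr_mono2 min.mono) auto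
    then show "incseq ?f"
      by (auto simp: incseq_def le_fun_def)
  qed measurable
  also have "\<dots> \<le> ennreal (2 * A powr (1 + \<delta>) * l ^ CARD('n))"
  proof (rule SUP_least)
    fix N :: nat
    show "(\<integral>\<^sup>+ x. ?f N x \<partial>lebesgue) \<le> ennreal (2 * A powr (1 + \<delta>) * l ^ CARD('n))"
      by (rule truncated_reverse_holder[OF w \<beta> \<delta> small half[unfolded \<nu>_def] l A[unfolded \<nu>_def]]) auto
  qed
  finally show ?thesis .
qed

section \<open>Averages and Muckenhoupt weights\<close>

text \<open>Young's inequality for f/A and g/B, integrated. Taking positive upper bounds A and B in
  place of the norms themselves avoids the degenerate cases of norm zero or infinity.\<close>

lemma nn_integral_Holder:
  assumes fg: "f \<in> borel_measurable M" "g \<in> borel_measurable M" "\<And>x. 0 \<le> f x" "\<And>x. 0 \<le> g x"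
    and r: "1 < r" "1 < r'" "1 / r + 1 / r' = 1" and AB: "0 < A" "0 < B"
    and f: "(\<integral>\<^sup>+ x. ennreal (f x powr r) \<partial>M) \<le> ennreal (A powr r)"
    and g: "(\<integral>\<^sup>+ x. ennreal (g x powr r') \<partial>M) \<le> ennreal (B powr r')"
  shows "(\<integral>\<^sup>+ x. ennreal (f x * g x) \<partial>M) \<le> ennreal (A * B)"
proof -
  note [measurable] = fg(1,2)
  let ?a = "A * B / (r * A powr r)" and ?b = "A * B / (r' * B powr r')"
  have "f x * g x \<le> ?a * f x powr r + ?b * g x powr r'" for x
  proof -
    have "(f x / A) * (g x / B) \<le> (f x / A) powr r / r + (g x / B) powr r' / r'"
      using fg(3,4) AB r by (intro Youngs_inequality) auto
    then have "A * B * ((f x / A) * (g x / B)) \<le> A * B * ((f x / A) powr r / r + (g x / B) powr r' / r')"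
      using AB by (intro mult_left_mono) auto
    moreover have "A * B * ((f x / A) * (g x / B)) = f x * g x"
      using AB by simp
    moreover have "A * B * ((f x / A) powr r / r + (g x / B) powr r' / r') = ?a * f x powr r + ?b * g x powr r'"
      using fg(3,4)[of x] AB by (simp add: powr_divide algebra_simps)
    ultimately show ?thesis by simp
  qed
  then have "(\<integral>\<^sup>+ x. ennreal (f x * g x) \<partial>M) \<le>
      (\<integral>\<^sup>+ x. ennreal ?a * ennreal (f x powr r) + ennreal ?b * ennreal (g x powr r') \<partial>M)"
    using r AB by (intro nn_integral_mono) (simp flip: ennreal_mult ennreal_plus)
  also have "\<dots> = ennreal ?a * (\<integral>\<^sup>+ x. ennreal (f x powr r) \<partial>M) + ennreal ?b * (\<integral>\<^sup>+ x. ennreal (g x powr r') \<partial>M)"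
    by (subst nn_integral_add) (auto simp: nn_integral_cmult)
  also have "\<dots> \<le> ennreal ?a * ennreal (A powr r) + ennreal ?b * ennreal (B powr r')"
    by (intro add_mono mult_left_mono f g) auto
  also have "\<dots> = ennreal (?a * A powr r + ?b * B powr r')"
    using r AB by (simp flip: ennreal_mult ennreal_plus)
  also have "?a * A powr r + ?b * B powr r' = A * B * (1 / r + 1 / r')"
    using r(1,2) AB by (simp add: distrib_left)
  also have "\<dots> = A * B"
    using r by simp
  finally show ?thesis .
qed

section \<open>Averages over cubes as integrals against normalized Lebesgue measure\<close>

lemma cubesE:
  assumes "Q \<in> cubes"
  obtains a l where "Q = cbox a (\<chi> i. a $ i + l)" "0 < l"
  using assms by (auto simp: cubes_def)

lemma cubesI: "0 < l \<Longrightarrow> cbox a (\<chi> i. a $ i + l) \<in> cubes"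
  by (auto simp: cubes_def)

lemma cubes_sets: "Q \<in> cubes \<Longrightarrow> Q \<in> sets lebesgue"
  by (auto elim: cubesE)

lemma emeasure_cubes:
  assumes "Q \<in> cubes"
  shows "emeasure lebesgue Q \<noteq> 0" "emeasure lebesgue Q \<noteq> top"
  using assms by (auto elim!: cubesE simp: emeasure_cube simp del: emeasure_completion)

lemma nn_average_eq:
  assumes "Q \<in> cubes" "f \<in> borel_measurable lebesgue"
  shows "nn_average Q f = (\<integral>\<^sup>+ x. ennreal (f x) \<partial>uniform_measure lebesgue Q)"
  unfolding nn_average_def using assms
  by (subst nn_integral_uniform_measure) (auto simp: cubes_sets mult.commute)

lemma nn_average_1:
  assumes "Q \<in> cubes" shows "nn_average Q (\<lambda>x. 1) = 1"
  using emeasure_cubes[OF assms] cubes_sets[OF assms]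
  by (simp add: nn_average_def ennreal_divide_self less_top del: emeasure_completion)

lemma nn_average_mono_AE:
  assumes "AE x in lebesgue. f x \<le> g x"
  shows "nn_average Q f \<le> nn_average Q g"
  unfolding nn_average_def divide_ennreal_def using assms
  by (intro mult_right_mono nn_integral_mono_AE) (auto elim!: eventually_mono intro!: mult_right_mono ennreal_leI)

lemma nn_average_mono: "(\<And>x. f x \<le> g x) \<Longrightarrow> nn_average Q f \<le> nn_average Q g"
  by (rule nn_average_mono_AE) simp

lemma nn_average_cong_AE:
  assumes "AE x in lebesgue. f x = g x"
  shows "nn_average Q f = nn_average Q g"
  using assms by (intro antisym nn_average_mono_AE) (auto elim!: eventually_mono)

lemma nn_average_cmult:
  assumes "Q \<in> cubes" "f \<in> borel_measurable lebesgue" "0 \<le> c"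
  shows "nn_average Q (\<lambda>x. c * f x) = ennreal c * nn_average Q f"
proof -
  have "f \<in> borel_measurable (uniform_measure lebesgue Q)"
    using assms(2) by (simp add: uniform_measure_def)
  then show ?thesis
    using assms by (simp add: nn_average_eq ennreal_mult' nn_integral_cmult)
qed

lemma nn_average_Holder:
  assumes Q: "Q \<in> cubes"
    and fg: "f \<in> borel_measurable lebesgue" "g \<in> borel_measurable lebesgue" "\<And>x. 0 \<le> f x" "\<And>x. 0 \<le> g x"
    and r: "1 < r" "1 < r'" "1 / r + 1 / r' = 1" and AB: "0 < A" "0 < B"
    and f: "nn_average Q (\<lambda>x. f x powr r) \<le> ennreal (A powr r)"
    and g: "nn_average Q (\<lambda>x. g x powr r') \<le> ennreal (B powr r')"
  shows "nn_average Q (\<lambda>x. f x * g x) \<le> ennreal (A * B)"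
proof -
  note [measurable] = fg(1,2)
  have m: "f \<in> borel_measurable (uniform_measure lebesgue Q)" "g \<in> borel_measurable (uniform_measure lebesgue Q)"
    using fg by (simp_all add: uniform_measure_def)
  have "nn_average Q (\<lambda>x. f x * g x) = (\<integral>\<^sup>+ x. ennreal (f x * g x) \<partial>uniform_measure lebesgue Q)"
    by (rule nn_average_eq[OF Q]) measurable
  also have "\<dots> \<le> ennreal (A * B)"
  proof (rule nn_integral_Holder[OF m fg(3,4) r AB])
    show "(\<integral>\<^sup>+ x. ennreal (f x powr r) \<partial>uniform_measure lebesgue Q) \<le> ennreal (A powr r)"
      using f by (subst (asm) nn_average_eq[OF Q]) auto
    show "(\<integral>\<^sup>+ x. ennreal (g x powr r') \<partial>uniform_measure lebesgue Q) \<le> ennreal (B powr r')"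
      using g by (subst (asm) nn_average_eq[OF Q]) auto
  qed
  finally show ?thesis .
qed

lemma nn_average_pos:
  assumes Q: "Q \<in> cubes" and f: "f \<in> borel_measurable lebesgue" "AE x in lebesgue. 0 < f x"
  shows "nn_average Q f \<noteq> 0"
proof
  assume "nn_average Q f = 0"
  then have "(\<integral>\<^sup>+ x \<in> Q. ennreal (f x) \<partial>lebesgue) = 0"
    using emeasure_cubes[OF Q] by (simp add: nn_average_def ennreal_divide_eq_0_iff del: emeasure_completion)
  then have "AE x in lebesgue. ennreal (f x) * indicator Q x = 0"
    using f(1) cubes_sets[OF Q] by (subst (asm) nn_integral_0_iff_AE) auto
  with f(2) have "AE x in lebesgue. x \<notin> Q"
    by (rule eventually_elim2) (auto simp: indicator_def)
  then have "emeasure lebesgue Q = 0"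
    using cubes_sets[OF Q] by (subst (asm) AE_iff_measurable[where N=Q]) auto
  then show False
    using emeasure_cubes[OF Q] by (simp del: emeasure_completion)
qed

lemma compact_subset_cubes:
  fixes K :: "(real ^ 'n) set"
  assumes "compact K"
  obtains Q where "Q \<in> cubes" "K \<subseteq> Q"
proof -
  obtain B where B: "0 < B" "\<And>x. x \<in> K \<Longrightarrow> norm x \<le> B"
    using compact_imp_bounded[OF assms] bounded_pos by blast
  have "K \<subseteq> cbox (\<chi> i. - B) (\<chi> i. (\<chi> i. - B) $ i + 2 * B)"
  proof
    fix x assume "x \<in> K"
    then have "\<bar>x $ i\<bar> \<le> B" for i
      using B(2) component_le_norm_cart order_trans by blast
    then show "x \<in> cbox (\<chi> i. - B) (\<chi> i. (\<chi> i. - B) $ i + 2 * B)"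
      by (simp add: mem_box_cart abs_le_iff minus_le_iff)
  qed
  with B(1) show ?thesis
    by (intro that[OF cubesI[of "2 * B" "\<chi> i. - B"]]) auto
qed

lemma locally_integrable_measurable:
  fixes f :: "real ^ 'n \<Rightarrow> 'a :: euclidean_space"
  assumes "locally_integrable f"
  shows "f \<in> borel_measurable lebesgue"
proof -
  have "(\<lambda>x. indicator (cball 0 (real j)) x *\<^sub>R f x) \<in> borel_measurable lebesgue" for j
    using assms unfolding locally_integrable_def set_integrable_def
    by (metis borel_measurable_integrable compact_cball)
  moreover have "(\<lambda>j. indicator (cball 0 (real j)) x *\<^sub>R f x) \<longlonglongrightarrow> f x" for x
  proof (rule tendsto_eventually)
    show "\<forall>\<^sub>F j in sequentially. indicator (cball 0 (real j)) x *\<^sub>R f x = f x"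
      using eventually_ge_at_top[of "nat \<lceil>norm x\<rceil>"]
      by eventually_elim (auto simp: indicator_def nat_le_iff ceiling_le_iff)
  qed
  ultimately show ?thesis
    by (rule borel_measurable_LIMSEQ_metric)
qed

text \<open>Every compact set lies in a cube, so local integrability can be tested on averages,
  which is the form in which the weighted estimates arrive.\<close>

lemma locally_integrable_iff_nn_average:
  fixes f :: "real ^ 'n \<Rightarrow> real"
  assumes f: "\<And>x. 0 \<le> f x"
  shows "locally_integrable f \<longleftrightarrow> f \<in> borel_measurable lebesgue \<and> (\<forall>Q\<in>cubes. nn_average Q f < \<infinity>)"
proof (intro iffI conjI ballI; (elim conjE)?)
  assume *: "locally_integrable f"
  then show "f \<in> borel_measurable lebesgue"
    by (rule locally_integrable_measurable)
  fix Q :: "(real ^ 'n) set" assume Q: "Q \<in> cubes"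
  then have "compact Q"
    by (auto elim!: cubesE)
  then have "integrable lebesgue (\<lambda>x. indicator Q x *\<^sub>R f x)"
    using * unfolding locally_integrable_def set_integrable_def by blast
  then have "(\<integral>\<^sup>+ x. ennreal (norm (indicator Q x *\<^sub>R f x)) \<partial>lebesgue) < \<infinity>"
    by (simp add: integrable_iff_bounded)
  also have "(\<integral>\<^sup>+ x. ennreal (norm (indicator Q x *\<^sub>R f x)) \<partial>lebesgue) = (\<integral>\<^sup>+ x \<in> Q. ennreal (f x) \<partial>lebesgue)"
    using f by (intro nn_integral_cong) (auto simp: indicator_def)
  finally show "nn_average Q f < \<infinity>"
    using emeasure_cubes[OF Q] unfolding nn_average_def
    by (simp add: ennreal_divide_eq_top_iff less_top[symmetric] del: emeasure_completion)
next
  assume m: "f \<in> borel_measurable lebesgue" and *: "\<forall>Q\<in>cubes. nn_average Q f < \<infinity>"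
  show "locally_integrable f"
    unfolding locally_integrable_def
  proof (intro allI impI)
    fix K :: "(real ^ 'n) set" assume K: "compact K"
    then obtain Q where Q: "Q \<in> cubes" "K \<subseteq> Q"
      by (rule compact_subset_cubes)
    have Ks: "K \<in> sets lebesgue"
      using K by (simp add: borel_compact)
    have "(\<integral>\<^sup>+ x \<in> Q. ennreal (f x) \<partial>lebesgue) < \<infinity>"
      using *[rule_format, OF Q(1)] emeasure_cubes[OF Q(1)]
      by (auto simp add: nn_average_def ennreal_divide_eq_top_iff less_top[symmetric] simp del: emeasure_completion)
    moreover have "(\<integral>\<^sup>+ x. ennreal (norm (indicator K x *\<^sub>R f x)) \<partial>lebesgue) \<le> (\<integral>\<^sup>+ x \<in> Q. ennreal (f x) \<partial>lebesgue)"
      using f Q(2) by (intro nn_integral_mono) (auto simp: indicator_def)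
    ultimately show "f absolutely_integrable_on K"
      unfolding set_integrable_def using m Ks by (intro integrableI_bounded) auto
  qed
qed

section \<open>The class A_s: real-valued averages, lower bound of the constant, duality\<close>

lemma dual_exponent_facts:
  assumes "1 < s"
  shows "1 < dual_exponent s" "dual_exponent s - 1 = 1 / (s - 1)" "(1 - dual_exponent s) * (s - 1) = - 1"
    "dual_exponent (dual_exponent s) = s"
proof -
  show "dual_exponent s - 1 = 1 / (s - 1)"
    using assms by (simp add: dual_exponent_def field_simps)
  then show "(1 - dual_exponent s) * (s - 1) = - 1"
    using assms by (simp add: field_simps)
  show "1 < dual_exponent s" "dual_exponent (dual_exponent s) = s"
    using assms by (simp_all add: dual_exponent_def field_simps)
qed

lemma ennreal_powr_ennreal: "0 \<le> x \<Longrightarrow> ennreal_powr (ennreal x) a = ennreal (x powr a)"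
  by (simp add: ennreal_powr_def)

lemma A_class_measurable:
  assumes "v \<in> A_class s"
  shows "v \<in> borel_measurable lebesgue"
  using assms locally_integrable_measurable by (auto simp: A_class_def weight_def)

text \<open>Turns the extended averages into positive reals. The average of v is finite by local
  integrability and nonzero by positivity; hence an infinite dual average would make the product,
  and with it \<open>A_const\<close>, infinite.\<close>

lemma A_class_averages:
  assumes s: "1 < s" and v: "v \<in> A_class s" and Q: "Q \<in> cubes"
  obtains V S where "0 < V" "0 < S" "nn_average Q v = ennreal V"
    "nn_average Q (\<lambda>x. v x powr (1 - dual_exponent s)) = ennreal S"
    "V * S powr (s - 1) \<le> A_norm s v"
proof -
  let ?\<sigma> = "\<lambda>x. v x powr (1 - dual_exponent s)"
  have v': "\<And>x. 0 \<le> v x" "locally_integrable v" "AE x in lebesgue. 0 < v x" "A_const s v < \<infinity>"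
    using v by (auto simp: A_class_def weight_def)
  have m [measurable]: "v \<in> borel_measurable lebesgue"
    using v by (rule A_class_measurable)
  have pos: "nn_average Q v \<noteq> 0" "nn_average Q ?\<sigma> \<noteq> 0"
  proof -
    show "nn_average Q v \<noteq> 0"
      by (rule nn_average_pos[OF Q m v'(3)])
    show "nn_average Q ?\<sigma> \<noteq> 0"
      by (rule nn_average_pos[OF Q]) (measurable, use v'(3) in \<open>auto elim!: eventually_mono\<close>)
  qed
  have fin: "nn_average Q v < \<infinity>"
    using v'(1,2) Q by (simp add: locally_integrable_iff_nn_average)
  have le: "nn_average Q v * ennreal_powr (nn_average Q ?\<sigma>) (s - 1) \<le> A_const s v"
    unfolding A_const_def using Q by (rule SUP_upper)
  have "nn_average Q ?\<sigma> \<noteq> \<infinity>"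
  proof
    assume "nn_average Q ?\<sigma> = \<infinity>"
    then have "nn_average Q v * ennreal_powr (nn_average Q ?\<sigma>) (s - 1) = \<infinity>"
      using pos by (simp add: ennreal_powr_def ennreal_mult_eq_top_iff)
    with le v'(4) show False by simp
  qed
  then obtain S where S: "nn_average Q ?\<sigma> = ennreal S" "0 \<le> S"
    by (cases "nn_average Q ?\<sigma>") auto
  obtain V where V: "nn_average Q v = ennreal V" "0 \<le> V"
    using fin by (cases "nn_average Q v") auto
  have "ennreal (V * S powr (s - 1)) \<le> A_const s v"
    using le S V by (simp add: ennreal_powr_ennreal ennreal_mult)
  then have "V * S powr (s - 1) \<le> A_norm s v"
    unfolding A_norm_def using v'(4) V(2)
    by (metis enn2real_ennreal enn2real_mono infinity_ennreal_def mult_nonneg_nonneg powr_ge_zero)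
  moreover have "0 < V" "0 < S"
    using S V pos by (auto simp: less_le)
  ultimately show ?thesis
    using that S V by blast
qed

text \<open>The product in \<open>A_const\<close> is monotone in both averages, so upper bounds V
  and S are enough; Hoelder's inequality provides exactly such bounds.\<close>

lemma A_classI:
  fixes v :: "real ^ 'n \<Rightarrow> real"
  assumes s: "1 < s" and v: "v \<in> borel_measurable lebesgue" "\<And>x. 0 \<le> v x" "AE x in lebesgue. 0 < v x"
    and avg: "\<And>Q. Q \<in> cubes \<Longrightarrow> \<exists>V S. 0 \<le> V \<and> 0 \<le> S \<and> nn_average Q v \<le> ennreal V \<and>
      nn_average Q (\<lambda>x. v x powr (1 - dual_exponent s)) \<le> ennreal S \<and> V * S powr (s - 1) \<le> C"
  shows "v \<in> A_class s" "A_norm s v \<le> C"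
proof -
  let ?\<sigma> = "\<lambda>x. v x powr (1 - dual_exponent s)"
  \<comment> \<open>Any single cube shows C to be nonnegative, as the comparison with the real
    number \<open>A_norm\<close> requires.\<close>
  have "cbox 0 (\<chi> i. (0 :: real ^ 'n) $ i + 1) \<in> cubes"
    by (rule cubesI) simp
  from avg[OF this] have C: "0 \<le> C"
    by (meson mult_nonneg_nonneg order_trans powr_ge_zero)
  have "A_const s v \<le> ennreal C"
    unfolding A_const_def
  proof (rule SUP_least)
    fix Q :: "(real ^ 'n) set" assume "Q \<in> cubes"
    then obtain V S where VS: "0 \<le> V" "0 \<le> S" "nn_average Q v \<le> ennreal V"
      "nn_average Q ?\<sigma> \<le> ennreal S" "V * S powr (s - 1) \<le> C"
      using avg by meson
    then obtain S' where S': "nn_average Q ?\<sigma> = ennreal S'" "0 \<le> S'" "S' \<le> S"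
      by (cases "nn_average Q ?\<sigma>") (auto simp: top_unique)
    have "nn_average Q v * ennreal_powr (nn_average Q ?\<sigma>) (s - 1) \<le> ennreal V * ennreal (S powr (s - 1))"
      using VS(3) S' s by (intro mult_mono) (auto simp: ennreal_powr_ennreal intro!: ennreal_leI powr_mono2)
    also have "\<dots> \<le> ennreal C"
    proof -
      have "ennreal V * ennreal (S powr (s - 1)) = ennreal (V * S powr (s - 1))"
        using VS(1) by (simp add: ennreal_mult)
      then show ?thesis
        using VS(5) by (simp add: ennreal_leI)
    qed
    finally show "nn_average Q v * ennreal_powr (nn_average Q ?\<sigma>) (s - 1) \<le> ennreal C" .
  qed
  then have fin: "A_const s v < \<infinity>" and "A_norm s v \<le> C"
    unfolding A_norm_def using C by (auto simp: top_unique less_top[symmetric] intro: enn2real_leI)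
  have "nn_average Q v < \<infinity>" if "Q \<in> cubes" for Q
    using avg[OF that] by (metis ennreal_less_top infinity_ennreal_def le_less_trans)
  then have "locally_integrable v"
    using v by (simp add: locally_integrable_iff_nn_average)
  then show "v \<in> A_class s"
    using v fin by (auto simp: A_class_def weight_def)
  show "A_norm s v \<le> C" by fact
qed

text \<open>Hoelder's inequality for 1 = v^(1/s) v^(-1/s) on one cube. The bound keeps the arguments
  of \<phi> inside its domain.\<close>

lemma A_norm_ge_1:
  fixes v :: "real ^ 'n \<Rightarrow> real"
  assumes s: "1 < s" and v: "v \<in> A_class s"
  shows "1 \<le> A_norm s v"
proof -
  let ?s = "dual_exponent s"
  note d = dual_exponent_facts[OF s]
  define Q where "Q = cbox 0 (\<chi> i. (0 :: real ^ 'n) $ i + 1)"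
  have Q: "Q \<in> cubes"
    unfolding Q_def by (rule cubesI) simp
  from s v Q obtain V S where VS: "0 < V" "0 < S" "nn_average Q v = ennreal V"
    "nn_average Q (\<lambda>x. v x powr (1 - ?s)) = ennreal S" "V * S powr (s - 1) \<le> A_norm s v"
    by (rule A_class_averages)
  have v': "\<And>x. 0 \<le> v x" "AE x in lebesgue. 0 < v x"
    using v by (auto simp: A_class_def weight_def)
  have [measurable]: "v \<in> borel_measurable lebesgue"
    using v by (rule A_class_measurable)
  have e: "- 1 / s * ?s = 1 - ?s"
    using s by (simp add: dual_exponent_def field_simps)
  have "1 = nn_average Q (\<lambda>x. 1)"
    using Q by (simp add: nn_average_1)
  also have "\<dots> = nn_average Q (\<lambda>x. v x powr (1 / s) * v x powr (- 1 / s))"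
    using v'(2) by (intro nn_average_cong_AE) (auto elim!: eventually_mono simp: simp flip: powr_add)
  also have "\<dots> \<le> ennreal (V powr (1 / s) * S powr (1 / ?s))"
  proof (rule nn_average_Holder[OF Q, where r=s and r'="?s"])
    show "nn_average Q (\<lambda>x. (v x powr (1 / s)) powr s) \<le> ennreal ((V powr (1 / s)) powr s)"
      using VS s v' by (simp add: powr_powr)
    show "nn_average Q (\<lambda>x. (v x powr (- 1 / s)) powr ?s) \<le> ennreal ((S powr (1 / ?s)) powr ?s)"
      using VS s v' d e by (simp only: powr_powr) simp
  qed (use s d VS in \<open>auto simp: dual_exponent\<close>)
  finally have "1 \<le> V powr (1 / s) * S powr (1 / ?s)"
    by (simp add: ennreal_1[symmetric] del: ennreal_1)
  then have "1 powr s \<le> (V powr (1 / s) * S powr (1 / ?s)) powr s"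
    using s by (intro powr_mono2) auto
  also have "\<dots> = V * S powr (s - 1)"
    using VS s by (simp add: powr_mult powr_powr dual_exponent_def)
  finally show ?thesis
    using VS by simp
qed

text \<open>Since (1 - s') (1 - s) = 1, dualizing twice returns v almost everywhere, namely where v
  is positive. On each cube S V^(s'-1) is the 1/(s-1)-th power of V S^(s-1), which yields the
  constant.\<close>

lemma A_class_dual:
  fixes v :: "real ^ 'n \<Rightarrow> real"
  assumes s: "1 < s" and v: "v \<in> A_class s"
  defines "\<sigma> \<equiv> \<lambda>x. v x powr (1 - dual_exponent s)"
  shows "\<sigma> \<in> A_class (dual_exponent s)" "A_norm (dual_exponent s) \<sigma> \<le> A_norm s v powr (1 / (s - 1))"
proof -
  let ?s = "dual_exponent s"
  note d = dual_exponent_facts[OF s]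
  have v': "\<And>x. 0 \<le> v x" "AE x in lebesgue. 0 < v x"
    using v by (auto simp: A_class_def weight_def)
  have [measurable]: "v \<in> borel_measurable lebesgue"
    using v by (rule A_class_measurable)
  have "\<exists>V S. 0 \<le> V \<and> 0 \<le> S \<and> nn_average Q \<sigma> \<le> ennreal V \<and>
      nn_average Q (\<lambda>x. \<sigma> x powr (1 - dual_exponent ?s)) \<le> ennreal S \<and>
      V * S powr (?s - 1) \<le> A_norm s v powr (1 / (s - 1))" if Q: "Q \<in> cubes" for Q
  proof -
    from s v Q obtain V S where VS: "0 < V" "0 < S" "nn_average Q v = ennreal V"
      "nn_average Q \<sigma> = ennreal S" "V * S powr (s - 1) \<le> A_norm s v"
      unfolding \<sigma>_def by (rule A_class_averages)
    have "(1 - ?s) * (1 - s) = 1"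
      using d(3) by (simp add: algebra_simps)
    then have "nn_average Q (\<lambda>x. \<sigma> x powr (1 - dual_exponent ?s)) = nn_average Q v"
      using v'(2) unfolding \<sigma>_def d(4)
      by (intro nn_average_cong_AE) (auto elim!: eventually_mono simp: powr_powr)
    moreover have "S * V powr (?s - 1) \<le> A_norm s v powr (1 / (s - 1))"
    proof -
      have "(V * S powr (s - 1)) powr (1 / (s - 1)) \<le> A_norm s v powr (1 / (s - 1))"
        using VS s by (intro powr_mono2) auto
      then show ?thesis
        using VS s by (simp add: powr_mult powr_powr d(2) mult.commute)
    qed
    ultimately show ?thesis
      using VS by (intro exI[of _ S] exI[of _ V]) auto
  qed
  then show "\<sigma> \<in> A_class ?s" "A_norm ?s \<sigma> \<le> A_norm s v powr (1 / (s - 1))"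
    using d(1) v' by (intro A_classI; auto simp: \<sigma>_def elim!: eventually_mono; fail)+
qed

section \<open>Reverse Hoelder inequality and exponential perturbation for A_s weights\<close>

lemma nn_integral_hcube:
  fixes v :: "real ^ 'n \<Rightarrow> real"
  assumes l: "0 < l"
  shows "(\<integral>\<^sup>+ x \<in> hcube a l. ennreal (v x) \<partial>lebesgue) =
    nn_average (cbox a (\<chi> i. a $ i + l)) v * ennreal (l ^ CARD('n))"
proof -
  let ?Q = "cbox a (\<chi> i. a $ i + l)"
  have "(\<integral>\<^sup>+ x \<in> hcube a l. ennreal (v x) \<partial>lebesgue) = (\<integral>\<^sup>+ x \<in> ?Q. ennreal (v x) \<partial>lebesgue)"
    using AE_hcube_cbox[of a l]
    by (intro nn_integral_cong_AE) (auto elim!: eventually_mono simp: indicator_def)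
  also have "\<dots> = nn_average ?Q v * ennreal (l ^ CARD('n))"
    using l unfolding nn_average_def emeasure_cube[OF l]
    by (simp add: ennreal_divide_times ennreal_mult_divide_eq flip: ennreal_0)
  finally show ?thesis .
qed

text \<open>If {v \<le> t} fills the fraction \<rho> of the cube, the dual average is at least
  \<rho> t^(1-s'), and the A_s condition gives V \<rho>^(s-1) / t \<le> [v]. As V > h, the choice t
  = 2^(1-s) h / [v] forces \<rho> \<le> 1/2. This is the hypothesis \<open>half\<close> of the
  good-lambda inequality with \<beta> = 2^(1-s) / [v].\<close>

lemma A_class_half:
  fixes v :: "real ^ 'n \<Rightarrow> real"
  assumes s: "1 < s" and v: "v \<in> A_class s" and h: "0 < h" and l: "0 < l"
    and large: "ennreal h * emeasure lebesgue (hcube a l) < emeasure (density lebesgue (\<lambda>x. ennreal (v x))) (hcube a l)"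
  shows "emeasure lebesgue (hcube a l) \<le>
    2 * emeasure lebesgue (hcube a l \<inter> {x. 2 powr (1 - s) / A_norm s v * h < v x})"
proof -
  let ?s = "dual_exponent s"
  let ?\<sigma> = "\<lambda>x. v x powr (1 - ?s)"
  let ?H = "hcube a l" and ?Q = "cbox a (\<chi> i. a $ i + l)"
  define C where "C = A_norm s v"
  define t where "t = 2 powr (1 - s) / C * h"
  define L where "L = l ^ CARD('n)"
  note d = dual_exponent_facts[OF s]
  have [measurable]: "v \<in> borel_measurable lebesgue"
    using v by (rule A_class_measurable)
  have v': "AE x in lebesgue. 0 < v x"
    using v by (auto simp: A_class_def weight_def)
  have C: "1 \<le> C"
    unfolding C_def by (rule A_norm_ge_1[OF s v])
  have L: "0 < L" and t: "0 < t"
    using l h C by (auto simp: L_def t_def)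
  have "Measurable.pred lebesgue (\<lambda>x. t < v x)" "Measurable.pred lebesgue (\<lambda>x. v x \<le> t)"
    by measurable
  then have sets: "?H \<inter> {x. t < v x} \<in> sets lebesgue" "?H \<inter> {x. v x \<le> t} \<in> sets lebesgue"
    by (simp_all add: pred_def sets.Int)
  from s v cubesI[OF l, of a] obtain V S where VS: "0 < V" "0 < S" "nn_average ?Q v = ennreal V"
    "nn_average ?Q ?\<sigma> = ennreal S" "V * S powr (s - 1) \<le> C"
    unfolding C_def by (rule A_class_averages)
  have hV: "h < V"
  proof -
    have "emeasure (density lebesgue (\<lambda>x. ennreal (v x))) ?H = ennreal V * ennreal L"
      using nn_integral_hcube[OF l, of v a] by (simp add: emeasure_density VS(3) L_def)
    then have "ennreal (h * L) < ennreal (V * L)"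
      using large h VS L l by (simp add: emeasure_hcube ennreal_mult L_def del: emeasure_completion)
    then show ?thesis
      using h VS L by (simp add: ennreal_less_iff)
  qed
  have split: "emeasure lebesgue (?H \<inter> {x. t < v x}) + emeasure lebesgue (?H \<inter> {x. v x \<le> t}) = ennreal L"
  proof -
    have "emeasure lebesgue (?H \<inter> {x. t < v x}) + emeasure lebesgue (?H \<inter> {x. v x \<le> t}) =
        emeasure lebesgue (?H \<inter> {x. t < v x} \<union> ?H \<inter> {x. v x \<le> t})"
      using sets by (intro plus_emeasure) auto
    also have "?H \<inter> {x. t < v x} \<union> ?H \<inter> {x. v x \<le> t} = ?H"
      by auto
    finally show ?thesis
      using l by (simp add: emeasure_hcube L_def del: emeasure_completion)
  qed
  then obtain g f where gf: "emeasure lebesgue (?H \<inter> {x. t < v x}) = ennreal g" "0 \<le> g"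
      "emeasure lebesgue (?H \<inter> {x. v x \<le> t}) = ennreal f" "0 \<le> f"
    by (cases "emeasure lebesgue (?H \<inter> {x. t < v x})"; cases "emeasure lebesgue (?H \<inter> {x. v x \<le> t})") auto
  have gfL: "g + f = L"
    using split gf L by (simp flip: ennreal_plus)
  \<comment> \<open>The negative exponent makes the dual weight at least t^(1-s') on {v \<le> t}. At
    zeros of v this fails because \<open>0 powr a = 0\<close>, so positivity almost everywhere
    enters.\<close>
  have "t powr (1 - ?s) * f \<le> S * L"
  proof -
    have "ennreal (t powr (1 - ?s) * f) = (\<integral>\<^sup>+ x. ennreal (t powr (1 - ?s)) * indicator (?H \<inter> {x. v x \<le> t}) x \<partial>lebesgue)"
      using sets gf by (simp add: nn_integral_cmult_indicator ennreal_mult)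
    also have "\<dots> \<le> (\<integral>\<^sup>+ x \<in> ?H. ennreal (?\<sigma> x) \<partial>lebesgue)"
      using v' d(1)
      by (intro nn_integral_mono_AE) (auto elim!: eventually_mono simp: indicator_def intro!: ennreal_leI powr_mono2')
    also have "\<dots> = ennreal (S * L)"
      using l VS by (simp add: nn_integral_hcube L_def ennreal_mult)
    finally show ?thesis
      using VS L by simp
  qed
  then have "(t powr (1 - ?s) * (f / L)) \<le> S"
    using L by (simp add: field_simps)
  then have "(t powr (1 - ?s) * (f / L)) powr (s - 1) \<le> S powr (s - 1)"
    using gf L t s by (intro powr_mono2) auto
  then have "(f / L) powr (s - 1) / t \<le> S powr (s - 1)"
  proof -
    have "(t powr (1 - ?s) * (f / L)) powr (s - 1) = t powr ((1 - ?s) * (s - 1)) * (f / L) powr (s - 1)"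
      using gf L t by (subst powr_mult) (auto simp: powr_powr)
    then have "(t powr (1 - ?s) * (f / L)) powr (s - 1) = (f / L) powr (s - 1) / t"
      unfolding d(3) using t by (simp add: powr_minus_divide)
    then show ?thesis
      using \<open>(t powr (1 - ?s) * (f / L)) powr (s - 1) \<le> S powr (s - 1)\<close> by simp
  qed
  then have "h * ((f / L) powr (s - 1) / t) \<le> h * S powr (s - 1)"
    using h by (intro mult_left_mono) auto
  also have "\<dots> \<le> V * S powr (s - 1)"
    using hV by (intro mult_right_mono) auto
  also have "\<dots> \<le> C" by (rule VS)
  finally have "(f / L) powr (s - 1) \<le> 2 powr (1 - s)"
    using h C t unfolding t_def by (simp add: field_simps)
  also have "2 powr (1 - s) = (1 / 2) powr (s - 1)"
    by (simp add: powr_divide powr_minus_divide[symmetric])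
  finally have "f / L \<le> 1 / 2"
    using s powr_less_mono2[of "s - 1" "1 / 2" "f / L"] by (cases "f / L \<le> 1 / 2") auto
  then have "L \<le> 2 * g"
    using gfL L by (simp add: field_simps)
  then have "ennreal L \<le> 2 * ennreal g"
    using gf(2) by (metis ennreal_leI ennreal_mult' ennreal_numeral zero_le_numeral)
  then show ?thesis
    using l gf(1) unfolding t_def C_def by (simp add: emeasure_hcube L_def del: emeasure_completion)
qed

text \<open>With X = 1/\<beta> = 2^(s-1) C the left side is 2^(n+1) (\<delta> X) X^\<delta>. Here
  \<delta> X = 2^(s-1-2m-n) \<le> 1/2, hence X^\<delta> \<le> exp (\<delta> X) \<le> 2, and 2^(n+1)
  \<delta> X = 2^(s-2m) \<le> 1/4.\<close>

lemma reverse_holder_constant: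
  fixes s m C \<delta> :: real and n :: nat
  assumes s: "1 < s" and m: "s \<le> m" "2 \<le> m" and C: "1 \<le> C"
    and \<delta>: "\<delta> = 1 / (2 powr (2 * m + n) * C)"
  shows "2 ^ (n + 1) * \<delta> * (2 powr (1 - s) / C) powr - (1 + \<delta>) \<le> 1 / 2"
proof -
  define X where "X = 2 powr (s - 1) * C"
  have X: "0 < X" using C by (simp add: X_def)
  have \<delta>0: "0 < \<delta>" using C \<delta> by simp
  have "2 powr (1 - s) / C = 1 / X"
    by (simp add: X_def powr_diff)
  then have "(2 powr (1 - s) / C) powr - (1 + \<delta>) = X powr (1 + \<delta>)"
    using X by (simp only: powr_minus) (simp add: powr_divide inverse_eq_divide)
  also have "\<dots> = X * X powr \<delta>"
    using X by (simp add: powr_add)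
  finally have eq: "(2 powr (1 - s) / C) powr - (1 + \<delta>) = X * X powr \<delta>" .
  have \<delta>X: "\<delta> * X = 2 powr (s - 1 - 2 * m - n)"
    using C unfolding \<delta> X_def by (simp add: powr_diff powr_add divide_simps)
  also have "\<dots> \<le> 2 powr - 1"
    using m by (intro powr_mono) auto
  finally have le: "\<delta> * X \<le> 1 / 2" by (simp add: powr_minus_divide)
  have "X powr \<delta> = exp (\<delta> * ln X)"
    using X by (simp add: powr_def)
  also have "\<dots> \<le> exp (1 / 2)"
  proof -
    have "ln X \<le> X" using X ln_bound by auto
    then have "\<delta> * ln X \<le> \<delta> * X" using \<delta>0 by (intro mult_left_mono) auto
    then show ?thesis using le by simp
  qed
  also have "\<dots> \<le> 2"
    using exp_bound_half[of "1 / 2 :: real"] by simp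
  finally have X2: "X powr \<delta> \<le> 2" .
  have "2 ^ (n + 1) * \<delta> * (X * X powr \<delta>) = 2 ^ (n + 1) * (\<delta> * X) * X powr \<delta>"
    by simp
  also have "2 ^ (n + 1) * (\<delta> * X) = 2 powr (s - 2 * m)"
    unfolding \<delta>X by (simp add: powr_realpow[symmetric] powr_add[symmetric] powr_mult_base del: powr_realpow)
  also have "\<dots> * X powr \<delta> \<le> 2 powr - 2 * 2"
    using m X2 by (intro mult_mono powr_mono) auto
  also have "\<dots> = 1 / 2"
    by (simp add: powr_minus_divide)
  finally show ?thesis
    unfolding eq .
qed

text \<open>The exponent is expressed through a bound m \<ge> s in place of s, so that one m serves
  both v in A_s and its dual weight in A_s'.\<close>

lemma A_class_reverse_holder:
  fixes v :: "real ^ 'n \<Rightarrow> real"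
  assumes s: "1 < s" and v: "v \<in> A_class s" and m: "s \<le> m" "2 \<le> m"
    and \<delta>: "\<delta> = 1 / (2 powr (2 * m + CARD('n)) * A_norm s v)"
    and Q: "Q \<in> cubes" and V: "nn_average Q v = ennreal V" "0 < V"
  shows "nn_average Q (\<lambda>x. v x powr (1 + \<delta>)) \<le> ennreal (2 * V powr (1 + \<delta>))"
proof -
  from Q obtain a l where Q_eq: "Q = cbox a (\<chi> i. a $ i + l)" and l: "0 < l"
    by (rule cubesE)
  define C where "C = A_norm s v"
  have C: "1 \<le> C"
    unfolding C_def by (rule A_norm_ge_1[OF s v])
  have v': "v \<in> borel_measurable lebesgue" "\<And>x. 0 \<le> v x"
    using v A_class_measurable by (auto simp: A_class_def weight_def)
  have \<delta>0: "0 < \<delta>"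
    using C by (simp add: \<delta> C_def)
  have b: "2 powr (1 - s) / C \<le> 1"
  proof -
    have "2 powr (1 - s) \<le> 2 powr 0" using s by (intro powr_mono) auto
    then show ?thesis using C by simp
  qed
  have L: "0 < l ^ CARD('n)" using l by simp
  have "emeasure (density lebesgue (\<lambda>x. ennreal (v x))) (hcube a l) = ennreal (V * l ^ CARD('n))"
    using nn_integral_hcube[OF l, of v a] v'(1) V l
    by (simp add: emeasure_density Q_eq ennreal_mult)
  from reverse_holder[OF v' _ b \<delta>0 reverse_holder_constant[OF s m C \<delta>[folded C_def]]
      A_class_half[OF s v, folded C_def] l V(2) this]
  have "(\<integral>\<^sup>+ x \<in> hcube a l. ennreal (v x powr (1 + \<delta>)) \<partial>lebesgue) \<le> ennreal (2 * V powr (1 + \<delta>) * l ^ CARD('n))"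
    using C by simp
  then have "nn_average Q (\<lambda>x. v x powr (1 + \<delta>)) * ennreal (l ^ CARD('n)) \<le>
      ennreal (2 * V powr (1 + \<delta>)) * ennreal (l ^ CARD('n))"
    using l by (simp add: nn_integral_hcube Q_eq ennreal_mult')
  then have "ennreal (l ^ CARD('n)) * nn_average Q (\<lambda>x. v x powr (1 + \<delta>)) \<le>
      ennreal (l ^ CARD('n)) * ennreal (2 * V powr (1 + \<delta>))"
    by (simp only: mult.commute)
  moreover have "ennreal (l ^ CARD('n)) \<noteq> 0" "ennreal (l ^ CARD('n)) \<noteq> top"
    using l by auto
  ultimately show ?thesis
    by (subst (asm) ennreal_mult_le_mult_iff)
qed

text \<open>Hoelder's inequality with exponents 1 + \<delta> and 1 + 1/\<delta>. The reverse Hoelder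
  inequality contributes 2^(1/(1+\<delta>)) V and the oscillation bound 2^(1/(1+1/\<delta>)); the
  exponents are conjugate, so the two powers of 2 multiply to 2. The lower bound on \<kappa> says 1
  + 1/\<delta> \<le> \<kappa>.\<close>

lemma A_class_exp_average:
  fixes v u :: "real ^ 'n \<Rightarrow> real"
  assumes s: "1 < s" and v: "v \<in> A_class s" and m: "s \<le> m" "2 \<le> m"
    and Q: "Q \<in> cubes" and V: "nn_average Q v = ennreal V" "0 < V"
    and u: "u \<in> borel_measurable lebesgue"
    and \<kappa>: "1 + 2 powr (2 * m + CARD('n)) * A_norm s v \<le> \<kappa>"
    and osc: "nn_average Q (\<lambda>x. exp (\<kappa> * \<bar>u x - c\<bar>)) \<le> 2"
  shows "nn_average Q (\<lambda>x. v x * exp (u x)) \<le> ennreal (2 * V * exp c)"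
proof -
  define \<delta> where \<delta>: "\<delta> = 1 / (2 powr (2 * m + CARD('n)) * A_norm s v)"
  have "0 < A_norm s v"
    using A_norm_ge_1[OF s v] by simp
  then have \<delta>0: "0 < \<delta>"
    by (simp add: \<delta>)
  have r: "1 < 1 + \<delta>" "1 < 1 + 1 / \<delta>" "1 / (1 + \<delta>) + 1 / (1 + 1 / \<delta>) = 1"
    using \<delta>0 by (simp_all add: field_simps)
  have r': "1 + 1 / \<delta> \<le> \<kappa>"
    using \<kappa> by (simp add: \<delta>)
  have [measurable]: "v \<in> borel_measurable lebesgue" "u \<in> borel_measurable lebesgue"
    using A_class_measurable[OF v] u by auto
  have v': "\<And>x. 0 \<le> v x"
    using v by (auto simp: A_class_def weight_def)
  have "nn_average Q (\<lambda>x. v x * exp (u x - c)) \<le> ennreal (2 powr (1 / (1 + \<delta>)) * V * 2 powr (1 / (1 + 1 / \<delta>)))"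
  proof (rule nn_average_Holder[OF Q _ _ v' _ r])
    have "(2 powr (1 / (1 + \<delta>)) * V) powr (1 + \<delta>) = 2 * V powr (1 + \<delta>)"
      using V \<delta>0 by (simp add: powr_mult powr_powr)
    then show "nn_average Q (\<lambda>x. v x powr (1 + \<delta>)) \<le> ennreal ((2 powr (1 / (1 + \<delta>)) * V) powr (1 + \<delta>))"
      using A_class_reverse_holder[OF s v m \<delta> Q V] by simp
    have "nn_average Q (\<lambda>x. exp (u x - c) powr (1 + 1 / \<delta>)) \<le> nn_average Q (\<lambda>x. exp (\<kappa> * \<bar>u x - c\<bar>))"
    proof (rule nn_average_mono)
      fix x
      have "(1 + 1 / \<delta>) * (u x - c) \<le> (1 + 1 / \<delta>) * \<bar>u x - c\<bar>"
        using r by (intro mult_left_mono) auto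
      also have "\<dots> \<le> \<kappa> * \<bar>u x - c\<bar>"
        using r' by (intro mult_right_mono) auto
      finally show "exp (u x - c) powr (1 + 1 / \<delta>) \<le> exp (\<kappa> * \<bar>u x - c\<bar>)"
        by (simp add: exp_powr_real mult.commute)
    qed
    also have "\<dots> \<le> 2" by (rule osc)
    also have "2 = ennreal ((2 powr (1 / (1 + 1 / \<delta>))) powr (1 + 1 / \<delta>))"
    proof -
      have "1 + 1 / \<delta> \<noteq> 0" using r(2) by linarith
      then show ?thesis by (simp only: powr_powr) simp
    qed
    finally show "nn_average Q (\<lambda>x. exp (u x - c) powr (1 + 1 / \<delta>)) \<le>
        ennreal ((2 powr (1 / (1 + 1 / \<delta>))) powr (1 + 1 / \<delta>))" .
  qed (use V in auto)
  also have "2 powr (1 / (1 + \<delta>)) * V * 2 powr (1 / (1 + 1 / \<delta>)) = 2 powr (1 / (1 + \<delta>) + 1 / (1 + 1 / \<delta>)) * V"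
    by (simp only: powr_add mult_ac)
  also have "\<dots> = 2 * V"
    using r by simp
  finally have *: "nn_average Q (\<lambda>x. v x * exp (u x - c)) \<le> ennreal (2 * V)" .
  have "nn_average Q (\<lambda>x. v x * exp (u x)) = nn_average Q (\<lambda>x. exp c * (v x * exp (u x - c)))"
    by (simp add: exp_diff)
  also have "\<dots> = ennreal (exp c) * nn_average Q (\<lambda>x. v x * exp (u x - c))"
    by (rule nn_average_cmult[OF Q]) auto
  also have "\<dots> \<le> ennreal (exp c) * ennreal (2 * V)"
    by (intro mult_left_mono *) auto
  also have "\<dots> = ennreal (2 * V * exp c)"
    using V by (simp add: mult_ac flip: ennreal_mult)
  finally show ?thesis .
qed

text \<open>The previous lemma is applied to v with u and to the dual weight with (1 - s') u. Its
  two losses of a factor 2 combine to 2 * 2^(s-1). The number \<kappa> = 4 M [v]^e / min 1 (s-1),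
  with M = 2^(2m+n) and e = max 1 (1/(s-1)), satisfies both integrability requirements; the factor 4
  leaves room for the summand 1 in 1 + 1/\<delta>.\<close>

lemma A_class_perturbation:
  fixes v u :: "real ^ 'n \<Rightarrow> real"
  assumes s: "1 < s" and v: "v \<in> A_class s" and u: "u \<in> borel_measurable lebesgue"
    and \<kappa>: "\<kappa> = 2 powr (2 * max s (dual_exponent s) + CARD('n) + 2) *
      A_norm s v powr (max 1 (1 / (s - 1))) / min 1 (s - 1)"
    and osc: "\<And>Q. Q \<in> cubes \<Longrightarrow> \<exists>c. nn_average Q (\<lambda>x. exp (\<kappa> * \<bar>u x - c\<bar>)) \<le> 2"
  shows "(\<lambda>x. v x * exp (u x)) \<in> A_class s" "A_norm s (\<lambda>x. v x * exp (u x)) \<le> 2 powr s * A_norm s v"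
proof -
  let ?s = "dual_exponent s"
  let ?\<sigma> = "\<lambda>x. v x powr (1 - ?s)"
  define m where "m = max s ?s"
  define M where "M = 2 powr (2 * m + CARD('n))"
  define C where "C = A_norm s v"
  define e where "e = max 1 (1 / (s - 1))"
  note d = dual_exponent_facts[OF s]
  have C: "1 \<le> C"
    unfolding C_def by (rule A_norm_ge_1[OF s v])
  \<comment> \<open>Conjugate exponents satisfy (s - 1) (s' - 1) = 1, so they cannot both be below
    2. This gives the condition 2 \<le> m behind \<open>reverse_holder_constant\<close>.\<close>
  have "s * ?s = s + ?s"
    using s by (simp add: dual_exponent_def field_simps)
  then have "(s - 1) * (?s - 1) = 1"
    by (simp add: algebra_simps)
  then have m: "s \<le> m" "?s \<le> m" "2 \<le> m"
  proof -
    show "s \<le> m" "?s \<le> m" by (auto simp: m_def)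
    show "2 \<le> m"
    proof (rule ccontr)
      assume "\<not> 2 \<le> m"
      then have "(s - 1) * (?s - 1) < 1 * 1"
        using s d(1) unfolding m_def by (intro mult_strict_mono) auto
      then show False using \<open>(s - 1) * (?s - 1) = 1\<close> by simp
    qed
  qed
  have M: "1 \<le> M"
    unfolding M_def using m by (intro ge_one_powr_ge_zero) auto
  have \<kappa>': "\<kappa> = 4 * M * C powr e / min 1 (s - 1)"
    unfolding \<kappa> M_def C_def m_def e_def by (simp add: powr_add)
  have C_e: "C powr 1 \<le> C powr e" "C powr (1 / (s - 1)) \<le> C powr e"
    using C unfolding e_def by (intro powr_mono; simp)+
  have Ce: "1 \<le> C powr e"
    using C by (intro ge_one_powr_ge_zero) (auto simp: e_def)
  have \<sigma>: "?\<sigma> \<in> A_class ?s" "A_norm ?s ?\<sigma> \<le> C powr (1 / (s - 1))"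
    unfolding C_def by (rule A_class_dual[OF s v])+
  have MCe: "1 \<le> M * C powr e"
    using mult_mono[of 1 M 1 "C powr e"] M Ce by simp
  have \<kappa>1: "1 + M * C \<le> \<kappa>"
  proof -
    have "1 + M * C \<le> 2 * (M * C powr e)"
    proof -
      have "M * C \<le> M * C powr e"
        using M C C_e(1) by (intro mult_left_mono) auto
      then show ?thesis using MCe by simp
    qed
    also have "\<dots> \<le> 4 * (M * C powr e)"
      using MCe by simp
    also have "\<dots> = 4 * (M * C powr e) / 1" by simp
    also have "\<dots> \<le> 4 * (M * C powr e) / min 1 (s - 1)"
      using MCe s by (intro divide_left_mono) auto
    finally show ?thesis by (simp add: \<kappa>' mult.assoc)
  qed
  \<comment> \<open>The factor exp ((1 - s') u) on the dual weight scales the oscillation by s' - 1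
    = 1/(s-1), which is the source of the division by min 1 (s-1).\<close>
  have \<kappa>2: "(1 + M * A_norm ?s ?\<sigma>) * (?s - 1) \<le> \<kappa>"
  proof -
    have "M * A_norm ?s ?\<sigma> \<le> M * C powr e"
      using \<sigma>(2) C_e(2) M by (intro mult_left_mono) auto
    then have "1 + M * A_norm ?s ?\<sigma> \<le> 4 * (M * C powr e)"
      using MCe by simp
    then have "(1 + M * A_norm ?s ?\<sigma>) * (?s - 1) \<le> 4 * (M * C powr e) / (s - 1)"
      using s unfolding d(2) by (simp add: divide_right_mono)
    also have "\<dots> \<le> 4 * (M * C powr e) / min 1 (s - 1)"
      using MCe s by (intro divide_left_mono) auto
    finally show ?thesis by (simp add: \<kappa>' mult.assoc)
  qed
  have [measurable]: "v \<in> borel_measurable lebesgue" "u \<in> borel_measurable lebesgue"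
    using A_class_measurable[OF v] u by auto
  have v': "\<And>x. 0 \<le> v x" "AE x in lebesgue. 0 < v x"
    using v by (auto simp: A_class_def weight_def)
  have "\<exists>V S. 0 \<le> V \<and> 0 \<le> S \<and> nn_average Q (\<lambda>x. v x * exp (u x)) \<le> ennreal V \<and>
      nn_average Q (\<lambda>x. (v x * exp (u x)) powr (1 - ?s)) \<le> ennreal S \<and>
      V * S powr (s - 1) \<le> 2 powr s * C" if Q: "Q \<in> cubes" for Q
  proof -
    from s v Q obtain V S where VS: "0 < V" "0 < S" "nn_average Q v = ennreal V"
      "nn_average Q ?\<sigma> = ennreal S" "V * S powr (s - 1) \<le> C"
      unfolding C_def by (rule A_class_averages)
    obtain c where c: "nn_average Q (\<lambda>x. exp (\<kappa> * \<bar>u x - c\<bar>)) \<le> 2"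
      using osc[OF Q] by blast
    have "nn_average Q (\<lambda>x. v x * exp (u x)) \<le> ennreal (2 * V * exp c)"
      using \<kappa>1 unfolding M_def C_def by (rule A_class_exp_average[OF s v m(1,3) Q VS(3,1) u _ c])
    moreover have "nn_average Q (\<lambda>x. ?\<sigma> x * exp ((1 - ?s) * u x)) \<le> ennreal (2 * S * exp ((1 - ?s) * c))"
    proof (rule A_class_exp_average[OF d(1) \<sigma>(1) m(2,3) Q VS(4,2)])
      let ?k = "1 + 2 powr (2 * m + CARD('n)) * A_norm ?s ?\<sigma>"
      have "nn_average Q (\<lambda>x. exp (?k * \<bar>(1 - ?s) * u x - (1 - ?s) * c\<bar>)) \<le>
          nn_average Q (\<lambda>x. exp (\<kappa> * \<bar>u x - c\<bar>))"
      proof (rule nn_average_mono)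
        fix x
        have "\<bar>(1 - ?s) * u x - (1 - ?s) * c\<bar> = (?s - 1) * \<bar>u x - c\<bar>"
          using d(1) by (simp add: abs_mult flip: right_diff_distrib)
        then have "?k * \<bar>(1 - ?s) * u x - (1 - ?s) * c\<bar> = ((1 + M * A_norm ?s ?\<sigma>) * (?s - 1)) * \<bar>u x - c\<bar>"
          by (simp add: M_def)
        also have "\<dots> \<le> \<kappa> * \<bar>u x - c\<bar>"
          using \<kappa>2 by (intro mult_right_mono) auto
        finally show "exp (?k * \<bar>(1 - ?s) * u x - (1 - ?s) * c\<bar>) \<le> exp (\<kappa> * \<bar>u x - c\<bar>)"
          by simp
      qed
      then show "nn_average Q (\<lambda>x. exp (?k * \<bar>(1 - ?s) * u x - (1 - ?s) * c\<bar>)) \<le> 2"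
        using c by (rule order_trans)
    qed auto
    moreover have "(\<lambda>x. (v x * exp (u x)) powr (1 - ?s)) = (\<lambda>x. ?\<sigma> x * exp ((1 - ?s) * u x))"
      using v'(1) by (auto simp: powr_mult exp_powr_real mult.commute)
    \<comment> \<open>The centre c of the oscillation drops out: (1 - s') (s - 1) = -1 turns the
      dual exponential into exp (- c).\<close>
    moreover have "(2 * V * exp c) * (2 * S * exp ((1 - ?s) * c)) powr (s - 1) \<le> 2 powr s * C"
    proof -
      have "(2 * S * exp ((1 - ?s) * c)) powr (s - 1) =
          2 powr (s - 1) * S powr (s - 1) * exp ((1 - ?s) * c * (s - 1))"
        using VS by (simp add: powr_mult exp_powr_real)
      also have "(1 - ?s) * c * (s - 1) = ((1 - ?s) * (s - 1)) * c"
        by (simp only: mult_ac)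
      also have "\<dots> = - c"
        unfolding d(3) by simp
      finally have "(2 * V * exp c) * (2 * S * exp ((1 - ?s) * c)) powr (s - 1) =
          (2 * 2 powr (s - 1)) * (V * S powr (s - 1)) * (exp c * exp (- c))"
        by (simp only: mult_ac)
      also have "exp c * exp (- c) = 1"
        by (simp add: exp_minus_inverse)
      also have "2 * 2 powr (s - 1) = 2 powr s"
        by (simp add: powr_diff)
      finally have "(2 * V * exp c) * (2 * S * exp ((1 - ?s) * c)) powr (s - 1) = 2 powr s * (V * S powr (s - 1))"
        by (simp only: mult_1_right)
      then show ?thesis
        using VS(5) by (simp only: mult_left_mono powr_ge_zero)
    qed
    ultimately show ?thesis
      using VS by (intro exI[of _ "2 * V * exp c"] exI[of _ "2 * S * exp ((1 - ?s) * c)"]) simp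
  qed
  then show "(\<lambda>x. v x * exp (u x)) \<in> A_class s" "A_norm s (\<lambda>x. v x * exp (u x)) \<le> 2 powr s * A_norm s v"
    using v' unfolding C_def by (intro A_classI[OF s]; auto; fail)+
qed

section \<open>Perturbation of weights by functions of bounded mean oscillation\<close>

text \<open>The strict inequality yields an admissible parameter not exceeding t, and the
  exponential average decreases in that parameter. Thus the infimum need not be attained, and a
  symbol of norm 0 causes no division by zero.\<close>

lemma BMO_exp_average:
  assumes b: "b \<in> BMO" and t: "BMO_norm b < t" and Q: "Q \<in> cubes"
  shows "nn_average Q (\<lambda>x. exp (norm (b x - average Q b) / t)) \<le> 2"
proof -
  have fin: "BMO_seminorm b < \<infinity>"
    using b by (simp add: BMO_def)
  have "expL_norm Q (\<lambda>x. b x - average Q b) \<le> BMO_seminorm b"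
    unfolding BMO_seminorm_def using Q by (rule SUP_upper)
  also have "\<dots> = ennreal (BMO_norm b)"
    using fin by (simp add: BMO_norm_def)
  also have "\<dots> < ennreal t"
    using t by (intro ennreal_lessI) (auto simp: BMO_norm_def intro: le_less_trans[OF enn2real_nonneg])
  finally obtain t0 where t0: "0 < t0" "nn_average Q (\<lambda>x. exp (norm (b x - average Q b) / t0)) \<le> 2" "ennreal t0 < ennreal t"
    unfolding expL_norm_def by (auto simp: INF_less_iff)
  then have "t0 \<le> t"
    by (simp add: ennreal_less_iff)
  have "nn_average Q (\<lambda>x. exp (norm (b x - average Q b) / t)) \<le>
      nn_average Q (\<lambda>x. exp (norm (b x - average Q b) / t0))"
    using t0(1) \<open>t0 \<le> t\<close> by (intro nn_average_mono) (auto intro!: divide_left_mono)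
  also have "\<dots> \<le> 2" by (rule t0)
  finally show ?thesis .
qed

definition admissible :: "real \<Rightarrow> real \<Rightarrow> (real ^ 'n \<Rightarrow> real) \<Rightarrow> bool"
  where "admissible \<theta> s w \<longleftrightarrow> weight w \<and> (\<lambda>x. w x powr \<theta>) \<in> A_class s"

text \<open>This is \<theta> times the \<kappa> of \<open>A_class_perturbation\<close> for the
  weight w^\<theta>. Its reciprocal, divided by t, is the largest Lipschitz constant allowed in an
  exponent g(b) multiplying w.\<close>

definition bmo_const :: "real \<Rightarrow> real \<Rightarrow> (real ^ 'n \<Rightarrow> real) \<Rightarrow> real"
  where "bmo_const \<theta> s w = 2 powr (2 * max s (dual_exponent s) + CARD('n) + 2) * \<theta> / min 1 (s - 1) *
    A_norm s (\<lambda>x. w x powr \<theta>) powr (max 1 (1 / (s - 1)))"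

lemma admissible_measurable:
  "admissible \<theta> s w \<Longrightarrow> w \<in> borel_measurable lebesgue"
  by (simp add: admissible_def weight_def locally_integrable_measurable)

lemma admissible_nonneg: "admissible \<theta> s w \<Longrightarrow> 0 \<le> w x"
  by (simp add: admissible_def weight_def)

lemma admissible_pos_AE: "admissible \<theta> s w \<Longrightarrow> AE x in lebesgue. 0 < w x"
  by (auto simp: admissible_def A_class_def weight_def less_le elim!: eventually_mono)

lemma bmo_const_pos:
  assumes "1 < s" "0 < \<theta>" "admissible \<theta> s w"
  shows "0 < bmo_const \<theta> s w"
proof -
  have "1 \<le> A_norm s (\<lambda>x. w x powr \<theta>)"
    using assms by (intro A_norm_ge_1) (auto simp: admissible_def)
  then show ?thesis
    using assms by (simp add: bmo_const_def)
qed

lemma BMO_measurable: "b \<in> BMO \<Longrightarrow> b \<in> borel_measurable lebesgue"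
  by (simp add: BMO_def locally_integrable_measurable)

lemma weight_mono:
  fixes w w' :: "real ^ 'n \<Rightarrow> real"
  assumes w: "weight w" and w': "w' \<in> borel_measurable lebesgue" "\<And>x. 0 \<le> w' x" "\<And>x. w' x \<le> B * w x" and B: "0 \<le> B"
  shows "weight w'"
proof -
  have *: "\<And>x. 0 \<le> w x" "w \<in> borel_measurable lebesgue" "\<And>Q. Q \<in> cubes \<Longrightarrow> nn_average Q w < \<infinity>"
    using w by (auto simp: weight_def locally_integrable_iff_nn_average)
  have "nn_average Q w' < \<infinity>" if Q: "Q \<in> cubes" for Q
  proof -
    have "nn_average Q w' \<le> nn_average Q (\<lambda>x. B * w x)"
      by (intro nn_average_mono w')
    also have "\<dots> = ennreal B * nn_average Q w"
      by (rule nn_average_cmult[OF Q *(2) B])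
    also have "\<dots> < \<infinity>"
      using *(3)[OF Q] by (simp add: ennreal_mult_less_top)
    finally show ?thesis .
  qed
  then show ?thesis
    using w' by (simp add: weight_def locally_integrable_iff_nn_average)
qed

text \<open>The oscillation of \<open>g \<circ> b\<close> about \<open>g (b\<^sub>Q)\<close> is controlled by that of \<open>b\<close> about \<open>b\<^sub>Q\<close>
  for every Lipschitz function \<open>g\<close>, so truncations of \<open>b\<close> cost nothing.\<close>

lemma admissible_perturbation:
  fixes w :: "real ^ 'n \<Rightarrow> real" and g :: "complex \<Rightarrow> real"
  assumes s: "1 < s" and \<theta>: "0 < \<theta>" and w: "admissible \<theta> s w" and b: "b \<in> BMO" and t: "BMO_norm b < t"
    and g: "\<And>y z. \<bar>g y - g z\<bar> \<le> 1 / (bmo_const \<theta> s w * t) * norm (y - z)"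
    and B: "\<And>z. exp (- g z) \<le> B"
  shows "admissible \<theta> s (\<lambda>x. w x * exp (- g (b x)))"
    "A_norm s (\<lambda>x. (w x * exp (- g (b x))) powr \<theta>) \<le> 2 powr s * A_norm s (\<lambda>x. w x powr \<theta>)"
proof -
  let ?v = "\<lambda>x. w x powr \<theta>" and ?u = "\<lambda>x. - \<theta> * g (b x)"
  define \<kappa> where "\<kappa> = 2 powr (2 * max s (dual_exponent s) + CARD('n) + 2) *
      A_norm s ?v powr (max 1 (1 / (s - 1))) / min 1 (s - 1)"
  have K: "bmo_const \<theta> s w = \<kappa> * \<theta>"
    by (simp add: bmo_const_def \<kappa>_def)
  have K0: "0 < \<kappa> * \<theta>"
    using bmo_const_pos[OF s \<theta> w] unfolding K .
  then have \<kappa>0: "0 < \<kappa>"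
    using \<theta> by (simp add: zero_less_mult_iff)
  have t0: "0 < t"
    using t by (auto simp: BMO_norm_def intro: le_less_trans[OF enn2real_nonneg])
  have "continuous_on UNIV g"
  proof (rule continuous_onI)
    fix z :: complex and e :: real assume "0 < e"
    let ?L = "1 / (bmo_const \<theta> s w * t)"
    have "0 < ?L" using K0 t0 by (simp add: K)
    then show "\<exists>d>0. \<forall>z'\<in>UNIV. dist z' z < d \<longrightarrow> dist (g z') (g z) \<le> e"
    proof (intro exI[of _ "e / ?L"] conjI ballI impI)
      fix z' assume "dist z' z < e / ?L"
      then have "?L * norm (z' - z) \<le> e"
        using \<open>0 < ?L\<close> by (simp add: dist_norm field_simps)
      then show "dist (g z') (g z) \<le> e"
        using g[of z' z] by (simp add: dist_real_def)
    qed (use \<open>0 < e\<close> in simp)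
  qed
  then have [measurable]: "g \<in> borel_measurable borel"
    by (rule borel_measurable_continuous_onI)
  have [measurable]: "b \<in> borel_measurable lebesgue" "w \<in> borel_measurable lebesgue"
    using b w by (auto intro: BMO_measurable admissible_measurable)
  have osc: "\<exists>c. nn_average Q (\<lambda>x. exp (\<kappa> * \<bar>?u x - c\<bar>)) \<le> 2" if Q: "Q \<in> cubes" for Q
  proof (rule exI)
    let ?c = "- \<theta> * g (average Q b)"
    have "nn_average Q (\<lambda>x. exp (\<kappa> * \<bar>?u x - ?c\<bar>)) \<le> nn_average Q (\<lambda>x. exp (norm (b x - average Q b) / t))"
    proof (rule nn_average_mono)
      fix x
      have "\<bar>?u x - ?c\<bar> = \<theta> * \<bar>g (b x) - g (average Q b)\<bar>"
        using \<theta> by (simp add: abs_mult abs_minus_commute flip: right_diff_distrib)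
      then have "\<kappa> * \<bar>?u x - ?c\<bar> = (\<kappa> * \<theta>) * \<bar>g (b x) - g (average Q b)\<bar>"
        by simp
      also have "\<dots> \<le> (\<kappa> * \<theta>) * (1 / (\<kappa> * \<theta> * t) * norm (b x - average Q b))"
        using g[of "b x" "average Q b"] K0 unfolding K by (intro mult_left_mono) auto
      also have "\<dots> = norm (b x - average Q b) / t"
        using \<kappa>0 \<theta> t0 by simp
      finally show "exp (\<kappa> * \<bar>?u x - ?c\<bar>) \<le> exp (norm (b x - average Q b) / t)" by simp
    qed
    also have "\<dots> \<le> 2"
      by (rule BMO_exp_average[OF b t Q])
    finally show "nn_average Q (\<lambda>x. exp (\<kappa> * \<bar>?u x - ?c\<bar>)) \<le> 2" .
  qed
  have v: "?v \<in> A_class s"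
    using w by (simp add: admissible_def)
  have eq: "(\<lambda>x. (w x * exp (- g (b x))) powr \<theta>) = (\<lambda>x. ?v x * exp (?u x))"
    using admissible_nonneg[OF w] by (auto simp: powr_mult exp_powr_real mult.commute)
  have "?u \<in> borel_measurable lebesgue" by measurable
  note pert = A_class_perturbation[OF s v this \<kappa>_def osc]
  \<comment> \<open>The A_s condition supplies local integrability of the \<theta>-th power only.
    For the perturbed weight itself it comes from the bound B on the exponential factor.\<close>
  have "weight (\<lambda>x. w x * exp (- g (b x)))"
  proof (rule weight_mono[where B=B])
    show "weight w" using w by (simp add: admissible_def)
    show "0 \<le> B" using B[of 0] by (meson exp_ge_zero order_trans)
    show "w x * exp (- g (b x)) \<le> B * w x" for x
      using mult_right_mono[OF B[of "b x"] admissible_nonneg[OF w, of x]] by (simp only: mult.commute)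
  qed (use admissible_nonneg[OF w] in auto)
  then show "admissible \<theta> s (\<lambda>x. w x * exp (- g (b x)))"
    using pert(1) unfolding admissible_def eq by simp
  show "A_norm s (\<lambda>x. (w x * exp (- g (b x))) powr \<theta>) \<le> 2 powr s * A_norm s ?v"
    using pert(2) unfolding eq .
qed

section \<open>Algebra of commutators\<close>

lemma scaleC_zero_left [simp]: "0 *\<^sub>C x = (0 :: 'b::complex_banach)"
  using norm_scaleC[of 0 x] by simp

lemma scaleC_zero_right [simp]: "c *\<^sub>C 0 = (0 :: 'b::complex_banach)"
  using norm_scaleC[of c 0] by simp

lemma scaleC_one [simp]: "1 *\<^sub>C x = (x :: 'b::complex_banach)"
  using scaleC_of_real[of 1 x] by simp

lemma scaleC_minus_left: "(- c) *\<^sub>C x = - (c *\<^sub>C x :: 'b::complex_banach)"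
  using scaleC_add_left[of "- c" c x] by (simp add: eq_neg_iff_add_eq_0)

lemma scaleC_sum_left: "(\<Sum>i\<in>I. c i) *\<^sub>C x = (\<Sum>i\<in>I. c i *\<^sub>C (x :: 'b::complex_banach))"
  by (induction I rule: infinite_finite_induct) (auto simp: scaleC_add_left)

lemma scaleC_sum_right: "c *\<^sub>C (\<Sum>i\<in>I. x i) = (\<Sum>i\<in>I. c *\<^sub>C (x i :: 'b::complex_banach))"
  by (induction I rule: infinite_finite_induct) (auto simp: scaleC_add_right)

lemma continuous_on_scaleC_left:
  fixes x :: "'b::complex_banach"
  assumes "continuous_on S f"
  shows "continuous_on S (\<lambda>z. f z *\<^sub>C x)"
proof -
  have "bounded_linear (\<lambda>c. c *\<^sub>C x)"
  proof (rule bounded_linear_intro[where K="norm x"])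
    fix r :: real and c :: complex
    have "(r *\<^sub>R c) *\<^sub>C x = of_real r *\<^sub>C (c *\<^sub>C x)"
      by (simp add: scaleC_scaleC scaleR_conv_of_real)
    then show "(r *\<^sub>R c) *\<^sub>C x = r *\<^sub>R (c *\<^sub>C x)"
      by (simp add: scaleC_of_real)
  qed (auto simp: scaleC_add_left norm_scaleC)
  then show ?thesis
    using assms by (rule bounded_linear.continuous_on)
qed

lemma tendsto_scaleC_right:
  fixes x :: "'i \<Rightarrow> 'b::complex_banach"
  assumes "(x \<longlongrightarrow> y) F"
  shows "((\<lambda>i. c *\<^sub>C x i) \<longlongrightarrow> c *\<^sub>C y) F"
proof -
  have "bounded_linear (\<lambda>x :: 'b. c *\<^sub>C x)"
  proof (rule bounded_linear_intro[where K="norm c"])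
    fix r :: real and y :: 'b
    have "c *\<^sub>C (of_real r *\<^sub>C y) = of_real r *\<^sub>C (c *\<^sub>C y)"
      by (simp add: scaleC_scaleC mult.commute)
    then show "c *\<^sub>C (r *\<^sub>R y) = r *\<^sub>R (c *\<^sub>C y)"
      by (simp add: scaleC_of_real)
  qed (auto simp: scaleC_add_right norm_scaleC mult.commute)
  then show ?thesis
    using assms by (rule bounded_linear.tendsto)
qed

text \<open>Each commutator step multiplies by b either inside L or outside it, so only Pascal's
  rule enters and the identity holds at every point. The induction generalizes f because the inner
  step replaces f by b f.\<close>

lemma iter_commutator_expansion:
  fixes L :: "(real ^ 'n \<Rightarrow> complex) \<Rightarrow> real ^ 'n \<Rightarrow> 'b::complex_banach"
  shows "iter_commutator k L b f x =
    (\<Sum>j\<le>k. (of_nat (k choose j) * (- b x) ^ (k - j)) *\<^sub>C L (\<lambda>y. b y ^ j * f y) x)"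
proof (induction k arbitrary: f)
  case 0
  show ?case by (simp add: iter_commutator_def)
next
  case (Suc k)
  let ?X = "\<lambda>j. L (\<lambda>y. b y ^ j * f y) x" and ?\<beta> = "- b x"
  have "iter_commutator (Suc k) L b f x =
      iter_commutator k L b (\<lambda>y. b y * f y) x - b x *\<^sub>C iter_commutator k L b f x"
    by (simp add: iter_commutator_def commutator_def)
  also have "iter_commutator k L b (\<lambda>y. b y * f y) x = (\<Sum>j\<le>k. (of_nat (k choose j) * ?\<beta> ^ (k - j)) *\<^sub>C ?X (Suc j))"
    unfolding Suc.IH by (simp add: mult_ac)
  also have "b x *\<^sub>C iter_commutator k L b f x = - (\<Sum>j\<le>k. (of_nat (k choose j) * ?\<beta> ^ (Suc k - j)) *\<^sub>C ?X j)"
    unfolding Suc.IH scaleC_sum_right sum_negf[symmetric]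
    by (intro sum.cong refl) (simp add: scaleC_scaleC Suc_diff_le scaleC_minus_left[symmetric] mult_ac)
  \<comment> \<open>The added term j = k + 1 has binomial coefficient 0; it allows the index shift
    that lines the two sums up for Pascal's rule.\<close>
  also have "(\<Sum>j\<le>k. (of_nat (k choose j) * ?\<beta> ^ (Suc k - j)) *\<^sub>C ?X j) =
      (\<Sum>j\<le>Suc k. (of_nat (k choose j) * ?\<beta> ^ (Suc k - j)) *\<^sub>C ?X j)"
    by (simp add: binomial_eq_0)
  also have "\<dots> = ?\<beta> ^ Suc k *\<^sub>C ?X 0 + (\<Sum>j\<le>k. (of_nat (k choose Suc j) * ?\<beta> ^ (k - j)) *\<^sub>C ?X (Suc j))"
    by (subst sum.atMost_Suc_shift) simp
  also have "(\<Sum>j\<le>k. (of_nat (k choose j) * ?\<beta> ^ (k - j)) *\<^sub>C ?X (Suc j)) -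
      - (?\<beta> ^ Suc k *\<^sub>C ?X 0 + (\<Sum>j\<le>k. (of_nat (k choose Suc j) * ?\<beta> ^ (k - j)) *\<^sub>C ?X (Suc j))) =
      ?\<beta> ^ Suc k *\<^sub>C ?X 0 + (\<Sum>j\<le>k. (of_nat (Suc k choose Suc j) * ?\<beta> ^ (k - j)) *\<^sub>C ?X (Suc j))"
    by (simp add: sum.distrib scaleC_add_left distrib_right)
  also have "\<dots> = (\<Sum>j\<le>Suc k. (of_nat (Suc k choose j) * ?\<beta> ^ (Suc k - j)) *\<^sub>C ?X j)"
    by (simp add: sum.atMost_Suc_shift del: sum.atMost_Suc)
  finally show ?case .
qed

lemma linear_operator_onD:
  assumes "linear_operator_on D L" "f \<in> D" "g \<in> D"
  shows "(\<lambda>x. \<alpha> * f x + \<beta> * g x) \<in> D"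
    "AE x in lebesgue. L (\<lambda>x. \<alpha> * f x + \<beta> * g x) x = \<alpha> *\<^sub>C L f x + \<beta> *\<^sub>C L g x"
  using assms unfolding linear_operator_on_def by blast+

lemma linear_operator_on_sum:
  fixes L :: "(real ^ 'n \<Rightarrow> complex) \<Rightarrow> real ^ 'n \<Rightarrow> 'b::complex_banach"and M :: nat
  assumes L: "linear_operator_on D L" and f: "\<And>j. j \<le> M \<Longrightarrow> f j \<in> D"
  shows "(\<lambda>x. \<Sum>j\<le>M. \<alpha> j * f j x) \<in> D \<and>
    (AE x in lebesgue. L (\<lambda>x. \<Sum>j\<le>M. \<alpha> j * f j x) x = (\<Sum>j\<le>M. \<alpha> j *\<^sub>C L (f j) x))"
  using f
proof (induction M)
  case 0
  then have "(\<lambda>x. \<alpha> 0 * f 0 x + 0 * f 0 x) \<in> D"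
    "AE x in lebesgue. L (\<lambda>x. \<alpha> 0 * f 0 x + 0 * f 0 x) x = \<alpha> 0 *\<^sub>C L (f 0) x + 0 *\<^sub>C L (f 0) x"
    using L by (intro linear_operator_onD; simp)+
  then show ?case by simp
next
  case (Suc M)
  let ?g = "\<lambda>x. \<Sum>j\<le>M. \<alpha> j * f j x"
  have IH: "?g \<in> D" "AE x in lebesgue. L ?g x = (\<Sum>j\<le>M. \<alpha> j *\<^sub>C L (f j) x)"
    using Suc by auto
  have "f (Suc M) \<in> D"
    using Suc.prems by simp
  from linear_operator_onD[OF L IH(1) this] have *: "(\<lambda>x. 1 * ?g x + \<alpha> (Suc M) * f (Suc M) x) \<in> D"
    "AE x in lebesgue. L (\<lambda>x. 1 * ?g x + \<alpha> (Suc M) * f (Suc M) x) x = 1 *\<^sub>C L ?g x + \<alpha> (Suc M) *\<^sub>C L (f (Suc M)) x"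
    by blast+
  have "AE x in lebesgue. L (\<lambda>x. \<Sum>j\<le>Suc M. \<alpha> j * f j x) x = (\<Sum>j\<le>Suc M. \<alpha> j *\<^sub>C L (f j) x)"
    using *(2) IH(2) by eventually_elim simp
  with *(1) show ?case by simp
qed

text \<open>Simple functions approximating b take finitely many values, so inserting them preserves
  measurability; continuity in c carries it to the limit. It is needed since b(x) appears as a
  coefficient in front of vector values that are measurable only through norms.\<close>

lemma borel_measurable_Caratheodory:
  fixes \<Psi> :: "'a :: {metric_space, second_countable_topology} \<Rightarrow> 'c \<Rightarrow> real"
  assumes m: "\<And>c. \<Psi> c \<in> borel_measurable M" and c: "\<And>x. continuous_on UNIV (\<lambda>c. \<Psi> c x)"
    and b: "b \<in> borel_measurable M"
  shows "(\<lambda>x. \<Psi> (b x) x) \<in> borel_measurable M"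
proof -
  obtain F where F: "\<And>i. simple_function M (F i)" "\<And>x. x \<in> space M \<Longrightarrow> (\<lambda>i. F i x) \<longlonglongrightarrow> b x"
    using borel_measurable_implies_sequence_metric[OF b] by meson
  have "(\<lambda>x. \<Psi> (F i x) x) \<in> borel_measurable M" for i
  proof (rule measurable_compose_countable'[where I="F i ` space M" and f="\<lambda>c x. \<Psi> c x"])
    show "F i \<in> measurable M (count_space (F i ` space M))"
      using F(1)[of i] by (auto simp: simple_function_def measurable_def)
        (metis (no_types, lifting) UN_simps(1) simple_function_def simple_functionD(2) F(1))
    show "countable (F i ` space M)"
      using simple_functionD(1)[OF F(1)] by (rule countable_finite)
  qed (rule m)
  moreover have "(\<lambda>i. \<Psi> (F i x) x) \<longlonglongrightarrow> \<Psi> (b x) x" if "x \<in> space M" for x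
    using c[of x] F(2)[OF that] by (auto intro: continuous_on_tendsto_compose[where s=UNIV])
  ultimately show ?thesis
    by (rule borel_measurable_LIMSEQ_metric)
qed

section \<open>Taylor polynomials of the exponential and sums over roots of unity\<close>

definition exp_poly :: "nat \<Rightarrow> complex \<Rightarrow> complex"
  where "exp_poly M u = (\<Sum>j\<le>M. u ^ j / fact j)"

text \<open>The error has to be relative, because exp (Re u) must later cancel against a weight. On
  the disc of radius r one has exp (Re u) \<ge> exp (- r), so a remainder small compared with exp (-
  r) is also small relative to exp (Re u).\<close>

lemma exp_poly_bound:
  assumes "0 < \<eta>"
  obtains M where "k \<le> M" "\<And>u. norm u \<le> \<rho> \<Longrightarrow> norm (exp_poly M u) \<le> (1 + \<eta>) * exp (Re u)"
proof -
  let ?r = "max \<rho> 0"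
  have "(\<lambda>n. inverse (fact n) * ?r ^ n) \<longlonglongrightarrow> 0"
    by (rule summable_LIMSEQ_zero[OF summable_exp])
  then have "(\<lambda>n. exp (2 * ?r) * ?r * (inverse (fact n) * ?r ^ n)) \<longlonglongrightarrow> exp (2 * ?r) * ?r * 0"
    by (rule tendsto_mult_left)
  then have "\<forall>\<^sub>F n in sequentially. exp (2 * ?r) * ?r * (inverse (fact n) * ?r ^ n) < \<eta>"
    using assms by (intro order_tendstoD) auto
  then have "\<forall>\<^sub>F n in sequentially. exp (2 * ?r) * ?r * (inverse (fact n) * ?r ^ n) < \<eta> \<and> k \<le> n"
    using eventually_ge_at_top[of k] by (rule eventually_conj)
  then obtain M where M: "k \<le> M" "exp (2 * ?r) * ?r * (inverse (fact M) * ?r ^ M) < \<eta>"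
    by (auto simp: eventually_sequentially)
  show ?thesis
  proof (rule that[OF M(1)])
    fix u :: complex assume "norm u \<le> \<rho>"
    then have u: "norm u \<le> ?r" by simp
    have Re: "\<bar>Re u\<bar> \<le> ?r"
      using abs_Re_le_cmod u by (rule order_trans)
    have "norm (exp u - exp_poly M u) \<le> exp \<bar>Re u\<bar> * norm u ^ Suc M / fact M"
      unfolding exp_poly_def by (rule Taylor_exp)
    also have "\<dots> \<le> exp ?r * ?r ^ Suc M / fact M"
      using u Re by (intro divide_right_mono mult_mono power_mono) auto
    also have "\<dots> = exp (- ?r) * (exp (2 * ?r) * ?r * (inverse (fact M) * ?r ^ M))"
      by (simp add: field_simps flip: exp_add)
    also have "\<dots> \<le> exp (Re u) * \<eta>"
      using M(2) Re assms by (intro mult_mono) auto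
    finally have "norm (exp u - exp_poly M u) \<le> exp (Re u) * \<eta>" .
    moreover have "norm (exp_poly M u) \<le> norm (exp u) + norm (exp u - exp_poly M u)"
      by (metis norm_minus_commute norm_triangle_sub)
    ultimately show "norm (exp_poly M u) \<le> (1 + \<eta>) * exp (Re u)"
      by (simp add: algebra_simps norm_exp_eq_Re)
  qed
qed

definition circle_pt :: "real \<Rightarrow> nat \<Rightarrow> nat \<Rightarrow> complex"
  where "circle_pt \<epsilon> N m = of_real \<epsilon> * cis (2 * pi * real m / real N)"

lemma norm_circle_pt: "0 < \<epsilon> \<Longrightarrow> norm (circle_pt \<epsilon> N m) = \<epsilon>"
  by (simp add: circle_pt_def norm_mult)

text \<open>Up to a power of \<epsilon> the sum is geometric in y = exp (2 pi i (j - k) / N). The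
  restriction j, k < N ensures y \<noteq> 1 for j \<noteq> k, while y^N = 1.\<close>

lemma circle_pt_orthogonal:
  assumes \<epsilon>: "0 < \<epsilon>" and jk: "j < N" "k < N"
  shows "(\<Sum>m<N. circle_pt \<epsilon> N m ^ j / circle_pt \<epsilon> N m ^ k) = (if j = k then of_nat N else 0)"
proof (cases "j = k")
  case True
  have "circle_pt \<epsilon> N m \<noteq> 0" for m
    using norm_circle_pt[OF \<epsilon>, of N m] \<epsilon> by auto
  then show ?thesis using True by simp
next
  case False
  have N: "0 < N" using jk by simp
  define y where "y = cis (2 * pi * (real j - real k) / real N)"
  have yN: "y ^ N = 1"
  proof -
    have "y ^ N = cis (real N * (2 * pi * (real j - real k) / real N))"
      by (simp only: y_def Complex.DeMoivre)
    also have "real N * (2 * pi * (real j - real k) / real N) = 2 * pi * real_of_int (int j - int k)"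
      using N by simp
    also have "cis (2 * pi * real_of_int (int j - int k)) = 1"
      by (rule cis_multiple_2pi) (rule Ints_of_int)
    finally show ?thesis .
  qed
  have "y \<noteq> 1"
  proof
    assume "y = 1"
    then have "cos (2 * pi * (real j - real k) / real N) = 1"
      by (metis cis.simps(1) one_complex.simps(1) y_def)
    then obtain i :: int where "2 * pi * (real j - real k) / real N = real_of_int i * 2 * pi"
      using cos_one_2pi_int by auto
    then have "2 * pi * (real j - real k) = 2 * pi * (real_of_int i * real N)"
      using N by (simp add: divide_eq_eq mult_ac)
    then have "real j - real k = real_of_int i * real N"
      by (subst (asm) mult_cancel_left) simp
    then have "int j - int k = i * int N"
      by (metis of_int_diff of_int_eq_iff of_int_mult of_int_of_nat_eq)
    moreover have "\<bar>int j - int k\<bar> < int N" "int j - int k \<noteq> 0"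
      using jk False by auto
    ultimately show False
      by (metis abs_ge_zero dvd_imp_le_int dvd_triv_right linorder_not_le abs_of_nat)
  qed
  have "circle_pt \<epsilon> N m ^ j / circle_pt \<epsilon> N m ^ k = of_real (\<epsilon> ^ j / \<epsilon> ^ k) * y ^ m" for m
    by (simp add: circle_pt_def y_def power_mult_distrib Complex.DeMoivre field_simps diff_divide_distrib flip: cis_divide)
  then have "(\<Sum>m<N. circle_pt \<epsilon> N m ^ j / circle_pt \<epsilon> N m ^ k) = of_real (\<epsilon> ^ j / \<epsilon> ^ k) * (\<Sum>m<N. y ^ m)"
    by (simp only: sum_distrib_left)
  also have "(\<Sum>m<N. y ^ m) = 0"
    using \<open>y \<noteq> 1\<close> yN by (simp add: geometric_sum)
  finally show ?thesis using False by simp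
qed

text \<open>The degrees j + l are at most 2 * M < N, so the roots of unity see no aliasing, and only
  l = k - j survives.\<close>

lemma circle_pt_coefficient:
  assumes \<epsilon>: "0 < \<epsilon>" and M: "k \<le> M" "j \<le> M" "2 * M < N"
  shows "(\<Sum>m<N. circle_pt \<epsilon> N m ^ j / circle_pt \<epsilon> N m ^ k * exp_poly M (circle_pt \<epsilon> N m * \<beta>)) =
    (if j \<le> k then of_nat N * \<beta> ^ (k - j) / fact (k - j) else 0)"
proof -
  let ?z = "circle_pt \<epsilon> N"
  have "(\<Sum>m<N. ?z m ^ j / ?z m ^ k * exp_poly M (?z m * \<beta>)) =
      (\<Sum>m<N. \<Sum>l\<le>M. \<beta> ^ l / fact l * (?z m ^ (j + l) / ?z m ^ k))"
    unfolding exp_poly_def sum_distrib_left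
    by (intro sum.cong refl) (simp add: power_add power_mult_distrib mult_ac)
  also have "\<dots> = (\<Sum>l\<le>M. \<beta> ^ l / fact l * (\<Sum>m<N. ?z m ^ (j + l) / ?z m ^ k))"
    by (subst sum.swap) (simp add: sum_distrib_left)
  also have "\<dots> = (\<Sum>l\<le>M. \<beta> ^ l / fact l * (if j + l = k then of_nat N else 0))"
    using M by (intro sum.cong refl arg_cong2[where f="(*)"] circle_pt_orthogonal[OF \<epsilon>]) auto
  also have "\<dots> = (\<Sum>l\<le>M. if l = k - j \<and> j \<le> k then \<beta> ^ l / fact l * of_nat N else 0)"
    by (intro sum.cong refl) auto
  also have "\<dots> = (if j \<le> k then of_nat N * \<beta> ^ (k - j) / fact (k - j) else 0)"
    using M by (cases "j \<le> k") (auto simp: mult.commute)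
  finally show ?thesis .
qed

text \<open>Cauchy's integral formula for the \<open>k\<close>-th derivative of \<open>e\<^bsup>-zb(x)\<^esup> T(e\<^bsup>zb\<^esup> f)(x)\<close> at \<open>z = 0\<close>, with
  the exponential replaced by a Taylor polynomial, so that a finite sum over roots of unity is exact.\<close>

lemma commutator_Cauchy_sum:
  fixes X :: "nat \<Rightarrow> 'b::complex_banach"
  assumes \<epsilon>: "0 < \<epsilon>" and M: "k \<le> M" "2 * M < N"
  shows "norm (\<Sum>j\<le>k. (of_nat (k choose j) * \<beta> ^ (k - j)) *\<^sub>C X j) \<le>
    fact k / (\<epsilon> ^ k * real N) * (\<Sum>m<N. norm (exp_poly M (circle_pt \<epsilon> N m * \<beta>)) *
      norm (\<Sum>j\<le>M. (circle_pt \<epsilon> N m ^ j / fact j) *\<^sub>C X j))"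
proof -
  let ?z = "circle_pt \<epsilon> N" and ?E = "\<lambda>m. exp_poly M (circle_pt \<epsilon> N m * \<beta>)"
  have N: "0 < N" using M by simp
  have "(\<Sum>m<N. (fact k / of_nat N * (?E m / ?z m ^ k)) *\<^sub>C (\<Sum>j\<le>M. (?z m ^ j / fact j) *\<^sub>C X j)) =
      (\<Sum>m<N. \<Sum>j\<le>M. (fact k / (of_nat N * fact j) * (?z m ^ j / ?z m ^ k * ?E m)) *\<^sub>C X j)"
    unfolding scaleC_sum_right scaleC_scaleC
    by (intro sum.cong refl arg_cong2[where f=scaleC]) (simp add: field_simps)
  also have "\<dots> = (\<Sum>j\<le>M. (fact k / (of_nat N * fact j) * (\<Sum>m<N. ?z m ^ j / ?z m ^ k * ?E m)) *\<^sub>C X j)"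
    by (subst sum.swap) (simp add: sum_distrib_left scaleC_sum_left)
  also have "\<dots> = (\<Sum>j\<le>M. if j \<le> k then (of_nat (k choose j) * \<beta> ^ (k - j)) *\<^sub>C X j else 0)"
  proof (intro sum.cong refl)
    fix j assume "j \<in> {..M}"
    then have *: "(\<Sum>m<N. ?z m ^ j / ?z m ^ k * ?E m) = (if j \<le> k then of_nat N * \<beta> ^ (k - j) / fact (k - j) else 0)"
      using circle_pt_coefficient[OF \<epsilon> M(1) _ M(2)] by simp
    have "fact k / (of_nat N * fact j) * (of_nat N * \<beta> ^ (k - j) / fact (k - j)) = of_nat (k choose j) * \<beta> ^ (k - j)"
      if "j \<le> k"
      using that N by (simp add: binomial_fact mult.commute)
    then show "(fact k / (of_nat N * fact j) * (\<Sum>m<N. ?z m ^ j / ?z m ^ k * ?E m)) *\<^sub>C X j =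
        (if j \<le> k then (of_nat (k choose j) * \<beta> ^ (k - j)) *\<^sub>C X j else 0)"
      unfolding * by (cases "j \<le> k") (simp_all only: if_True if_False mult_zero_right scaleC_zero_left)
  qed
  also have "\<dots> = (\<Sum>j\<le>k. (of_nat (k choose j) * \<beta> ^ (k - j)) *\<^sub>C X j)"
    using M(1) by (intro sum.mono_neutral_cong_right) auto
  finally have eq: "(\<Sum>m<N. (fact k / of_nat N * (?E m / ?z m ^ k)) *\<^sub>C (\<Sum>j\<le>M. (?z m ^ j / fact j) *\<^sub>C X j)) =
      (\<Sum>j\<le>k. (of_nat (k choose j) * \<beta> ^ (k - j)) *\<^sub>C X j)" .
  have "norm (\<Sum>j\<le>k. (of_nat (k choose j) * \<beta> ^ (k - j)) *\<^sub>C X j) \<le>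
      (\<Sum>m<N. norm ((fact k / of_nat N * (?E m / ?z m ^ k)) *\<^sub>C (\<Sum>j\<le>M. (?z m ^ j / fact j) *\<^sub>C X j)))"
    unfolding eq[symmetric] by (rule norm_sum)
  also have "\<dots> = fact k / (\<epsilon> ^ k * real N) * (\<Sum>m<N. norm (?E m) * norm (\<Sum>j\<le>M. (?z m ^ j / fact j) *\<^sub>C X j))"
    unfolding sum_distrib_left norm_scaleC
    by (intro sum.cong refl) (simp add: norm_mult norm_divide norm_power norm_circle_pt[OF \<epsilon>] mult_ac)
  finally show ?thesis .
qed

section \<open>Weighted estimates for commutators\<close>

lemma Lp_space_nn_integral:
  assumes r: "1 \<le> r" and w: "\<And>x. 0 \<le> w x" and f: "f \<in> Lp_space r (\<lambda>x. w x powr r)"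
  shows "(\<integral>\<^sup>+ x. ennreal (norm (f x) powr r * w x powr r) \<partial>lebesgue) =
    ennreal (Lp_norm r (\<lambda>x. w x powr r) f powr r)"
proof -
  have "(\<integral>\<^sup>+ x. ennreal (norm (f x) powr r * w x powr r) \<partial>lebesgue) =
      ennreal (LINT x|lebesgue. norm (f x) powr r * w x powr r)"
    using f by (intro nn_integral_eq_integral) (auto simp: Lp_space_def)
  also have "(LINT x|lebesgue. norm (f x) powr r * w x powr r) = Lp_norm r (\<lambda>x. w x powr r) f powr r"
    unfolding Lp_norm_def using r by (subst powr_powr) (auto simp: integral_nonneg_AE)
  finally show ?thesis .
qed

lemma Lp_spaceI:
  assumes r: "1 \<le> r" and w: "w \<in> borel_measurable lebesgue"
    and f: "f \<in> borel_measurable lebesgue" and B: "0 \<le> B"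
    and le: "(\<integral>\<^sup>+ x. ennreal (norm (f x) powr r * w x powr r) \<partial>lebesgue) \<le> ennreal (B powr r)"
  shows "f \<in> Lp_space r (\<lambda>x. w x powr r)" "Lp_norm r (\<lambda>x. w x powr r) f \<le> B"
proof -
  note [measurable] = w f
  have int: "integrable lebesgue (\<lambda>x. norm (f x) powr r * w x powr r)"
    using le by (intro integrableI_bounded) (auto intro: le_less_trans)
  then show "f \<in> Lp_space r (\<lambda>x. w x powr r)"
    using f by (simp add: Lp_space_def)
  have "ennreal (LINT x|lebesgue. norm (f x) powr r * w x powr r) \<le> ennreal (B powr r)"
    using le nn_integral_eq_integral[OF int] by simp
  then have "(LINT x|lebesgue. norm (f x) powr r * w x powr r) \<le> B powr r"
    by simp
  then have "Lp_norm r (\<lambda>x. w x powr r) f \<le> (B powr r) powr (1 / r)"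
    unfolding Lp_norm_def using r by (intro powr_mono2) (auto simp: integral_nonneg_AE)
  then show "Lp_norm r (\<lambda>x. w x powr r) f \<le> B"
    using r B by (simp add: powr_powr)
qed

lemma Lp_norm_nonneg: "0 \<le> Lp_norm r v f"
  by (simp add: Lp_norm_def)

text \<open>The factor \<open>norm (f x)\<close> stays on both sides of the domination, so h w' is
  compared with B w only where f does not vanish. This matters when b is bounded only on the support
  of f.\<close>

lemma Lp_space_mult:
  fixes h f :: "real ^ 'n \<Rightarrow> complex"
  assumes r: "1 \<le> r" and w: "\<And>x. 0 \<le> w x" and w': "w' \<in> borel_measurable lebesgue" "\<And>x. 0 \<le> w' x"
    and f: "f \<in> Lp_space r (\<lambda>x. w x powr r)" and h: "h \<in> borel_measurable lebesgue" and B: "0 \<le> B"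
    and le: "\<And>x. norm (h x) * norm (f x) * w' x \<le> B * norm (f x) * w x"
  shows "(\<lambda>x. h x * f x) \<in> Lp_space r (\<lambda>x. w' x powr r)"
    "Lp_norm r (\<lambda>x. w' x powr r) (\<lambda>x. h x * f x) \<le> B * Lp_norm r (\<lambda>x. w x powr r) f"
proof -
  have f': "f \<in> borel_measurable lebesgue" "integrable lebesgue (\<lambda>x. norm (f x) powr r * w x powr r)"
    using f by (auto simp: Lp_space_def)
  have "(\<integral>\<^sup>+ x. ennreal (norm (h x * f x) powr r * w' x powr r) \<partial>lebesgue) \<le>
      (\<integral>\<^sup>+ x. ennreal (B powr r) * ennreal (norm (f x) powr r * w x powr r) \<partial>lebesgue)"
  proof (intro nn_integral_mono)
    fix x
    have "norm (h x * f x) powr r * w' x powr r = (norm (h x) * norm (f x) * w' x) powr r"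
      using w'(2)[of x] by (simp add: norm_mult powr_mult)
    also have "\<dots> \<le> (B * norm (f x) * w x) powr r"
      using r w'(2)[of x] by (intro powr_mono2 le) auto
    also have "\<dots> = B powr r * (norm (f x) powr r * w x powr r)"
      using B w[of x] by (simp add: powr_mult)
    finally show "ennreal (norm (h x * f x) powr r * w' x powr r) \<le>
        ennreal (B powr r) * ennreal (norm (f x) powr r * w x powr r)"
      by (simp add: ennreal_leI flip: ennreal_mult)
  qed
  also have "\<dots> = ennreal (B powr r) * (\<integral>\<^sup>+ x. ennreal (norm (f x) powr r * w x powr r) \<partial>lebesgue)"
    by (intro nn_integral_cmult measurable_compose[OF borel_measurable_integrable[OF f'(2)] measurable_ennreal])
  also have "\<dots> = ennreal ((B * Lp_norm r (\<lambda>x. w x powr r) f) powr r)"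
    using B by (simp add: Lp_space_nn_integral[OF r w f] powr_mult Lp_norm_nonneg flip: ennreal_mult)
  finally have *: "(\<integral>\<^sup>+ x. ennreal (norm (h x * f x) powr r * w' x powr r) \<partial>lebesgue) \<le>
      ennreal ((B * Lp_norm r (\<lambda>x. w x powr r) f) powr r)" .
  show "(\<lambda>x. h x * f x) \<in> Lp_space r (\<lambda>x. w' x powr r)"
    "Lp_norm r (\<lambda>x. w' x powr r) (\<lambda>x. h x * f x) \<le> B * Lp_norm r (\<lambda>x. w x powr r) f"
    using Lp_spaceI[OF r w'(1) _ _ *] f'(1) h B by (auto simp: Lp_norm_nonneg)
qed

text \<open>Convexity of the q-th power from Young's inequality: with A the mean, a m is paired with
  A^(q-1), and the sum is solved for A^q. Used pointwise on the mean over the circle, it lets the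
  q-th powers be integrated term by term.\<close>

lemma mean_powr_le:
  fixes a :: "nat \<Rightarrow> real"
  assumes q: "1 \<le> q" and a: "\<And>m. 0 \<le> a m" and N: "0 < N"
  shows "((\<Sum>m<N. a m) / real N) powr q \<le> (\<Sum>m<N. a m powr q) / real N"
proof (cases "q = 1 \<or> (\<Sum>m<N. a m) = 0")
  case True
  then show ?thesis using a by (auto simp: sum_nonneg)
next
  case False
  then have q1: "1 < q" using q by simp
  define A where "A = (\<Sum>m<N. a m) / real N"
  have "0 < (\<Sum>m<N. a m)"
    using False a by (simp add: less_le sum_nonneg)
  then have A: "0 < A"
    using N by (simp add: A_def)
  have A1: "A * A powr (q - 1) = A powr q"
    using A by (simp add: powr_diff)
  have "a m * A powr (q - 1) \<le> a m powr q / q + A powr q * (1 - 1 / q)" for m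
  proof -
    have "a m * A powr (q - 1) \<le> a m powr q / q + (A powr (q - 1)) powr (q / (q - 1)) / (q / (q - 1))"
      using q1 a by (intro Youngs_inequality) (auto simp: field_simps)
    also have "(A powr (q - 1)) powr (q / (q - 1)) / (q / (q - 1)) = A powr q * (1 - 1 / q)"
    proof -
      have "(q - 1) * (q / (q - 1)) = q" using q1 by simp
      then have "(A powr (q - 1)) powr (q / (q - 1)) = A powr q"
        by (simp only: powr_powr)
      then show ?thesis
        using q1 by (simp add: field_simps)
    qed
    finally show ?thesis .
  qed
  then have "(\<Sum>m<N. a m * A powr (q - 1)) \<le> (\<Sum>m<N. a m powr q / q + A powr q * (1 - 1 / q))"
    by (rule sum_mono)
  then have "(\<Sum>m<N. a m) * A powr (q - 1) \<le> (\<Sum>m<N. a m powr q) / q + real N * (A powr q * (1 - 1 / q))"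
    by (simp add: sum.distrib sum_divide_distrib sum_distrib_right)
  moreover have "(\<Sum>m<N. a m) = real N * A"
    using N by (simp add: A_def)
  ultimately have "real N * A powr q \<le> (\<Sum>m<N. a m powr q) / q + real N * (A powr q * (1 - 1 / q))"
    using A1 by (simp add: mult.assoc)
  then have "real N * A powr q / q \<le> (\<Sum>m<N. a m powr q) / q"
    by (simp add: algebra_simps)
  then show ?thesis
    using q1 N by (simp add: A_def[symmetric] divide_le_cancel field_simps)
qed

text \<open>Both halves of the theorem are instances: a linear operator is treated as a
  linearization of its own norm.\<close>

locale weighted_linearization =
  fixes p q \<theta> s :: real and \<phi> :: "real \<Rightarrow> real" and D :: "(real ^ 'n \<Rightarrow> complex) set"
    and T :: "(real ^ 'n \<Rightarrow> complex) \<Rightarrow> real ^ 'n \<Rightarrow> real"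
    and L :: "(real ^ 'n \<Rightarrow> complex) \<Rightarrow> real ^ 'n \<Rightarrow> 'b :: complex_banach"
  assumes p: "1 \<le> p" and q: "1 \<le> q" and \<theta>: "0 < \<theta>" and s: "1 < s"
    and \<phi>_mono: "mono_on {1..} \<phi>" and \<phi>_nonneg: "\<And>t. 1 \<le> t \<Longrightarrow> 0 \<le> \<phi> t"
    and lin: "linearizes_on D L T" and bound: "weighted_bound p q \<theta> s \<phi> D T"
begin

lemma linear: "linear_operator_on D L"
  using lin by (simp add: linearizes_on_def)

lemma A_norm_ge: "admissible \<theta> s w \<Longrightarrow> 1 \<le> A_norm s (\<lambda>x. w x powr \<theta>)"
  by (intro A_norm_ge_1[OF s]) (simp add: admissible_def)

text \<open>Transfers the hypothesis from T to L. Measurability is obtained only for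
  \<open>norm (L f x)\<close>, since linearization relates T to the norm alone; the later arguments
  have to work with norms.\<close>

lemma operator_bound:
  assumes w: "admissible \<theta> s w" and f: "f \<in> Lp_space p (\<lambda>x. w x powr p)"
  shows "f \<in> D" "(\<lambda>x. norm (L f x)) \<in> borel_measurable lebesgue"
    "(\<integral>\<^sup>+ x. ennreal (norm (L f x) powr q * w x powr q) \<partial>lebesgue) \<le>
      ennreal ((\<phi> (A_norm s (\<lambda>x. w x powr \<theta>)) * Lp_norm p (\<lambda>x. w x powr p) f) powr q)"
proof -
  have "f \<in> D \<and> T f \<in> Lp_space q (\<lambda>x. w x powr q) \<and>
      Lp_norm q (\<lambda>x. w x powr q) (T f) \<le> \<phi> (A_norm s (\<lambda>x. w x powr \<theta>)) * Lp_norm p (\<lambda>x. w x powr p) f"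
    using bound w f unfolding weighted_bound_def admissible_def by blast
  then have D: "f \<in> D" and Tf: "T f \<in> Lp_space q (\<lambda>x. w x powr q)"
    and le: "Lp_norm q (\<lambda>x. w x powr q) (T f) \<le> \<phi> (A_norm s (\<lambda>x. w x powr \<theta>)) * Lp_norm p (\<lambda>x. w x powr p) f"
    by auto
  show "f \<in> D" by fact
  have eq: "AE x in lebesgue. T f x = norm (L f x)"
    using lin D by (simp add: linearizes_on_def)
  have "T f \<in> borel_measurable lebesgue"
    using Tf by (simp add: Lp_space_def)
  then show "(\<lambda>x. norm (L f x)) \<in> borel_measurable lebesgue"
    using eq by (rule borel_measurable_AE)
  have "(\<integral>\<^sup>+ x. ennreal (norm (L f x) powr q * w x powr q) \<partial>lebesgue) =
      (\<integral>\<^sup>+ x. ennreal (norm (T f x) powr q * w x powr q) \<partial>lebesgue)"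
    using eq by (intro nn_integral_cong_AE) (auto elim!: eventually_mono)
  also have "\<dots> = ennreal (Lp_norm q (\<lambda>x. w x powr q) (T f) powr q)"
    by (rule Lp_space_nn_integral[OF q admissible_nonneg[OF w] Tf])
  also have "\<dots> \<le> ennreal ((\<phi> (A_norm s (\<lambda>x. w x powr \<theta>)) * Lp_norm p (\<lambda>x. w x powr p) f) powr q)"
    using q le by (intro ennreal_leI powr_mono2) (auto simp: Lp_norm_nonneg)
  finally show "(\<integral>\<^sup>+ x. ennreal (norm (L f x) powr q * w x powr q) \<partial>lebesgue) \<le>
      ennreal ((\<phi> (A_norm s (\<lambda>x. w x powr \<theta>)) * Lp_norm p (\<lambda>x. w x powr p) f) powr q)" .
qed

text \<open>Freezing b(x) to a constant c turns the expansion into L applied to the single function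
  (\<Sum>j. \<alpha> c j b^j) f, whose norm is measurable by \<open>operator_bound\<close>. The
  Caratheodory lemma then restores c = b(x). The weight w' absorbs the powers of b; it may be w
  itself when b is bounded on the support of f.\<close>

lemma iter_commutator_measurable:
  assumes w: "admissible \<theta> s w" and w': "admissible \<theta> s w'" and b: "b \<in> borel_measurable lebesgue"
    and f: "f \<in> Lp_space p (\<lambda>x. w x powr p)"
    and B: "\<And>j. 0 \<le> B j" "\<And>j x. norm (b x) ^ j * norm (f x) * w' x \<le> B j * norm (f x) * w x"
  shows "(\<lambda>x. norm (iter_commutator k L b f x)) \<in> borel_measurable lebesgue"
proof -
  let ?\<alpha> = "\<lambda>c j. of_nat (k choose j) * (- c) ^ (k - j) :: complex"
  let ?f = "\<lambda>j x. b x ^ j * f x"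
  note nn = admissible_nonneg[OF w] admissible_nonneg[OF w']
  note mw' = admissible_measurable[OF w']
  have fj: "?f j \<in> D" for j
  proof (rule operator_bound(1)[OF w'])
    show "?f j \<in> Lp_space p (\<lambda>x. w' x powr p)"
      using b by (intro Lp_space_mult(1)[OF p nn(1) mw' nn(2) f _ B(1)[of j]])
        (auto simp: norm_power B(2))
  qed
  have "(\<lambda>x. norm (\<Sum>j\<le>k. ?\<alpha> c j *\<^sub>C L (?f j) x)) \<in> borel_measurable lebesgue" for c
  proof -
    have eq: "(\<lambda>x. \<Sum>j\<le>k. ?\<alpha> c j * ?f j x) = (\<lambda>x. (\<Sum>j\<le>k. ?\<alpha> c j * b x ^ j) * f x)"
      by (simp add: sum_distrib_right mult.assoc)
    have "(\<lambda>x. (\<Sum>j\<le>k. ?\<alpha> c j * b x ^ j) * f x) \<in> Lp_space p (\<lambda>x. w' x powr p)"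
    proof (rule Lp_space_mult(1)[OF p nn(1) mw' nn(2) f])
      show "(\<lambda>x. \<Sum>j\<le>k. ?\<alpha> c j * b x ^ j) \<in> borel_measurable lebesgue"
        using b by measurable
      show "0 \<le> (\<Sum>j\<le>k. norm (?\<alpha> c j) * B j)"
        by (intro sum_nonneg mult_nonneg_nonneg B) auto
      fix x
      have "norm (\<Sum>j\<le>k. ?\<alpha> c j * b x ^ j) * norm (f x) * w' x \<le>
          (\<Sum>j\<le>k. norm (?\<alpha> c j) * norm (b x) ^ j) * (norm (f x) * w' x)"
        unfolding mult.assoc[of _ "norm (f x)"] using nn(2)[of x]
        by (intro mult_right_mono) (auto simp: norm_mult norm_power intro!: order_trans[OF norm_sum] sum_mono)
      also have "\<dots> = (\<Sum>j\<le>k. norm (?\<alpha> c j) * (norm (b x) ^ j * norm (f x) * w' x))"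
        unfolding sum_distrib_right by (intro sum.cong refl) (simp only: mult_ac)
      also have "\<dots> \<le> (\<Sum>j\<le>k. norm (?\<alpha> c j) * (B j * norm (f x) * w x))"
        by (intro sum_mono mult_left_mono B) auto
      also have "\<dots> = (\<Sum>j\<le>k. norm (?\<alpha> c j) * B j) * norm (f x) * w x"
        unfolding sum_distrib_right by (intro sum.cong refl) (simp only: mult_ac)
      finally show "norm (\<Sum>j\<le>k. ?\<alpha> c j * b x ^ j) * norm (f x) * w' x \<le>
        (\<Sum>j\<le>k. norm (?\<alpha> c j) * B j) * norm (f x) * w x" .
    qed
    from operator_bound(2)[OF w' this]
    have "(\<lambda>x. norm (L (\<lambda>x. \<Sum>j\<le>k. ?\<alpha> c j * ?f j x) x)) \<in> borel_measurable lebesgue"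
      unfolding eq .
    moreover have "AE x in lebesgue. norm (L (\<lambda>x. \<Sum>j\<le>k. ?\<alpha> c j * ?f j x) x) = norm (\<Sum>j\<le>k. ?\<alpha> c j *\<^sub>C L (?f j) x)"
      using conjunct2[OF linear_operator_on_sum[OF linear, of k ?f "?\<alpha> c"]] fj
      by (auto elim!: eventually_mono)
    ultimately show ?thesis
      by (rule borel_measurable_AE)
  qed
  then have "(\<lambda>x. norm (\<Sum>j\<le>k. ?\<alpha> (b x) j *\<^sub>C L (?f j) x)) \<in> borel_measurable lebesgue"
    by (rule borel_measurable_Caratheodory[OF _ _ b])
      (intro continuous_on_norm continuous_on_sum continuous_on_scaleC_left continuous_intros)
  then show ?thesis
    unfolding iter_commutator_expansion .
qed

definition \<Phi> :: "(real ^ 'n \<Rightarrow> real) \<Rightarrow> real"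
  where "\<Phi> w = \<phi> (4 powr min 1 (s - 1) * 2 powr s * A_norm s (\<lambda>x. w x powr \<theta>))"

text \<open>The perturbation multiplies the constant by at most 2^s, and 4^(min 1 (s-1)) \<ge> 1
  raises this to the argument of \<phi> in the claim.\<close>

lemma \<phi>_le_\<Phi>:
  assumes w: "admissible \<theta> s w" and w': "admissible \<theta> s w'"
    and le: "A_norm s (\<lambda>x. w' x powr \<theta>) \<le> 2 powr s * A_norm s (\<lambda>x. w x powr \<theta>)"
  shows "\<phi> (A_norm s (\<lambda>x. w' x powr \<theta>)) \<le> \<Phi> w"
proof -
  have "1 * (2 powr s * A_norm s (\<lambda>x. w x powr \<theta>)) \<le>
      4 powr min 1 (s - 1) * (2 powr s * A_norm s (\<lambda>x. w x powr \<theta>))"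
    using s A_norm_ge[OF w] by (intro mult_right_mono ge_one_powr_ge_zero) auto
  then have le2: "A_norm s (\<lambda>x. w' x powr \<theta>) \<le> 4 powr min 1 (s - 1) * 2 powr s * A_norm s (\<lambda>x. w x powr \<theta>)"
    using le by (simp only: mult.assoc mult_1_left)
  show ?thesis
    unfolding \<Phi>_def
    by (rule mono_onD[OF \<phi>_mono]) (use A_norm_ge[OF w'] order_trans[OF A_norm_ge[OF w'] le2] le2 in \<open>simp_all only: atLeast_iff\<close>)
qed

lemma \<Phi>_nonneg:
  assumes w: "admissible \<theta> s w"
  shows "0 \<le> \<Phi> w"
proof -
  have "1 * 1 * 1 \<le> 4 powr min 1 (s - 1) * 2 powr s * A_norm s (\<lambda>x. w x powr \<theta>)"
    using s A_norm_ge[OF w] by (intro mult_mono ge_one_powr_ge_zero) auto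
  then show ?thesis
    unfolding \<Phi>_def by (intro \<phi>_nonneg) simp
qed

text \<open>For each root of unity z the weight w is replaced by w e^(-Re(z b)), with b truncated.
  This factor cancels the growth of the Taylor polynomial inside L. The outer Taylor polynomial at
  -z b(x) times w reproduces the same weight where |b| \<le> R, whence the indicator. Each of the
  two approximations costs 1 + \<eta>.\<close>

lemma local_commutator_estimate:
  fixes w :: "real ^ 'n \<Rightarrow> real"
  assumes w: "admissible \<theta> s w" and b: "b \<in> BMO" and t: "BMO_norm b < t"
    and f: "f \<in> Lp_space p (\<lambda>x. w x powr p)" and R: "\<And>x. f x \<noteq> 0 \<Longrightarrow> norm (b x) \<le> R" "0 \<le> R" and \<eta>: "0 < \<eta>"
  defines "\<epsilon> \<equiv> 1 / (bmo_const \<theta> s w * t)"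
  shows "(\<integral>\<^sup>+ x. ennreal (norm (iter_commutator k L b f x) powr q * w x powr q) *
      indicator {x. norm (b x) \<le> R} x \<partial>lebesgue) \<le>
    ennreal ((fact k * (1 + \<eta>) / \<epsilon> ^ k * (\<Phi> w * ((1 + \<eta>) * Lp_norm p (\<lambda>x. w x powr p) f))) powr q)"
proof -
  have t0: "0 < t"
    using t by (auto simp: BMO_norm_def intro: le_less_trans[OF enn2real_nonneg])
  have \<epsilon>: "0 < \<epsilon>"
    using bmo_const_pos[OF s \<theta> w] t0 by (simp add: \<epsilon>_def)
  note wn = admissible_nonneg[OF w] and wm = admissible_measurable[OF w]
  have bm: "b \<in> borel_measurable lebesgue"
    by (rule BMO_measurable[OF b])
  obtain M where M: "k \<le> M" "\<And>u. norm u \<le> \<epsilon> * R \<Longrightarrow> norm (exp_poly M u) \<le> (1 + \<eta>) * exp (Re u)"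
    using exp_poly_bound[OF \<eta>] by blast
  \<comment> \<open>The least number of nodes without aliasing: two Taylor polynomials of degree M
    multiply to degree 2 * M.\<close>
  define N where "N = 2 * M + 1"
  have N: "2 * M < N" "0 < N" by (auto simp: N_def)
  define z where "z = circle_pt \<epsilon> N"
  have nz: "norm (z m) = \<epsilon>" for m
    unfolding z_def by (rule norm_circle_pt[OF \<epsilon>])
  \<comment> \<open>The nearest-point map onto a closed disc is 1-Lipschitz by convexity. It makes
    the exponent bounded on the whole plane without raising its Lipschitz constant
    \<epsilon>.\<close>
  define \<tau> where "\<tau> = closest_point (cball (0 :: complex) R)"
  have \<tau>_bd: "norm (\<tau> y) \<le> R" for y
    using closest_point_in_set[of "cball (0 :: complex) R" y] R(2) by (simp add: \<tau>_def)
  have \<tau>_lip: "norm (\<tau> y - \<tau> y') \<le> norm (y - y')" for y y'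
    using closest_point_lipschitz[of "cball (0 :: complex) R" y y'] R(2) by (simp add: \<tau>_def dist_norm)
  have \<tau>_id: "\<tau> y = y" if "norm y \<le> R" for y
    using that by (simp add: \<tau>_def closest_point_self)
  define g where "g m y = Re (z m * \<tau> y)" for m y
  define W where "W m x = w x * exp (- g m (b x))" for m x
  have g_lip: "\<bar>g m y - g m y'\<bar> \<le> 1 / (bmo_const \<theta> s w * t) * norm (y - y')" for m y y'
  proof -
    have "\<bar>g m y - g m y'\<bar> = \<bar>Re (z m * (\<tau> y - \<tau> y'))\<bar>"
      by (simp add: g_def algebra_simps)
    also have "\<dots> \<le> norm (z m * (\<tau> y - \<tau> y'))"
      by (rule abs_Re_le_cmod)
    also have "\<dots> \<le> \<epsilon> * norm (y - y')"
      using \<tau>_lip \<epsilon> by (simp add: norm_mult nz mult_left_mono)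
    finally show ?thesis by (simp add: \<epsilon>_def)
  qed
  have g_bd: "exp (- g m y) \<le> exp (\<epsilon> * R)" for m y
  proof -
    have "\<bar>g m y\<bar> \<le> norm (z m * \<tau> y)"
      unfolding g_def by (rule abs_Re_le_cmod)
    also have "\<dots> \<le> \<epsilon> * R"
      using \<tau>_bd[of y] \<epsilon> by (simp add: norm_mult nz mult_left_mono)
    finally show ?thesis by simp
  qed
  have W: "admissible \<theta> s (W m)" "A_norm s (\<lambda>x. W m x powr \<theta>) \<le> 2 powr s * A_norm s (\<lambda>x. w x powr \<theta>)" for m
    unfolding W_def by (rule admissible_perturbation[OF s \<theta> w b t g_lip g_bd])+
  define F where "F m x = exp_poly M (z m * b x) * f x" for m x
  have F: "F m \<in> Lp_space p (\<lambda>x. W m x powr p)"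
    "Lp_norm p (\<lambda>x. W m x powr p) (F m) \<le> (1 + \<eta>) * Lp_norm p (\<lambda>x. w x powr p) f" for m
  proof -
    have "norm (exp_poly M (z m * b x)) * norm (f x) * W m x \<le> (1 + \<eta>) * norm (f x) * w x" for x
    proof (cases "f x = 0")
      case False
      then have bR: "norm (b x) \<le> R" by (rule R)
      then have "norm (z m * b x) \<le> \<epsilon> * R"
        using \<epsilon> by (simp add: norm_mult nz mult_left_mono)
      then have "norm (exp_poly M (z m * b x)) * W m x \<le> (1 + \<eta>) * exp (Re (z m * b x)) * W m x"
        using admissible_nonneg[OF W(1)] by (intro mult_right_mono M) auto
      also have "\<dots> = (1 + \<eta>) * w x * (exp (Re (z m * b x)) * exp (- Re (z m * b x)))"
        unfolding W_def g_def \<tau>_id[OF bR] by (simp only: mult_ac)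
      also have "\<dots> = (1 + \<eta>) * w x"
        by (simp only: exp_minus_inverse mult_1_right)
      finally have "norm (f x) * (norm (exp_poly M (z m * b x)) * W m x) \<le> norm (f x) * ((1 + \<eta>) * w x)"
        by (intro mult_left_mono) auto
      then show ?thesis by (simp only: mult_ac)
    qed simp
    note le = this
    have em: "(\<lambda>x. exp_poly M (z m * b x)) \<in> borel_measurable lebesgue"
      unfolding exp_poly_def using bm by measurable
    have "0 \<le> 1 + \<eta>" using \<eta> by simp
    note Lp_space_mult[OF p wn admissible_measurable[OF W(1)] admissible_nonneg[OF W(1)] f em this le]
    then show "F m \<in> Lp_space p (\<lambda>x. W m x powr p)"
      "Lp_norm p (\<lambda>x. W m x powr p) (F m) \<le> (1 + \<eta>) * Lp_norm p (\<lambda>x. w x powr p) f"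
      unfolding F_def by simp_all
  qed
  \<comment> \<open>Here w itself suffices, because b is bounded by R on the support of f.\<close>
  have fj: "(\<lambda>x. b x ^ j * f x) \<in> D" for j
  proof (rule operator_bound(1)[OF w])
    have "norm (b x ^ j) * norm (f x) * w x \<le> R ^ j * norm (f x) * w x" for x
      using R wn[of x] by (cases "f x = 0") (auto simp: norm_power intro!: mult_right_mono power_mono)
    then show "(\<lambda>x. b x ^ j * f x) \<in> Lp_space p (\<lambda>x. w x powr p)"
      using bm R(2) by (intro Lp_space_mult(1)[OF p wn wm wn f, where B="R ^ j"]) auto
  qed
  have ae: "AE x in lebesgue. L (F m) x = (\<Sum>j\<le>M. (z m ^ j / fact j) *\<^sub>C L (\<lambda>x. b x ^ j * f x) x)" for m
  proof -
    have "F m = (\<lambda>x. \<Sum>j\<le>M. z m ^ j / fact j * (b x ^ j * f x))"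
      by (auto simp: F_def exp_poly_def sum_distrib_right power_mult_distrib intro!: ext sum.cong)
    then show ?thesis
      using conjunct2[OF linear_operator_on_sum[OF linear, of M "\<lambda>j x. b x ^ j * f x" "\<lambda>j. z m ^ j / fact j"]] fj
      by simp
  qed
  define c where "c = fact k * (1 + \<eta>) / \<epsilon> ^ k"
  have c: "0 < c" using \<epsilon> \<eta> by (simp add: c_def)
  have ptw: "AE x in lebesgue. ennreal (norm (iter_commutator k L b f x) powr q * w x powr q) * indicator {x. norm (b x) \<le> R} x \<le>
      (\<Sum>m<N. ennreal (c powr q / real N) * ennreal (norm (L (F m) x) powr q * W m x powr q))"
  proof -
    have "AE x in lebesgue. \<forall>m\<in>{..<N}. L (F m) x = (\<Sum>j\<le>M. (z m ^ j / fact j) *\<^sub>C L (\<lambda>x. b x ^ j * f x) x)"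
      using ae by (intro AE_finite_allI) auto
    then show ?thesis
    proof eventually_elim
      case (elim x)
      show ?case
      proof (cases "norm (b x) \<le> R")
        case bR: True
        let ?I = "norm (iter_commutator k L b f x)"
        have Wn: "0 \<le> W m x" for m
          by (rule admissible_nonneg[OF W(1)])
        have "?I \<le> fact k / (\<epsilon> ^ k * real N) * (\<Sum>m<N. norm (exp_poly M (z m * (- b x))) * norm (L (F m) x))"
          using commutator_Cauchy_sum[OF \<epsilon> M(1) N(1), of "- b x" "\<lambda>j. L (\<lambda>x. b x ^ j * f x) x"] elim
          unfolding iter_commutator_expansion z_def by simp
        then have "?I * w x \<le> fact k / (\<epsilon> ^ k * real N) * (\<Sum>m<N. norm (exp_poly M (z m * (- b x))) * norm (L (F m) x)) * w x"
          using wn by (rule mult_right_mono)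
        also have "\<dots> = fact k / (\<epsilon> ^ k * real N) * (\<Sum>m<N. norm (exp_poly M (z m * (- b x))) * w x * norm (L (F m) x))"
          by (simp add: sum_distrib_left sum_distrib_right mult_ac)
        \<comment> \<open>On |b| \<le> R the truncation is the identity, so the Taylor bound at -z
          b(x) turns w into W m, matching the weight in which L (F m) is estimated.\<close>
        also have "\<dots> \<le> fact k / (\<epsilon> ^ k * real N) * (\<Sum>m<N. (1 + \<eta>) * W m x * norm (L (F m) x))"
        proof (intro mult_left_mono sum_mono mult_right_mono)
          fix m
          have "norm (z m * (- b x)) \<le> \<epsilon> * R"
            using bR \<epsilon> by (simp add: norm_mult nz mult_left_mono)
          then have "norm (exp_poly M (z m * (- b x))) * w x \<le> (1 + \<eta>) * exp (Re (z m * (- b x))) * w x"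
            using wn by (intro mult_right_mono M) auto
          also have "\<dots> = (1 + \<eta>) * W m x"
            by (simp add: W_def g_def \<tau>_id[OF bR])
          finally show "norm (exp_poly M (z m * (- b x))) * w x \<le> (1 + \<eta>) * W m x" .
        qed (use \<epsilon> in auto)
        also have "\<dots> = c * ((\<Sum>m<N. norm (L (F m) x) * W m x) / real N)"
          by (simp add: c_def sum_distrib_left sum_divide_distrib mult_ac)
        finally have "(?I * w x) powr q \<le> (c * ((\<Sum>m<N. norm (L (F m) x) * W m x) / real N)) powr q"
          using q wn by (intro powr_mono2) auto
        also have "\<dots> = c powr q * ((\<Sum>m<N. norm (L (F m) x) * W m x) / real N) powr q"
          by (rule powr_mult)
        also have "\<dots> \<le> c powr q * ((\<Sum>m<N. (norm (L (F m) x) * W m x) powr q) / real N)"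
          using Wn N(2) by (intro mult_left_mono mean_powr_le[OF q]) auto
        also have "\<dots> = (\<Sum>m<N. c powr q / real N * (norm (L (F m) x) powr q * W m x powr q))"
          using Wn by (simp add: powr_mult sum_distrib_left sum_divide_distrib)
        finally have "?I powr q * w x powr q \<le> (\<Sum>m<N. c powr q / real N * (norm (L (F m) x) powr q * W m x powr q))"
          using wn[of x] by (simp add: powr_mult)
        then have "ennreal (?I powr q * w x powr q) \<le> ennreal (\<Sum>m<N. c powr q / real N * (norm (L (F m) x) powr q * W m x powr q))"
          by (rule ennreal_leI)
        also have "\<dots> = (\<Sum>m<N. ennreal (c powr q / real N * (norm (L (F m) x) powr q * W m x powr q)))"
          by (rule sum_ennreal[symmetric]) simp
        also have "\<dots> = (\<Sum>m<N. ennreal (c powr q / real N) * ennreal (norm (L (F m) x) powr q * W m x powr q))"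
          by (intro sum.cong refl ennreal_mult) auto
        finally show ?thesis
          using bR by simp
      qed simp
    qed
  qed
  have meas: "(\<lambda>x. ennreal (norm (L (F m) x) powr q * W m x powr q)) \<in> borel_measurable lebesgue" for m
    using operator_bound(2)[OF W(1) F(1)] admissible_measurable[OF W(1)] by measurable
  let ?Y = "\<Phi> w * ((1 + \<eta>) * Lp_norm p (\<lambda>x. w x powr p) f)"
  have Y: "0 \<le> ?Y"
    using \<Phi>_nonneg[OF w] \<eta> by (simp add: Lp_norm_nonneg)
  have each: "(\<integral>\<^sup>+ x. ennreal (norm (L (F m) x) powr q * W m x powr q) \<partial>lebesgue) \<le> ennreal (?Y powr q)" for m
  proof -
    have "\<phi> (A_norm s (\<lambda>x. W m x powr \<theta>)) * Lp_norm p (\<lambda>x. W m x powr p) (F m) \<le> ?Y"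
      using \<Phi>_nonneg[OF w] by (intro mult_mono \<phi>_le_\<Phi>[OF w W] F) (auto simp: Lp_norm_nonneg)
    moreover have "0 \<le> \<phi> (A_norm s (\<lambda>x. W m x powr \<theta>)) * Lp_norm p (\<lambda>x. W m x powr p) (F m)"
      using \<phi>_nonneg[OF A_norm_ge[OF W(1)]] by (simp add: Lp_norm_nonneg)
    ultimately have "ennreal ((\<phi> (A_norm s (\<lambda>x. W m x powr \<theta>)) * Lp_norm p (\<lambda>x. W m x powr p) (F m)) powr q) \<le>
        ennreal (?Y powr q)"
      using q by (intro ennreal_leI powr_mono2) auto
    with operator_bound(3)[OF W(1) F(1)] show ?thesis
      by (rule order_trans)
  qed
  have "(\<integral>\<^sup>+ x. ennreal (norm (iter_commutator k L b f x) powr q * w x powr q) * indicator {x. norm (b x) \<le> R} x \<partial>lebesgue) \<le>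
      (\<integral>\<^sup>+ x. (\<Sum>m<N. ennreal (c powr q / real N) * ennreal (norm (L (F m) x) powr q * W m x powr q)) \<partial>lebesgue)"
    by (rule nn_integral_mono_AE[OF ptw])
  also have "\<dots> = (\<Sum>m<N. ennreal (c powr q / real N) * (\<integral>\<^sup>+ x. ennreal (norm (L (F m) x) powr q * W m x powr q) \<partial>lebesgue))"
    using meas by (subst nn_integral_sum) (auto simp: nn_integral_cmult)
  also have "\<dots> \<le> (\<Sum>m<N. ennreal (c powr q / real N) * ennreal (?Y powr q))"
    by (intro sum_mono mult_left_mono each) auto
  also have "\<dots> = ennreal ((c * ?Y) powr q)"
  proof -
    have "(\<Sum>m<N. ennreal (c powr q / real N) * ennreal (?Y powr q)) =
        (\<Sum>m<N. ennreal (c powr q / real N * ?Y powr q))"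
      by (intro sum.cong refl ennreal_mult[symmetric]) auto
    also have "\<dots> = ennreal (\<Sum>m<N. c powr q / real N * ?Y powr q)"
      by (rule sum_ennreal) simp
    also have "(\<Sum>m<N. c powr q / real N * ?Y powr q) = (c * ?Y) powr q"
      using N(2) c Y by (simp add: powr_mult del: mult_eq_0_iff)
    finally show ?thesis .
  qed
  finally show ?thesis
    unfolding c_def .
qed

end

text \<open>The weight \<open>w e\<^bsup>-\<epsilon>|b|\<^esup>\<close> absorbs all powers of \<open>b\<close>. It is locally integrable because it is bounded by
  \<open>w\<close>, which may fail for \<open>w e\<^bsup>\<epsilon> Re b\<^esup>\<close>.\<close>

lemma admissible_moderation:
  fixes w :: "real ^ 'n \<Rightarrow> real"
  assumes s: "1 < s" and \<theta>: "0 < \<theta>" and w: "admissible \<theta> s w" and b: "b \<in> BMO"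
  obtains w' B where "admissible \<theta> s w'" "\<And>j. 0 \<le> B j" "\<And>j x. norm (b x) ^ j * w' x \<le> B j * w x"
proof -
  define t where "t = BMO_norm b + 1"
  have t: "BMO_norm b < t"
    by (simp add: t_def)
  have t0: "0 < t"
    using t by (auto simp: BMO_norm_def intro: le_less_trans[OF enn2real_nonneg])
  define \<epsilon> where "\<epsilon> = 1 / (bmo_const \<theta> s w * t)"
  have \<epsilon>: "0 < \<epsilon>"
    using bmo_const_pos[OF s \<theta> w] t0 by (simp add: \<epsilon>_def)
  define w' where "w' x = w x * exp (- (\<epsilon> * norm (b x)))" for x
  have w': "admissible \<theta> s w'"
    unfolding w'_def
  proof (rule admissible_perturbation(1)[OF s \<theta> w b t, where g="\<lambda>z. \<epsilon> * norm z" and B=1])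
    fix y z :: complex
    have "\<bar>\<epsilon> * norm y - \<epsilon> * norm z\<bar> = \<epsilon> * \<bar>norm y - norm z\<bar>"
      using \<epsilon> by (simp add: abs_mult flip: right_diff_distrib)
    also have "\<dots> \<le> \<epsilon> * norm (y - z)"
      using \<epsilon> by (intro mult_left_mono norm_triangle_ineq3) auto
    finally show "\<bar>\<epsilon> * norm y - \<epsilon> * norm z\<bar> \<le> 1 / (bmo_const \<theta> s w * t) * norm (y - z)"
      by (simp add: \<epsilon>_def)
  qed (use \<epsilon> in auto)
  note w'n = admissible_nonneg[OF w']
  \<comment> \<open>From y^j \<le> j! e^y at y = \<epsilon> |b|, a single term of the exponential
    series.\<close>
  define B where "B j = fact j / \<epsilon> ^ j" for j
  have B0: "0 \<le> B j" for j using \<epsilon> by (simp add: B_def)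
  have Bw: "norm (b x) ^ j * w' x \<le> B j * w x" for j x
  proof -
    have "(\<epsilon> * norm (b x)) ^ j / fact j \<le> exp (\<epsilon> * norm (b x))"
    proof -
      have "(\<epsilon> * norm (b x)) ^ j / fact j = (\<Sum>i\<in>{j}. (\<epsilon> * norm (b x)) ^ i / fact i)" by simp
      also have "\<dots> \<le> (\<Sum>i. (\<epsilon> * norm (b x)) ^ i / fact i)"
        using \<epsilon> summable_exp[of "\<epsilon> * norm (b x)"] by (intro sum_le_suminf) (auto simp: field_simps)
      also have "\<dots> = exp (\<epsilon> * norm (b x))"
        by (simp add: exp_def divide_inverse mult.commute)
      finally show ?thesis .
    qed
    then have "norm (b x) ^ j \<le> B j * exp (\<epsilon> * norm (b x))"
      using \<epsilon> by (simp add: B_def power_mult_distrib field_simps)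
    then have "norm (b x) ^ j * w' x \<le> B j * exp (\<epsilon> * norm (b x)) * w' x"
      by (rule mult_right_mono) (rule w'n)
    also have "\<dots> = B j * w x"
      by (simp add: w'_def exp_minus)
    finally show ?thesis .
  qed
  show ?thesis
    by (rule that[OF w' B0 Bw])
qed

context weighted_linearization
begin

text \<open>If R bounds b on the support of f, so does R + n. The local estimate therefore holds on
  every set {|b| \<le> R + n} with a bound independent of n after \<eta> tends to 0, and monotone
  convergence covers the whole space.\<close>

lemma bounded_commutator_estimate:
  fixes w :: "real ^ 'n \<Rightarrow> real"
  assumes w: "admissible \<theta> s w" and b: "b \<in> BMO" and t: "BMO_norm b < t"
    and f: "f \<in> Lp_space p (\<lambda>x. w x powr p)" and R: "\<And>x. f x \<noteq> 0 \<Longrightarrow> norm (b x) \<le> R" "0 \<le> R"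
  shows "(\<integral>\<^sup>+ x. ennreal (norm (iter_commutator k L b f x) powr q * w x powr q) \<partial>lebesgue) \<le>
    ennreal ((fact k * (bmo_const \<theta> s w * t) ^ k * (\<Phi> w * Lp_norm p (\<lambda>x. w x powr p) f)) powr q)"
    (is "(\<integral>\<^sup>+ x. ?G x \<partial>lebesgue) \<le> ennreal (?Z powr q)")
proof -
  let ?\<epsilon> = "1 / (bmo_const \<theta> s w * t)" and ?f = "Lp_norm p (\<lambda>x. w x powr p) f"
  let ?H = "\<lambda>n x. ?G x * indicator {x. norm (b x) \<le> R + real n} x"
  note wn = admissible_nonneg[OF w]
  have [measurable]: "b \<in> borel_measurable lebesgue" "w \<in> borel_measurable lebesgue"
    by (rule BMO_measurable[OF b], rule admissible_measurable[OF w])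
  have "norm (b x) ^ j * norm (f x) * w x \<le> R ^ j * norm (f x) * w x" for x j
    using R wn[of x] by (cases "f x = 0") (auto intro!: mult_right_mono power_mono)
  then have [measurable]: "(\<lambda>x. norm (iter_commutator k L b f x)) \<in> borel_measurable lebesgue"
    using R(2) BMO_measurable[OF b] by (intro iter_commutator_measurable[OF w w _ f, where B="\<lambda>j. R ^ j"]) auto
  have t0: "0 < t"
    using t by (auto simp: BMO_norm_def intro: le_less_trans[OF enn2real_nonneg])
  then have \<epsilon>0: "0 < ?\<epsilon>"
    using bmo_const_pos[OF s \<theta> w] by simp
  have eq: "fact k * (1 + 0) / ?\<epsilon> ^ k * (\<Phi> w * ((1 + 0) * ?f)) = ?Z"
    by (simp add: power_one_over)
  have H: "(\<integral>\<^sup>+ x. ?H n x \<partial>lebesgue) \<le> ennreal (?Z powr q)" for n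
  proof (rule tendsto_lowerbound)
    let ?X = "\<lambda>\<eta>. fact k * (1 + \<eta>) / ?\<epsilon> ^ k * (\<Phi> w * ((1 + \<eta>) * ?f))"
    have "(?X \<longlongrightarrow> ?X 0) (at_right 0)"
      using \<epsilon>0 by (intro tendsto_intros) auto
    moreover have "\<forall>\<^sub>F \<eta> in at_right 0. 0 \<le> ?X \<eta>"
    proof (rule eventually_at_rightI[of 0 1])
      fix \<eta> :: real assume \<eta>: "\<eta> \<in> {0<..<1}"
      show "0 \<le> ?X \<eta>"
        using t0 bmo_const_pos[OF s \<theta> w] \<eta> \<Phi>_nonneg[OF w] Lp_norm_nonneg[of p "\<lambda>x. w x powr p" f]
        by (intro mult_nonneg_nonneg divide_nonneg_nonneg zero_le_power) auto
    qed simp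
    ultimately have "((\<lambda>\<eta>. ?X \<eta> powr q) \<longlongrightarrow> ?X 0 powr q) (at_right 0)"
      using q by (intro tendsto_powr' tendsto_const) auto
    then show "((\<lambda>\<eta>. ennreal (?X \<eta> powr q)) \<longlongrightarrow> ennreal (?Z powr q)) (at_right 0)"
      unfolding eq by (rule tendsto_ennrealI)
    show "\<forall>\<^sub>F \<eta> in at_right 0. (\<integral>\<^sup>+ x. ?H n x \<partial>lebesgue) \<le> ennreal (?X \<eta> powr q)"
    proof (rule eventually_at_rightI[of 0 1])
      fix \<eta> :: real assume "\<eta> \<in> {0<..<1}"
      then have \<eta>: "0 < \<eta>" by simp
      have R1: "norm (b x) \<le> R + real n" if "f x \<noteq> 0" for x
        using R(1)[OF that] by simp
      have R2: "0 \<le> R + real n" using R(2) by simp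
      show "(\<integral>\<^sup>+ x. ?H n x \<partial>lebesgue) \<le> ennreal (?X \<eta> powr q)"
        by (rule local_commutator_estimate[OF w b t f R1 R2 \<eta>])
    qed simp
  qed (rule trivial_limit_at_right_real)
  have "(\<integral>\<^sup>+ x. ?G x \<partial>lebesgue) \<le> (\<integral>\<^sup>+ x. (SUP n. ?H n x) \<partial>lebesgue)"
  proof (rule nn_integral_mono)
    fix x
    have "norm (b x) \<le> R + real (nat \<lceil>norm (b x)\<rceil>)"
      using R(2) by linarith
    then have "?G x = ?H (nat \<lceil>norm (b x)\<rceil>) x"
      by simp
    then show "?G x \<le> (SUP n. ?H n x)"
      by (rule order_trans[OF eq_refl SUP_upper]) (rule UNIV_I)
  qed
  also have "\<dots> = (SUP n. \<integral>\<^sup>+ x. ?H n x \<partial>lebesgue)"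
  proof (rule nn_integral_monotone_convergence_SUP)
    have "?H n x \<le> ?H m x" if "n \<le> m" for n m x
      using that by (auto simp: indicator_def)
    then show "incseq ?H"
      by (auto simp: incseq_def le_fun_def)
    have "Measurable.pred lebesgue (\<lambda>x. norm (b x) \<le> R + real n)" for n
      by measurable
    then have [measurable]: "{x. norm (b x) \<le> R + real n} \<in> sets lebesgue" for n
      by (simp add: pred_def)
    show "?H n \<in> borel_measurable lebesgue" for n
      by measurable
  qed
  also have "\<dots> \<le> ennreal (?Z powr q)"
    by (intro SUP_least H)
  finally show ?thesis .
qed

text \<open>f is split into a part on which b is bounded and a tail g n tending to 0 in L^p(w^p).
  For the auxiliary weight w' the functions b^j (g n) tend to 0 as well, so T maps them to functions
  tending to 0 in L^q(w'^q). Along a subsequence the commutators of the cut-off functions then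
  converge almost everywhere, and Fatou's lemma with w transports their uniform bound.\<close>

lemma commutator_estimate:
  fixes w :: "real ^ 'n \<Rightarrow> real"
  assumes w: "admissible \<theta> s w" and b: "b \<in> BMO" and t: "BMO_norm b < t"
    and f: "f \<in> Lp_space p (\<lambda>x. w x powr p)"
  shows "(\<lambda>x. norm (iter_commutator k L b f x)) \<in> borel_measurable lebesgue"
    "(\<integral>\<^sup>+ x. ennreal (norm (iter_commutator k L b f x) powr q * w x powr q) \<partial>lebesgue) \<le>
    ennreal ((fact k * (bmo_const \<theta> s w * t) ^ k * (\<Phi> w * Lp_norm p (\<lambda>x. w x powr p) f)) powr q)"
proof -
  have t0: "0 < t"
    using t by (auto simp: BMO_norm_def intro: le_less_trans[OF enn2real_nonneg])
  note wn = admissible_nonneg[OF w] and wm = admissible_measurable[OF w]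
  have bm: "b \<in> borel_measurable lebesgue"
    by (rule BMO_measurable[OF b])
  have fm: "f \<in> borel_measurable lebesgue" and fi: "integrable lebesgue (\<lambda>x. norm (f x) powr p * w x powr p)"
    using f by (auto simp: Lp_space_def)
  note [measurable] = bm fm wm
  obtain w' B where w': "admissible \<theta> s w'" and B0: "\<And>j. 0 \<le> B j"
    and Bw: "\<And>j x. norm (b x) ^ j * w' x \<le> B j * w x"
    using admissible_moderation[OF s \<theta> w b] by blast
  note w'n = admissible_nonneg[OF w'] and w'm = admissible_measurable[OF w']
  have Bfw: "norm (b x) ^ j * norm (u x) * w' x \<le> B j * norm (u x) * w x" for j x and u :: "real ^ 'n \<Rightarrow> complex"
    using mult_left_mono[OF Bw[of x j] norm_ge_zero[of "u x"]] by (simp only: mult_ac)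
  let ?C = "\<lambda>u x. iter_commutator k L b u x"
  let ?Z = "fact k * (bmo_const \<theta> s w * t) ^ k * (\<Phi> w * Lp_norm p (\<lambda>x. w x powr p) f)"
  have meas: "(\<lambda>x. norm (?C u x)) \<in> borel_measurable lebesgue" if "u \<in> Lp_space p (\<lambda>x. w x powr p)" for u
    by (rule iter_commutator_measurable[OF w w' bm that B0]) (rule Bfw)
  show "(\<lambda>x. norm (?C f x)) \<in> borel_measurable lebesgue"
    by (rule meas[OF f])

  define f' where "f' n x = of_bool (norm (b x) \<le> real n) * f x" for n x
  define g where "g n x = of_bool (real n < norm (b x)) * f x" for n x
  have ind_meas: "(\<lambda>x. of_bool (norm (b x) \<le> real n) :: complex) \<in> borel_measurable lebesgue"
    "(\<lambda>x. of_bool (real n < norm (b x)) :: complex) \<in> borel_measurable lebesgue" for n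
    by measurable
  have f': "f' n \<in> Lp_space p (\<lambda>x. w x powr p)" "Lp_norm p (\<lambda>x. w x powr p) (f' n) \<le> Lp_norm p (\<lambda>x. w x powr p) f" for n
    unfolding f'_def using Lp_space_mult[OF p wn wm wn f ind_meas(1), where B=1] wn by (auto simp: of_bool_def)
  have g: "g n \<in> Lp_space p (\<lambda>x. w x powr p)" for n
    unfolding g_def using Lp_space_mult(1)[OF p wn wm wn f ind_meas(2), where B=1] wn by (auto simp: of_bool_def)
  have Z: "(\<integral>\<^sup>+ x. ennreal (norm (?C (f' n) x) powr q * w x powr q) \<partial>lebesgue) \<le> ennreal (?Z powr q)" for n
  proof -
    have *: "norm (b x) \<le> real n" if "f' n x \<noteq> 0" for x
      using that by (auto simp: f'_def)
    have "fact k * (bmo_const \<theta> s w * t) ^ k * (\<Phi> w * Lp_norm p (\<lambda>x. w x powr p) (f' n)) \<le> ?Z"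
      using bmo_const_pos[OF s \<theta> w] t0 \<Phi>_nonneg[OF w] by (intro mult_left_mono f') auto
    moreover have "0 \<le> fact k * (bmo_const \<theta> s w * t) ^ k * (\<Phi> w * Lp_norm p (\<lambda>x. w x powr p) (f' n))"
      using bmo_const_pos[OF s \<theta> w] t0 \<Phi>_nonneg[OF w] by (simp add: Lp_norm_nonneg)
    ultimately have "ennreal ((fact k * (bmo_const \<theta> s w * t) ^ k * (\<Phi> w * Lp_norm p (\<lambda>x. w x powr p) (f' n))) powr q) \<le>
        ennreal (?Z powr q)"
      using q by (intro ennreal_leI powr_mono2) auto
    moreover have "(\<integral>\<^sup>+ x. ennreal (norm (?C (f' n) x) powr q * w x powr q) \<partial>lebesgue) \<le>
        ennreal ((fact k * (bmo_const \<theta> s w * t) ^ k * (\<Phi> w * Lp_norm p (\<lambda>x. w x powr p) (f' n))) powr q)"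
      by (rule bounded_commutator_estimate[OF w b t f'(1) *]) auto
    ultimately show ?thesis
      by (rule order_trans[rotated])
  qed

  have g_lim: "(\<lambda>n. Lp_norm p (\<lambda>x. w x powr p) (g n)) \<longlonglongrightarrow> 0"
  proof -
    have "(\<lambda>n. LINT x|lebesgue. norm (g n x) powr p * w x powr p) \<longlonglongrightarrow> integral\<^sup>L (lebesgue :: (real ^ 'n) measure) (\<lambda>x. 0 :: real)"
    proof (rule integral_dominated_convergence[where w="\<lambda>x. norm (f x) powr p * w x powr p"])
      show "AE x in lebesgue. (\<lambda>n. norm (g n x) powr p * w x powr p) \<longlonglongrightarrow> 0"
      proof (rule AE_I2)
        fix x
        have "\<forall>\<^sub>F n in sequentially. norm (g n x) powr p * w x powr p = 0"
          using eventually_ge_at_top[of "nat \<lceil>norm (b x)\<rceil>"]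
          by eventually_elim (auto simp: g_def nat_le_iff ceiling_le_iff)
        then show "(\<lambda>n. norm (g n x) powr p * w x powr p) \<longlonglongrightarrow> 0"
          by (rule tendsto_eventually)
      qed
      show "(\<lambda>x. norm (g n x) powr p * w x powr p) \<in> borel_measurable lebesgue" for n
        using g[of n] by (auto simp: Lp_space_def)
    qed (use fi in \<open>auto simp: g_def\<close>)
    then have "(\<lambda>n. (LINT x|lebesgue. norm (g n x) powr p * w x powr p) powr (1 / p)) \<longlonglongrightarrow> 0 powr (1 / p)"
      using p by (intro tendsto_powr') (auto simp: integral_nonneg_AE)
    then show ?thesis
      using p by (simp add: Lp_norm_def)
  qed

  let ?X = "\<lambda>u j x. L (\<lambda>y. b y ^ j * u y) x"
  let ?U = "\<lambda>n j x. norm (?X (g n) j x) powr q * w' x powr q"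
  have bj: "(\<lambda>y. b y ^ j * u y) \<in> Lp_space p (\<lambda>x. w' x powr p)"
    "Lp_norm p (\<lambda>x. w' x powr p) (\<lambda>y. b y ^ j * u y) \<le> B j * Lp_norm p (\<lambda>x. w x powr p) u"
    if "u \<in> Lp_space p (\<lambda>x. w x powr p)" for j u
  proof -
    have "(\<lambda>x. b x ^ j) \<in> borel_measurable lebesgue" by measurable
    note Lp_space_mult[OF p wn w'm w'n that this B0[of j]]
    then show "(\<lambda>y. b y ^ j * u y) \<in> Lp_space p (\<lambda>x. w' x powr p)"
      "Lp_norm p (\<lambda>x. w' x powr p) (\<lambda>y. b y ^ j * u y) \<le> B j * Lp_norm p (\<lambda>x. w x powr p) u"
      using Bfw by (auto simp: norm_power)
  qed
  \<comment> \<open>This value of \<phi> belongs to w'. It multiplies only norms that tend to 0 and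
    so does not reach the final constant.\<close>
  define c where "c = \<phi> (A_norm s (\<lambda>x. w' x powr \<theta>))"
  have c: "0 \<le> c"
    unfolding c_def by (intro \<phi>_nonneg A_norm_ge[OF w'])
  have U_meas: "?U n j \<in> borel_measurable lebesgue" for n j
    using operator_bound(2)[OF w' bj(1)[OF g]] w'm by measurable
  have U_bd: "(\<integral>\<^sup>+ x. ennreal (?U n j x) \<partial>lebesgue) \<le> ennreal ((c * (B j * Lp_norm p (\<lambda>x. w x powr p) (g n))) powr q)" for n j
  proof -
    have "c * Lp_norm p (\<lambda>x. w' x powr p) (\<lambda>y. b y ^ j * g n y) \<le> c * (B j * Lp_norm p (\<lambda>x. w x powr p) (g n))"
      by (intro mult_left_mono bj(2)[OF g] c)
    moreover have "0 \<le> c * Lp_norm p (\<lambda>x. w' x powr p) (\<lambda>y. b y ^ j * g n y)"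
      using c by (simp add: Lp_norm_nonneg)
    ultimately have "ennreal ((c * Lp_norm p (\<lambda>x. w' x powr p) (\<lambda>y. b y ^ j * g n y)) powr q) \<le>
        ennreal ((c * (B j * Lp_norm p (\<lambda>x. w x powr p) (g n))) powr q)"
      using q by (intro ennreal_leI powr_mono2) auto
    with operator_bound(3)[OF w' bj(1)[OF g], folded c_def] show ?thesis
      by (rule order_trans)
  qed
  have U_int: "integrable lebesgue (?U n j)" for n j
    using U_bd[of j n] U_meas[of j n] by (intro integrableI_bounded) (auto intro: le_less_trans)
  have U_le: "(LINT x|lebesgue. ?U n j x) \<le> (c * (B j * Lp_norm p (\<lambda>x. w x powr p) (g n))) powr q" for n j
  proof -
    have "ennreal (LINT x|lebesgue. ?U n j x) \<le> ennreal ((c * (B j * Lp_norm p (\<lambda>x. w x powr p) (g n))) powr q)"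
      using U_bd[of j n] nn_integral_eq_integral[OF U_int[of j n]] by simp
    then show ?thesis by simp
  qed
  have U_lim: "(\<lambda>n. LINT x|lebesgue. ?U n j x) \<longlonglongrightarrow> 0" for j
  proof (rule tendsto_sandwich[OF _ _ tendsto_const])
    have "(\<lambda>n. (c * (B j * Lp_norm p (\<lambda>x. w x powr p) (g n))) powr q) \<longlonglongrightarrow> (c * (B j * 0)) powr q"
      using q c B0 by (intro tendsto_powr' tendsto_mult tendsto_const g_lim) (auto simp: Lp_norm_nonneg)
    then show "(\<lambda>n. (c * (B j * Lp_norm p (\<lambda>x. w x powr p) (g n))) powr q) \<longlonglongrightarrow> 0"
      using q by simp
  qed (use U_le in \<open>auto simp: integral_nonneg_AE\<close>)
  \<comment> \<open>Summing over j before extracting gives a single subsequence that works for every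
    j \<le> k.\<close>
  have sum_lim: "(\<lambda>n. LINT x|lebesgue. norm (\<Sum>j\<le>k. ?U n j x)) \<longlonglongrightarrow> 0"
  proof -
    have "(LINT x|lebesgue. norm (\<Sum>j\<le>k. ?U n j x)) = (\<Sum>j\<le>k. LINT x|lebesgue. ?U n j x)" for n
      using U_int by (subst Bochner_Integration.integral_sum[symmetric]) (auto simp: sum_nonneg abs_of_nonneg)
    moreover have "(\<lambda>n. \<Sum>j\<le>k. LINT x|lebesgue. ?U n j x) \<longlonglongrightarrow> (\<Sum>j\<le>k. 0)"
      by (intro tendsto_sum U_lim)
    ultimately show ?thesis by simp
  qed
  have "integrable lebesgue (\<lambda>x. \<Sum>j\<le>k. ?U n j x)" for n
    by (intro Bochner_Integration.integrable_sum U_int)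
  from tendsto_L1_AE_subseq[OF this sum_lim] obtain r where
    r: "strict_mono r" "AE x in lebesgue. (\<lambda>i. \<Sum>j\<le>k. ?U (r i) j x) \<longlonglongrightarrow> 0"
    by blast

  have split: "AE x in lebesgue. ?X f j x = ?X (f' n) j x + ?X (g n) j x" for n j
  proof -
    have fj: "(\<lambda>y. b y ^ j * f' n y) \<in> D" and gj: "(\<lambda>y. b y ^ j * g n y) \<in> D"
      by (rule operator_bound(1)[OF w' bj(1)[OF f'(1)]], rule operator_bound(1)[OF w' bj(1)[OF g]])
    have "(\<lambda>y. b y ^ j * f y) = (\<lambda>y. 1 * (b y ^ j * f' n y) + 1 * (b y ^ j * g n y))"
      by (auto simp: f'_def g_def)
    then show ?thesis
      using linear_operator_onD(2)[OF linear fj gj, of 1 1] by simp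
  qed
  then have split': "AE x in lebesgue. \<forall>n. \<forall>j. ?X f j x = ?X (f' n) j x + ?X (g n) j x"
    by (simp add: AE_all_countable)
  \<comment> \<open>The limits are known for the norms times w' x. Positivity of w' almost
    everywhere allows the division by w' x, and the result concerns the values of L without any
    weight.\<close>
  have conv: "AE x in lebesgue. (\<lambda>i. norm (?C (f' (r i)) x)) \<longlonglongrightarrow> norm (?C f x)"
    using split' r(2) admissible_pos_AE[OF w']
  proof eventually_elim
    case (elim x)
    have "(\<lambda>i. ?X (g (r i)) j x) \<longlonglongrightarrow> 0" if j: "j \<le> k" for j
    proof -
      have "(\<lambda>i. ?U (r i) j x) \<longlonglongrightarrow> 0"
      proof (rule tendsto_sandwich[OF _ _ tendsto_const elim(2)])
        show "\<forall>\<^sub>F i in sequentially. ?U (r i) j x \<le> (\<Sum>j\<le>k. ?U (r i) j x)"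
          using j by (intro always_eventually allI member_le_sum) auto
      qed auto
      then have "(\<lambda>i. ?U (r i) j x powr (1 / q)) \<longlonglongrightarrow> 0 powr (1 / q)"
        using q by (intro tendsto_powr') auto
      moreover have "?U (r i) j x powr (1 / q) = norm (?X (g (r i)) j x) * w' x" for i
        using q elim(3) by (simp add: powr_mult powr_powr)
      ultimately have "(\<lambda>i. norm (?X (g (r i)) j x) * w' x) \<longlonglongrightarrow> 0"
        using q by simp
      from tendsto_divide[OF this tendsto_const[of "w' x"]]
      have "(\<lambda>i. norm (?X (g (r i)) j x)) \<longlonglongrightarrow> 0"
        using elim(3) by simp
      then show ?thesis
        by (rule tendsto_norm_zero_cancel)
    qed
    then have "(\<lambda>i. ?X f j x - ?X (g (r i)) j x) \<longlonglongrightarrow> ?X f j x - 0" if "j \<le> k" for j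
      using that by (intro tendsto_diff tendsto_const)
    moreover have "?X f j x - ?X (g (r i)) j x = ?X (f' (r i)) j x" for i j
    proof -
      have "?X f j x = ?X (f' (r i)) j x + ?X (g (r i)) j x"
        using elim(1) by blast
      then show ?thesis by (simp only: add_diff_cancel_right')
    qed
    ultimately have "(\<lambda>i. ?X (f' (r i)) j x) \<longlonglongrightarrow> ?X f j x" if "j \<le> k" for j
      using that by simp
    then show ?case
      unfolding iter_commutator_expansion
      by (intro tendsto_norm tendsto_sum tendsto_scaleC_right) auto
  qed

  \<comment> \<open>Almost everywhere convergence does not refer to a weight, so Fatou's lemma can
    be applied with w although the convergence was found with w'.\<close>
  have "(\<integral>\<^sup>+ x. ennreal (norm (?C f x) powr q * w x powr q) \<partial>lebesgue) \<le>
      (\<integral>\<^sup>+ x. liminf (\<lambda>i. ennreal (norm (?C (f' (r i)) x) powr q * w x powr q)) \<partial>lebesgue)"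
  proof (rule nn_integral_mono_AE)
    show "AE x in lebesgue. ennreal (norm (?C f x) powr q * w x powr q) \<le>
        liminf (\<lambda>i. ennreal (norm (?C (f' (r i)) x) powr q * w x powr q))"
      using conv
    proof eventually_elim
      case (elim x)
      have "(\<lambda>i. ennreal (norm (?C (f' (r i)) x) powr q * w x powr q)) \<longlonglongrightarrow> ennreal (norm (?C f x) powr q * w x powr q)"
        using q by (intro tendsto_ennrealI tendsto_mult tendsto_powr' elim tendsto_const) auto
      from lim_imp_Liminf[OF trivial_limit_sequentially this] show ?case
        by (rule eq_refl[OF sym])
    qed
  qed
  also have "\<dots> \<le> liminf (\<lambda>i. \<integral>\<^sup>+ x. ennreal (norm (?C (f' (r i)) x) powr q * w x powr q) \<partial>lebesgue)"
  proof (rule nn_integral_liminf)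
    have [measurable]: "(\<lambda>x. norm (?C (f' n) x)) \<in> borel_measurable lebesgue" for n
      by (rule meas[OF f'(1)])
    show "(\<lambda>x. ennreal (norm (?C (f' (r i)) x) powr q * w x powr q)) \<in> borel_measurable lebesgue" for i
      by measurable
  qed
  also have "\<dots> \<le> liminf (\<lambda>i. ennreal (?Z powr q))"
    by (intro Liminf_mono always_eventually allI Z)
  also have "\<dots> = ennreal (?Z powr q)"
    by (simp add: Liminf_const)
  finally show "(\<integral>\<^sup>+ x. ennreal (norm (?C f x) powr q * w x powr q) \<partial>lebesgue) \<le> ennreal (?Z powr q)" .
qed

text \<open>The bound is continuous in t, so t decreases to \<open>BMO_norm b\<close>; this also
  covers symbols of norm 0.\<close>

lemma commutator_Lp_bound:
  fixes w :: "real ^ 'n \<Rightarrow> real"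
  assumes w: "admissible \<theta> s w" and b: "b \<in> BMO" and f: "f \<in> Lp_space p (\<lambda>x. w x powr p)"
  shows "(\<lambda>x. norm (iter_commutator k L b f x)) \<in> Lp_space q (\<lambda>x. w x powr q)"
    "Lp_norm q (\<lambda>x. w x powr q) (\<lambda>x. norm (iter_commutator k L b f x)) \<le>
      fact k * (bmo_const \<theta> s w * BMO_norm b) ^ k * (\<Phi> w * Lp_norm p (\<lambda>x. w x powr p) f)"
proof -
  let ?Z = "\<lambda>t. fact k * (bmo_const \<theta> s w * t) ^ k * (\<Phi> w * Lp_norm p (\<lambda>x. w x powr p) f)"
  have b0: "0 \<le> BMO_norm b"
    by (simp add: BMO_norm_def)
  have Z0: "0 \<le> ?Z t" if "BMO_norm b < t" for t
    using bmo_const_pos[OF s \<theta> w] \<Phi>_nonneg[OF w] that b0 by (simp add: Lp_norm_nonneg)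
  have *: "(\<lambda>x. norm (iter_commutator k L b f x)) \<in> Lp_space q (\<lambda>x. w x powr q)"
    "Lp_norm q (\<lambda>x. w x powr q) (\<lambda>x. norm (iter_commutator k L b f x)) \<le> ?Z t" if t: "BMO_norm b < t" for t
    using Lp_spaceI[OF q admissible_measurable[OF w] commutator_estimate(1)[OF w b t f] Z0[OF t]]
      commutator_estimate(2)[OF w b t f, of k] by auto
  show "(\<lambda>x. norm (iter_commutator k L b f x)) \<in> Lp_space q (\<lambda>x. w x powr q)"
    by (rule *(1)[of "BMO_norm b + 1"]) simp
  show "Lp_norm q (\<lambda>x. w x powr q) (\<lambda>x. norm (iter_commutator k L b f x)) \<le> ?Z (BMO_norm b)"
  proof (rule tendsto_lowerbound)
    show "(?Z \<longlongrightarrow> ?Z (BMO_norm b)) (at_right (BMO_norm b))"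
      by (intro tendsto_intros)
    show "\<forall>\<^sub>F t in at_right (BMO_norm b). Lp_norm q (\<lambda>x. w x powr q) (\<lambda>x. norm (iter_commutator k L b f x)) \<le> ?Z t"
      by (rule eventually_at_rightI[of _ "BMO_norm b + 1"]) (auto intro!: *(2))
  qed (rule trivial_limit_at_right_real)
qed

end

section \<open>Constants in final form and the two cases of the statement\<close>

lemma commutator_constant:
  assumes s: "1 < s" and w: "admissible \<theta> s w"
  shows "fact k * (bmo_const \<theta> s w * B) ^ k * (P * F) =
    fact k * (2 powr (2 * max s (dual_exponent s) + CARD('n) + 2) * \<theta> / min 1 (s - 1)) ^ k *
    A_norm s (\<lambda>x :: real ^ 'n. w x powr \<theta>) powr (k * max 1 (1 / (s - 1))) * P * B ^ k * F"
proof -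
  have "A_norm s (\<lambda>x. w x powr \<theta>) \<noteq> 0"
    using A_norm_ge_1[OF s, of "\<lambda>x. w x powr \<theta>"] w by (auto simp: admissible_def)
  then have "(A_norm s (\<lambda>x. w x powr \<theta>) powr (max 1 (1 / (s - 1)))) ^ k =
      A_norm s (\<lambda>x. w x powr \<theta>) powr (k * max 1 (1 / (s - 1)))"
    by (simp add: powr_power mult.commute)
  then show ?thesis
    unfolding bmo_const_def by (simp only: power_mult_distrib mult_ac)
qed

lemma linearized_commutator_bound:
  fixes p q \<theta> s :: real and D :: "(real ^ 'n \<Rightarrow> complex) set"
    and L :: "(real ^ 'n \<Rightarrow> complex) \<Rightarrow> real ^ 'n \<Rightarrow> 'b :: complex_banach"
  assumes "weighted_linearization p q \<theta> s \<phi> D T L" and b: "b \<in> BMO"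
    and w: "weight w" "(\<lambda>x. w x powr \<theta>) \<in> A_class s" and f: "f \<in> Lp_space p (\<lambda>x. w x powr p)"
  shows "(\<lambda>x. norm (iter_commutator k L b f x)) \<in> Lp_space q (\<lambda>x. w x powr q)"
    "Lp_norm q (\<lambda>x. w x powr q) (\<lambda>x. norm (iter_commutator k L b f x)) \<le>
      fact k * (2 powr (2 * max s (dual_exponent s) + CARD('n) + 2) * \<theta> / min 1 (s - 1)) ^ k *
      A_norm s (\<lambda>x. w x powr \<theta>) powr (k * max 1 (1 / (s - 1))) *
      \<phi> (4 powr min 1 (s - 1) * 2 powr s * A_norm s (\<lambda>x. w x powr \<theta>)) *
      BMO_norm b ^ k * Lp_norm p (\<lambda>x. w x powr p) f"
proof -
  interpret weighted_linearization p q \<theta> s \<phi> D T L by fact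
  have w': "admissible \<theta> s w"
    using w by (simp add: admissible_def)
  show "(\<lambda>x. norm (iter_commutator k L b f x)) \<in> Lp_space q (\<lambda>x. w x powr q)"
    by (rule commutator_Lp_bound(1)[OF w' b f])
  show "Lp_norm q (\<lambda>x. w x powr q) (\<lambda>x. norm (iter_commutator k L b f x)) \<le>
      fact k * (2 powr (2 * max s (dual_exponent s) + CARD('n) + 2) * \<theta> / min 1 (s - 1)) ^ k *
      A_norm s (\<lambda>x. w x powr \<theta>) powr (k * max 1 (1 / (s - 1))) *
      \<phi> (4 powr min 1 (s - 1) * 2 powr s * A_norm s (\<lambda>x. w x powr \<theta>)) *
      BMO_norm b ^ k * Lp_norm p (\<lambda>x. w x powr p) f"
    using commutator_Lp_bound(2)[OF w' b f, of k]
    unfolding commutator_constant[OF s w'] \<Phi>_def .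
qed

lemma Lp_space_norm_iff:
  "(\<lambda>x. norm (f x)) \<in> Lp_space r v \<longleftrightarrow> f \<in> Lp_space r v" if "f \<in> borel_measurable lebesgue"
    for f :: "real ^ 'n \<Rightarrow> complex"
  using that by (simp add: Lp_space_def)

lemma Lp_norm_norm [simp]: "Lp_norm r v (\<lambda>x. norm (f x)) = Lp_norm r v f"
  by (simp add: Lp_norm_def)

text \<open>The complex numbers serve as Banach space: T linearizes the sublinear operator |T f|,
  which inherits the weighted bound because norms in L^q see only absolute values.\<close>

lemma linear_weighted_linearization:
  fixes T :: "(real ^ 'n \<Rightarrow> complex) \<Rightarrow> real ^ 'n \<Rightarrow> complex"
  assumes "1 \<le> p" "1 \<le> q" "0 < \<theta>" "1 < s" "mono_on {1..} \<phi>" "\<And>t. 1 \<le> t \<Longrightarrow> 0 \<le> \<phi> t"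
    and T: "linear_operator_on D T" "weighted_bound p q \<theta> s \<phi> D T"
  shows "weighted_linearization p q \<theta> s \<phi> D (\<lambda>f x. norm (T f x)) T"
proof
  show "linearizes_on D T (\<lambda>f x. norm (T f x))"
    using T(1) by (simp add: linearizes_on_def)
  show "weighted_bound p q \<theta> s \<phi> D (\<lambda>f x. norm (T f x))"
    unfolding weighted_bound_def
  proof (intro allI impI ballI)
    fix w and f :: "real ^ 'n \<Rightarrow> complex"
    assume "weight w \<and> (\<lambda>x. w x powr \<theta>) \<in> A_class s" "f \<in> Lp_space p (\<lambda>x. w x powr p)"
    then have *: "f \<in> D" "T f \<in> Lp_space q (\<lambda>x. w x powr q)" "Lp_norm q (\<lambda>x. w x powr q) (T f) \<le>
        \<phi> (A_norm s (\<lambda>x. w x powr \<theta>)) * Lp_norm p (\<lambda>x. w x powr p) f"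
      using T(2) unfolding weighted_bound_def by blast+
    moreover have "T f \<in> borel_measurable lebesgue"
      using *(2) by (simp add: Lp_space_def)
    ultimately show "f \<in> D \<and> (\<lambda>x. norm (T f x)) \<in> Lp_space q (\<lambda>x. w x powr q) \<and>
        Lp_norm q (\<lambda>x. w x powr q) (\<lambda>x. norm (T f x)) \<le>
        \<phi> (A_norm s (\<lambda>x. w x powr \<theta>)) * Lp_norm p (\<lambda>x. w x powr p) f"
      by (simp add: Lp_space_norm_iff)
  qed
qed (use assms in auto)

text \<open>For linear T the claim places the commutator itself in L^q, so measurability of its norm
  is not enough. Each T(b^j f) is measurable because b^j f lies in L^p for the moderated weight w',
  and the expansion combines these functions.\<close>

lemma linear_iter_commutator_measurable:
  fixes T :: "(real ^ 'n \<Rightarrow> complex) \<Rightarrow> real ^ 'n \<Rightarrow> complex"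
  assumes p: "1 \<le> p" and \<theta>: "0 < \<theta>" and s: "1 < s" and T: "weighted_bound p q \<theta> s \<phi> D T" and b: "b \<in> BMO"
    and w: "admissible \<theta> s w" and f: "f \<in> Lp_space p (\<lambda>x. w x powr p)"
  shows "iter_commutator k T b f \<in> borel_measurable lebesgue"
proof -
  obtain w' B where w': "admissible \<theta> s w'" and B0: "\<And>j. 0 \<le> B j"
    and Bw: "\<And>j x. norm (b x) ^ j * w' x \<le> B j * w x"
    using admissible_moderation[OF s \<theta> w b] by blast
  have bm [measurable]: "b \<in> borel_measurable lebesgue"
    by (rule BMO_measurable[OF b])
  have [measurable]: "T (\<lambda>y. b y ^ j * f y) \<in> borel_measurable lebesgue" for j
  proof -
    have "norm (b x ^ j) * norm (f x) * w' x \<le> B j * norm (f x) * w x" for x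
      using mult_left_mono[OF Bw[of x j] norm_ge_zero[of "f x"]] by (simp only: mult_ac norm_power)
    then have "(\<lambda>y. b y ^ j * f y) \<in> Lp_space p (\<lambda>x. w' x powr p)"
      by (intro Lp_space_mult(1)[OF p admissible_nonneg[OF w] admissible_measurable[OF w'] admissible_nonneg[OF w'] f _ B0[of j]])
        measurable
    then have "T (\<lambda>y. b y ^ j * f y) \<in> Lp_space q (\<lambda>x. w' x powr q)"
      using T w' unfolding weighted_bound_def admissible_def by blast
    then show ?thesis by (simp add: Lp_space_def)
  qed
  show ?thesis
    unfolding iter_commutator_expansion[abs_def] scaleC_complex_def by measurable
qed

theorem theorem3p22:
  fixes p q \<theta> s :: real
    and \<phi> :: "real \<Rightarrow> real"
    and D :: "(real ^ 'n \<Rightarrow> complex) set"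
  assumes "1 \<le> p" and "1 \<le> q" and "0 < \<theta>" and "1 < s"
    and "mono_on {1..} \<phi>" and "\<And>t. 1 \<le> t \<Longrightarrow> 0 \<le> \<phi> t"
  shows
    "(\<forall>T :: (real ^ 'n \<Rightarrow> complex) \<Rightarrow> real ^ 'n \<Rightarrow> complex.
        linear_operator_on D T \<and> weighted_bound p q \<theta> s \<phi> D T \<longrightarrow>
        (\<forall>b \<in> BMO. \<forall>w. weight w \<and> (\<lambda>x. w x powr \<theta>) \<in> A_class s \<longrightarrow>
          (\<forall>f \<in> Lp_space p (\<lambda>x. w x powr p).
            commutator T b f \<in> Lp_space q (\<lambda>x. w x powr q) \<and>
            Lp_norm q (\<lambda>x. w x powr q) (commutator T b f) \<le>
              (2 powr (2 * max s (dual_exponent s) + CARD('n) + 2) * \<theta> / min 1 (s - 1)) *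
              A_norm s (\<lambda>x. w x powr \<theta>) powr (max 1 (1 / (s - 1))) *
              \<phi> (4 powr min 1 (s - 1) * 2 powr s * A_norm s (\<lambda>x. w x powr \<theta>)) *
              BMO_norm b * Lp_norm p (\<lambda>x. w x powr p) f \<and>
            (\<forall>k\<ge>2.
              iter_commutator k T b f \<in> Lp_space q (\<lambda>x. w x powr q) \<and>
              Lp_norm q (\<lambda>x. w x powr q) (iter_commutator k T b f) \<le>
                fact k * (2 powr (2 * max s (dual_exponent s) + CARD('n) + 2) * \<theta> / min 1 (s - 1)) ^ k *
                A_norm s (\<lambda>x. w x powr \<theta>) powr (k * max 1 (1 / (s - 1))) *
                \<phi> (4 powr min 1 (s - 1) * 2 powr s * A_norm s (\<lambda>x. w x powr \<theta>)) *
                BMO_norm b ^ k * Lp_norm p (\<lambda>x. w x powr p) f))))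
     \<and>
     (\<forall>(T :: (real ^ 'n \<Rightarrow> complex) \<Rightarrow> real ^ 'n \<Rightarrow> real)
       (L :: (real ^ 'n \<Rightarrow> complex) \<Rightarrow> real ^ 'n \<Rightarrow> 'b :: complex_banach).
        linearizes_on D L T \<and> weighted_bound p q \<theta> s \<phi> D T \<longrightarrow>
        (\<forall>b \<in> BMO. \<forall>w. weight w \<and> (\<lambda>x. w x powr \<theta>) \<in> A_class s \<longrightarrow>
          (\<forall>f \<in> Lp_space p (\<lambda>x. w x powr p).
            linearized_commutator 1 L b f \<in> Lp_space q (\<lambda>x. w x powr q) \<and>
            Lp_norm q (\<lambda>x. w x powr q) (linearized_commutator 1 L b f) \<le>
              (2 powr (2 * max s (dual_exponent s) + CARD('n) + 2) * \<theta> / min 1 (s - 1)) *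
              A_norm s (\<lambda>x. w x powr \<theta>) powr (max 1 (1 / (s - 1))) *
              \<phi> (4 powr min 1 (s - 1) * 2 powr s * A_norm s (\<lambda>x. w x powr \<theta>)) *
              BMO_norm b * Lp_norm p (\<lambda>x. w x powr p) f \<and>
            (\<forall>k\<ge>2.
              linearized_commutator k L b f \<in> Lp_space q (\<lambda>x. w x powr q) \<and>
              Lp_norm q (\<lambda>x. w x powr q) (linearized_commutator k L b f) \<le>
                fact k * (2 powr (2 * max s (dual_exponent s) + CARD('n) + 2) * \<theta> / min 1 (s - 1)) ^ k *
                A_norm s (\<lambda>x. w x powr \<theta>) powr (k * max 1 (1 / (s - 1))) *
                \<phi> (4 powr min 1 (s - 1) * 2 powr s * A_norm s (\<lambda>x. w x powr \<theta>)) *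
                BMO_norm b ^ k * Lp_norm p (\<lambda>x. w x powr p) f))))"
proof (intro conjI allI impI ballI; (elim conjE)?)
  fix T :: "(real ^ 'n \<Rightarrow> complex) \<Rightarrow> real ^ 'n \<Rightarrow> complex"
    and b f :: "real ^ 'n \<Rightarrow> complex" and w :: "real ^ 'n \<Rightarrow> real"
  assume T: "linear_operator_on D T" "weighted_bound p q \<theta> s \<phi> D T" and b: "b \<in> BMO"
    and w: "weight w" "(\<lambda>x. w x powr \<theta>) \<in> A_class s" and f: "f \<in> Lp_space p (\<lambda>x. w x powr p)"
  have m: "iter_commutator k T b f \<in> borel_measurable lebesgue" for k
    using w by (intro linear_iter_commutator_measurable[OF assms(1,3,4) T(2) b _ f]) (simp add: admissible_def)
  \<comment> \<open>One estimate for all k; k = 1 gives the first claim, since its factorial and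
    powers are trivial.\<close>
  note bd = linearized_commutator_bound[OF linear_weighted_linearization[OF assms T] b w f]
  have one: "commutator T b f = iter_commutator 1 T b f"
    by (simp add: iter_commutator_def)
  show "commutator T b f \<in> Lp_space q (\<lambda>x. w x powr q)"
    using bd(1)[of 1] m[of 1] unfolding one by (simp only: Lp_space_norm_iff)
  show "iter_commutator k T b f \<in> Lp_space q (\<lambda>x. w x powr q)" for k
    using bd(1)[of k] m[of k] by (simp only: Lp_space_norm_iff)
  show "Lp_norm q (\<lambda>x. w x powr q) (commutator T b f) \<le>
      (2 powr (2 * max s (dual_exponent s) + CARD('n) + 2) * \<theta> / min 1 (s - 1)) *
      A_norm s (\<lambda>x. w x powr \<theta>) powr (max 1 (1 / (s - 1))) *
      \<phi> (4 powr min 1 (s - 1) * 2 powr s * A_norm s (\<lambda>x. w x powr \<theta>)) *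
      BMO_norm b * Lp_norm p (\<lambda>x. w x powr p) f"
    using bd(2)[of 1] unfolding one by (simp only: Lp_norm_norm fact_1 power_one_right of_nat_1 mult_1_left)
  show "Lp_norm q (\<lambda>x. w x powr q) (iter_commutator k T b f) \<le>
      fact k * (2 powr (2 * max s (dual_exponent s) + CARD('n) + 2) * \<theta> / min 1 (s - 1)) ^ k *
      A_norm s (\<lambda>x. w x powr \<theta>) powr (k * max 1 (1 / (s - 1))) *
      \<phi> (4 powr min 1 (s - 1) * 2 powr s * A_norm s (\<lambda>x. w x powr \<theta>)) *
      BMO_norm b ^ k * Lp_norm p (\<lambda>x. w x powr p) f" for k
    using bd(2)[of k] by (simp only: Lp_norm_norm)
next
  fix T :: "(real ^ 'n \<Rightarrow> complex) \<Rightarrow> real ^ 'n \<Rightarrow> real"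
    and L :: "(real ^ 'n \<Rightarrow> complex) \<Rightarrow> real ^ 'n \<Rightarrow> 'b"
    and b f :: "real ^ 'n \<Rightarrow> complex" and w :: "real ^ 'n \<Rightarrow> real"
  assume L: "linearizes_on D L T" "weighted_bound p q \<theta> s \<phi> D T" and b: "b \<in> BMO"
    and w: "weight w" "(\<lambda>x. w x powr \<theta>) \<in> A_class s" and f: "f \<in> Lp_space p (\<lambda>x. w x powr p)"
  have "weighted_linearization p q \<theta> s \<phi> D T L"
    by unfold_locales (use assms L in auto)
  note bd = linearized_commutator_bound[OF this b w f]
  show "linearized_commutator 1 L b f \<in> Lp_space q (\<lambda>x. w x powr q)"
    "linearized_commutator k L b f \<in> Lp_space q (\<lambda>x. w x powr q)" for k
    unfolding linearized_commutator_def by (rule bd(1))+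
  show "Lp_norm q (\<lambda>x. w x powr q) (linearized_commutator 1 L b f) \<le>
      (2 powr (2 * max s (dual_exponent s) + CARD('n) + 2) * \<theta> / min 1 (s - 1)) *
      A_norm s (\<lambda>x. w x powr \<theta>) powr (max 1 (1 / (s - 1))) *
      \<phi> (4 powr min 1 (s - 1) * 2 powr s * A_norm s (\<lambda>x. w x powr \<theta>)) *
      BMO_norm b * Lp_norm p (\<lambda>x. w x powr p) f"
    using bd(2)[of 1] unfolding linearized_commutator_def
    by (simp only: fact_1 power_one_right of_nat_1 mult_1_left)
  show "Lp_norm q (\<lambda>x. w x powr q) (linearized_commutator k L b f) \<le>
      fact k * (2 powr (2 * max s (dual_exponent s) + CARD('n) + 2) * \<theta> / min 1 (s - 1)) ^ k *
      A_norm s (\<lambda>x. w x powr \<theta>) powr (k * max 1 (1 / (s - 1))) *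
      \<phi> (4 powr min 1 (s - 1) * 2 powr s * A_norm s (\<lambda>x. w x powr \<theta>)) *
      BMO_norm b ^ k * Lp_norm p (\<lambda>x. w x powr p) f" for k
    using bd(2)[of k] unfolding linearized_commutator_def .
qed

end
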